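(* The system $\mathsf{P}_0$ proves $\mathsf{ULC}_{\mathsf{ns}}$, and from this proof one can extract a closed term $t$ such that $\mathsf{E\text{-}PRA}^{\omega*}$ proves $\mathsf{ULC}_{\mathsf{ef}}(t)$. Here: $\mathsf{ULC}_{\mathsf{ns}}$: for all $f:\mathbb R\to\mathbb R$ and all sequences $(f_n)_n$ of functions $\mathbb R\to\mathbb R$, if for every standard $n$, $(\forall^{\mathrm{st}}x\in[0,1])(\forall y\in[0,1])[x\approx y\to f_n(x)\approx f_n(y)]$, and $(\forall x\in[0,1])(\forall N\in\Omega)(f_N(x)\approx f(x))$, then $(\forall^{\mathrm{st}}x\in[0,1])(\forall y\in[0,1])[x\approx y\to f(x)\approx f(y)]$. $\mathsf{ULC}_{\mathsf{ef}}(t)$: for all $f$, $(f_n)_n$, $(g_n)_n$, $h$: if $(\forall n,k)(\forall x,y\in[0,1])\big(|x-y|\le\frac{1}{g_n(x,k)}\to|f_n(x)-f_n(y)|\le\frac1k\big)$ and $(\forall k)(\forall x\in[0,1])(\forall N\ge h(k))\big(|f_N(x)-f(x)|\le\frac1k\big)$, then $(\forall k)(\forall x,y\in[0,1])\big(|x-y|<\frac{1}{t(g_{(\cdot)},h,k,x)}\to|f(x)-f(y)|<\frac1k\big)$.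
   Context: $\mathsf{E\text{-}PRA}^{\omega*}$: Kohlenbach's extensional primitive recursive arithmetic in all finite types with finite sequence types. Add predicate $\mathrm{st}$; $(\forall^{\mathrm{st}}x)A:\equiv(\forall x)(\mathrm{st}(x)\to A)$, $(\exists^{\mathrm{st}}x)A:\equiv(\exists x)(\mathrm{st}(x)\wedge A)$; internal = no $\mathrm{st}$; for $N^0$, $N\in\Omega$ means $\neg\mathrm{st}(N)$. $\mathsf{P}_0:=\mathsf{E\text{-}PRA}^{\omega*}+\mathcal{T}^*_{\mathrm{st}}+\mathsf{HAC}_{\mathrm{int}}+\mathsf{I}+\mathsf{QF\text{-}AC}^{1,0}$ with $\mathcal{T}^*_{\mathrm{st}}$: $\mathrm{st}(x)\wedge x=y\to\mathrm{st}(y)$, $\mathrm{st}(t)$ for closed terms, $\mathrm{st}(f)\wedge\mathrm{st}(x)\to\mathrm{st}(f(x))$; $\mathsf{HAC}_{\mathrm{int}}$ (internal $\varphi$): $(\forall^{\mathrm{st}}x^\rho)(\exists^{\mathrm{st}}y^\tau)\varphi\to(\exists^{\mathrm{st}}F^{\rho\to\tau^*})(\forall^{\mathrm{st}}x)(\exists y\in F(x))\varphi(x,y)$; $\mathsf{I}$ (internal $\varphi$): $(\forall^{\mathrm{st}}x^{\sigma^*})(\exists y)(\forall z\in x)\varphi(z,y)\to(\exists y)(\forall^{\mathrm{st}}x)\varphi(x,y)$; $\mathsf{QF\text{-}AC}^{1,0}$: $(\forall x^1)(\exists y^0)\varphi\to(\exists F^{1\to0})(\forall x)\varphi(x,F(x))$,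 $\varphi$ quantifier-free internal. Reals: fast-converging Cauchy sequences of rationals $(q_n)$; $x\approx y$ iff $(\forall^{\mathrm{st}}n)(|q_n-r_n|\le2^{-n})$; functions $\mathbb R\to\mathbb R$ are type $1\to1$ functionals respecting real equality. *)

theory Defs
  imports Main
begin

section \<open>Finite types, terms, formulas\<close>

datatype ty = N | Fun ty ty (infixr "\<rightarrow>" 60) | Seq ty

abbreviation N1 :: ty where "N1 \<equiv> N \<rightarrow> N"

text \<open>
  \<open>CPi\<close>, \<open>CSigma\<close> are the typed combinators and \<open>CRec\<close> is the recursor with values of type \<open>N\<close>.
  The constants for finite sequences are the empty sequence, prefixing, the sequence recursor
  (again with values of type \<open>N\<close>: with values of arbitrary type it would give Goedel's recursors
  rather than Kleene's), the projections, and \<open>CSeg\<close>, which maps \<open>f\<close> and \<open>n\<close> to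
  \<open>\<langle>f 0, \<dots>, f (n - 1)\<rangle>\<close>. Coding a sequence of type \<open>Seq \<sigma>\<close> by its length and a function of
  type \<open>N \<rightarrow> \<sigma>\<close>, all of them are definable in the theory without sequence types.
\<close>

datatype cst =
    CZero | CSucc | CPi ty ty | CSigma ty ty ty | CRec
  | CNil ty | CCons ty | CLRec ty | CNth ty | CSeg ty

fun cty :: "cst \<Rightarrow> ty" where
  "cty CZero = N"
| "cty CSucc = N \<rightarrow> N"
| "cty (CPi \<rho> \<tau>) = \<rho> \<rightarrow> \<tau> \<rightarrow> \<rho>"
| "cty (CSigma \<delta> \<rho> \<tau>) = (\<delta> \<rightarrow> \<rho> \<rightarrow> \<tau>) \<rightarrow> (\<delta> \<rightarrow> \<rho>) \<rightarrow> \<delta> \<rightarrow> \<tau>"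
| "cty CRec = N \<rightarrow> N \<rightarrow> (N \<rightarrow> N \<rightarrow> N) \<rightarrow> N"
| "cty (CNil \<sigma>) = Seq \<sigma>"
| "cty (CCons \<sigma>) = \<sigma> \<rightarrow> Seq \<sigma> \<rightarrow> Seq \<sigma>"
| "cty (CLRec \<sigma>) = Seq \<sigma> \<rightarrow> N \<rightarrow> (N \<rightarrow> \<sigma> \<rightarrow> N) \<rightarrow> N"
| "cty (CNth \<sigma>) = Seq \<sigma> \<rightarrow> N \<rightarrow> \<sigma>"
| "cty (CSeg \<sigma>) = (N \<rightarrow> \<sigma>) \<rightarrow> N \<rightarrow> Seq \<sigma>"

text \<open>
  Locally nameless syntax: free variables are named and typed, bound variables are de Bruijn
  indices. A term without dangling indices can be put under binders as it is.
\<close>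

type_synonym var = "string \<times> ty"

datatype tm = FV var | BV nat | Cn cst | App tm tm (infixl "\<cdot>" 100)

datatype fm =
    Eq ty tm tm
  | St ty tm
  | Fls
  | Imp fm fm (infixr "\<^bold>\<longrightarrow>" 55)
  | Con fm fm (infixr "\<^bold>\<and>" 65)
  | Dis fm fm (infixr "\<^bold>\<or>" 60)
  | All ty fm
  | Ex ty fm

abbreviation Neg :: "fm \<Rightarrow> fm" ("\<^bold>\<not> _" [70] 70) where
  "\<^bold>\<not> \<phi> \<equiv> \<phi> \<^bold>\<longrightarrow> Fls"

abbreviation Iff :: "fm \<Rightarrow> fm \<Rightarrow> fm" (infixr "\<^bold>\<longleftrightarrow>" 50) where
  "\<phi> \<^bold>\<longleftrightarrow> \<psi> \<equiv> (\<phi> \<^bold>\<longrightarrow> \<psi>) \<^bold>\<and> (\<psi> \<^bold>\<longrightarrow> \<phi>)"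

text \<open>The list \<open>\<Delta>\<close> holds the types of the enclosing binders, innermost first.\<close>

fun tty :: "ty list \<Rightarrow> tm \<Rightarrow> ty option" where
  "tty \<Delta> (FV v) = Some (snd v)"
| "tty \<Delta> (BV i) = (if i < length \<Delta> then Some (\<Delta> ! i) else None)"
| "tty \<Delta> (Cn c) = Some (cty c)"
| "tty \<Delta> (s \<cdot> t) =
    (case (tty \<Delta> s, tty \<Delta> t) of
       (Some (\<sigma> \<rightarrow> \<tau>), Some \<rho>) \<Rightarrow> if \<rho> = \<sigma> then Some \<tau> else None
     | _ \<Rightarrow> None)"

abbreviation ofty :: "tm \<Rightarrow> ty \<Rightarrow> bool" (infix "ofty" 50) where
  "t ofty \<sigma> \<equiv> tty [] t = Some \<sigma>"

fun wff :: "ty list \<Rightarrow> fm \<Rightarrow> bool" where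
  "wff \<Delta> (Eq \<sigma> s t) \<longleftrightarrow> tty \<Delta> s = Some \<sigma> \<and> tty \<Delta> t = Some \<sigma>"
| "wff \<Delta> (St \<sigma> t) \<longleftrightarrow> tty \<Delta> t = Some \<sigma>"
| "wff \<Delta> Fls \<longleftrightarrow> True"
| "wff \<Delta> (\<phi> \<^bold>\<longrightarrow> \<psi>) \<longleftrightarrow> wff \<Delta> \<phi> \<and> wff \<Delta> \<psi>"
| "wff \<Delta> (\<phi> \<^bold>\<and> \<psi>) \<longleftrightarrow> wff \<Delta> \<phi> \<and> wff \<Delta> \<psi>"
| "wff \<Delta> (\<phi> \<^bold>\<or> \<psi>) \<longleftrightarrow> wff \<Delta> \<phi> \<and> wff \<Delta> \<psi>"
| "wff \<Delta> (All \<sigma> \<phi>) \<longleftrightarrow> wff (\<sigma> # \<Delta>) \<phi>"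
| "wff \<Delta> (Ex \<sigma> \<phi>) \<longleftrightarrow> wff (\<sigma> # \<Delta>) \<phi>"

fun internal :: "fm \<Rightarrow> bool" where
  "internal (Eq \<sigma> s t) \<longleftrightarrow> True"
| "internal (St \<sigma> t) \<longleftrightarrow> False"
| "internal Fls \<longleftrightarrow> True"
| "internal (\<phi> \<^bold>\<longrightarrow> \<psi>) \<longleftrightarrow> internal \<phi> \<and> internal \<psi>"
| "internal (\<phi> \<^bold>\<and> \<psi>) \<longleftrightarrow> internal \<phi> \<and> internal \<psi>"
| "internal (\<phi> \<^bold>\<or> \<psi>) \<longleftrightarrow> internal \<phi> \<and> internal \<psi>"
| "internal (All \<sigma> \<phi>) \<longleftrightarrow> internal \<phi>"
| "internal (Ex \<sigma> \<phi>) \<longleftrightarrow> internal \<phi>"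

text \<open>
  Only equations of type \<open>N\<close> are quantifier-free: equality of a higher type amounts to a
  universal statement.
\<close>

fun qf :: "fm \<Rightarrow> bool" where
  "qf (Eq \<sigma> s t) \<longleftrightarrow> \<sigma> = N"
| "qf (St \<sigma> t) \<longleftrightarrow> False"
| "qf Fls \<longleftrightarrow> True"
| "qf (\<phi> \<^bold>\<longrightarrow> \<psi>) \<longleftrightarrow> qf \<phi> \<and> qf \<psi>"
| "qf (\<phi> \<^bold>\<and> \<psi>) \<longleftrightarrow> qf \<phi> \<and> qf \<psi>"
| "qf (\<phi> \<^bold>\<or> \<psi>) \<longleftrightarrow> qf \<phi> \<and> qf \<psi>"
| "qf (All \<sigma> \<phi>) \<longleftrightarrow> False"
| "qf (Ex \<sigma> \<phi>) \<longleftrightarrow> False"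

fun tfv :: "tm \<Rightarrow> var set" where
  "tfv (FV v) = {v}"
| "tfv (BV i) = {}"
| "tfv (Cn c) = {}"
| "tfv (s \<cdot> t) = tfv s \<union> tfv t"

fun ffv :: "fm \<Rightarrow> var set" where
  "ffv (Eq \<sigma> s t) = tfv s \<union> tfv t"
| "ffv (St \<sigma> t) = tfv t"
| "ffv Fls = {}"
| "ffv (\<phi> \<^bold>\<longrightarrow> \<psi>) = ffv \<phi> \<union> ffv \<psi>"
| "ffv (\<phi> \<^bold>\<and> \<psi>) = ffv \<phi> \<union> ffv \<psi>"
| "ffv (\<phi> \<^bold>\<or> \<psi>) = ffv \<phi> \<union> ffv \<psi>"
| "ffv (All \<sigma> \<phi>) = ffv \<phi>"
| "ffv (Ex \<sigma> \<phi>) = ffv \<phi>"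

text \<open>
  \<open>inst k u\<close> replaces the index \<open>k\<close> by the term \<open>u\<close>, \<open>sub v u\<close> replaces the free variable \<open>v\<close>
  by \<open>u\<close>, and \<open>close k v\<close> turns \<open>v\<close> into the index \<open>k\<close>. None of them shifts indices, as \<open>u\<close> is
  meant to have no dangling ones.
\<close>

fun tinst :: "nat \<Rightarrow> tm \<Rightarrow> tm \<Rightarrow> tm" where
  "tinst k u (FV v) = FV v"
| "tinst k u (BV i) = (if i = k then u else BV i)"
| "tinst k u (Cn c) = Cn c"
| "tinst k u (s \<cdot> t) = tinst k u s \<cdot> tinst k u t"

fun inst :: "nat \<Rightarrow> tm \<Rightarrow> fm \<Rightarrow> fm" where
  "inst k u (Eq \<sigma> s t) = Eq \<sigma> (tinst k u s) (tinst k u t)"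
| "inst k u (St \<sigma> t) = St \<sigma> (tinst k u t)"
| "inst k u Fls = Fls"
| "inst k u (\<phi> \<^bold>\<longrightarrow> \<psi>) = (inst k u \<phi> \<^bold>\<longrightarrow> inst k u \<psi>)"
| "inst k u (\<phi> \<^bold>\<and> \<psi>) = (inst k u \<phi> \<^bold>\<and> inst k u \<psi>)"
| "inst k u (\<phi> \<^bold>\<or> \<psi>) = (inst k u \<phi> \<^bold>\<or> inst k u \<psi>)"
| "inst k u (All \<sigma> \<phi>) = All \<sigma> (inst (Suc k) u \<phi>)"
| "inst k u (Ex \<sigma> \<phi>) = Ex \<sigma> (inst (Suc k) u \<phi>)"

fun tsub :: "var \<Rightarrow> tm \<Rightarrow> tm \<Rightarrow> tm" where
  "tsub v u (FV w) = (if w = v then u else FV w)"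
| "tsub v u (BV i) = BV i"
| "tsub v u (Cn c) = Cn c"
| "tsub v u (s \<cdot> t) = tsub v u s \<cdot> tsub v u t"

fun sub :: "var \<Rightarrow> tm \<Rightarrow> fm \<Rightarrow> fm" where
  "sub v u (Eq \<sigma> s t) = Eq \<sigma> (tsub v u s) (tsub v u t)"
| "sub v u (St \<sigma> t) = St \<sigma> (tsub v u t)"
| "sub v u Fls = Fls"
| "sub v u (\<phi> \<^bold>\<longrightarrow> \<psi>) = (sub v u \<phi> \<^bold>\<longrightarrow> sub v u \<psi>)"
| "sub v u (\<phi> \<^bold>\<and> \<psi>) = (sub v u \<phi> \<^bold>\<and> sub v u \<psi>)"
| "sub v u (\<phi> \<^bold>\<or> \<psi>) = (sub v u \<phi> \<^bold>\<or> sub v u \<psi>)"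
| "sub v u (All \<sigma> \<phi>) = All \<sigma> (sub v u \<phi>)"
| "sub v u (Ex \<sigma> \<phi>) = Ex \<sigma> (sub v u \<phi>)"

fun tclose :: "nat \<Rightarrow> var \<Rightarrow> tm \<Rightarrow> tm" where
  "tclose k v (FV w) = (if w = v then BV k else FV w)"
| "tclose k v (BV i) = BV i"
| "tclose k v (Cn c) = Cn c"
| "tclose k v (s \<cdot> t) = tclose k v s \<cdot> tclose k v t"

fun close :: "nat \<Rightarrow> var \<Rightarrow> fm \<Rightarrow> fm" where
  "close k v (Eq \<sigma> s t) = Eq \<sigma> (tclose k v s) (tclose k v t)"
| "close k v (St \<sigma> t) = St \<sigma> (tclose k v t)"
| "close k v Fls = Fls"
| "close k v (\<phi> \<^bold>\<longrightarrow> \<psi>) = (close k v \<phi> \<^bold>\<longrightarrow> close k v \<psi>)"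
| "close k v (\<phi> \<^bold>\<and> \<psi>) = (close k v \<phi> \<^bold>\<and> close k v \<psi>)"
| "close k v (\<phi> \<^bold>\<or> \<psi>) = (close k v \<phi> \<^bold>\<or> close k v \<psi>)"
| "close k v (All \<sigma> \<phi>) = All \<sigma> (close (Suc k) v \<phi>)"
| "close k v (Ex \<sigma> \<phi>) = Ex \<sigma> (close (Suc k) v \<phi>)"

definition AllV :: "var \<Rightarrow> fm \<Rightarrow> fm" where
  "AllV v \<phi> = All (snd v) (close 0 v \<phi>)"

definition ExV :: "var \<Rightarrow> fm \<Rightarrow> fm" where
  "ExV v \<phi> = Ex (snd v) (close 0 v \<phi>)"

abbreviation StV :: "var \<Rightarrow> fm" where
  "StV v \<equiv> St (snd v) (FV v)"

definition AllSt :: "var \<Rightarrow> fm \<Rightarrow> fm" where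
  "AllSt v \<phi> = AllV v (StV v \<^bold>\<longrightarrow> \<phi>)"

definition ExSt :: "var \<Rightarrow> fm \<Rightarrow> fm" where
  "ExSt v \<phi> = ExV v (StV v \<^bold>\<and> \<phi>)"


section \<open>Classical many-sorted logic\<close>

text \<open>
  \<open>prov L T \<Gamma> \<phi>\<close>: natural deduction of \<open>\<phi>\<close> from the assumptions \<open>\<Gamma>\<close> and the axioms \<open>T\<close>, using
  formulas of the language \<open>L\<close> only. The eigenvariable conditions do not concern \<open>T\<close>, so free
  variables of axioms are implicitly universally quantified.
\<close>

inductive prov :: "fm set \<Rightarrow> fm set \<Rightarrow> fm set \<Rightarrow> fm \<Rightarrow> bool" for L T where
  Ax: "\<phi> \<in> T \<Longrightarrow> \<phi> \<in> L \<Longrightarrow> prov L T \<Gamma> \<phi>"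
| Asm: "\<phi> \<in> \<Gamma> \<Longrightarrow> \<phi> \<in> L \<Longrightarrow> prov L T \<Gamma> \<phi>"
| ImpI: "prov L T (insert \<phi> \<Gamma>) \<psi> \<Longrightarrow> \<phi> \<in> L \<Longrightarrow> prov L T \<Gamma> (\<phi> \<^bold>\<longrightarrow> \<psi>)"
| ImpE: "prov L T \<Gamma> (\<phi> \<^bold>\<longrightarrow> \<psi>) \<Longrightarrow> prov L T \<Gamma> \<phi> \<Longrightarrow> prov L T \<Gamma> \<psi>"
| ConI: "prov L T \<Gamma> \<phi> \<Longrightarrow> prov L T \<Gamma> \<psi> \<Longrightarrow> prov L T \<Gamma> (\<phi> \<^bold>\<and> \<psi>)"
| ConE1: "prov L T \<Gamma> (\<phi> \<^bold>\<and> \<psi>) \<Longrightarrow> prov L T \<Gamma> \<phi>"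
| ConE2: "prov L T \<Gamma> (\<phi> \<^bold>\<and> \<psi>) \<Longrightarrow> prov L T \<Gamma> \<psi>"
| DisI1: "prov L T \<Gamma> \<phi> \<Longrightarrow> \<psi> \<in> L \<Longrightarrow> prov L T \<Gamma> (\<phi> \<^bold>\<or> \<psi>)"
| DisI2: "prov L T \<Gamma> \<psi> \<Longrightarrow> \<phi> \<in> L \<Longrightarrow> prov L T \<Gamma> (\<phi> \<^bold>\<or> \<psi>)"
| DisE: "prov L T \<Gamma> (\<phi> \<^bold>\<or> \<psi>) \<Longrightarrow> prov L T (insert \<phi> \<Gamma>) \<chi> \<Longrightarrow> prov L T (insert \<psi> \<Gamma>) \<chi> \<Longrightarrow>
    prov L T \<Gamma> \<chi>"
| Classical: "prov L T (insert (\<^bold>\<not> \<phi>) \<Gamma>) Fls \<Longrightarrow> \<phi> \<in> L \<Longrightarrow> prov L T \<Gamma> \<phi>"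
| AllI: "prov L T \<Gamma> (inst 0 (FV v) \<phi>) \<Longrightarrow> v \<notin> ffv \<phi> \<Longrightarrow> (\<forall>\<gamma>\<in>\<Gamma>. v \<notin> ffv \<gamma>) \<Longrightarrow>
    prov L T \<Gamma> (All (snd v) \<phi>)"
| AllE: "prov L T \<Gamma> (All \<sigma> \<phi>) \<Longrightarrow> t ofty \<sigma> \<Longrightarrow> prov L T \<Gamma> (inst 0 t \<phi>)"
| ExI: "prov L T \<Gamma> (inst 0 t \<phi>) \<Longrightarrow> t ofty \<sigma> \<Longrightarrow> Ex \<sigma> \<phi> \<in> L \<Longrightarrow> prov L T \<Gamma> (Ex \<sigma> \<phi>)"
| ExE: "prov L T \<Gamma> (Ex (snd v) \<phi>) \<Longrightarrow> prov L T (insert (inst 0 (FV v) \<phi>) \<Gamma>) \<psi> \<Longrightarrow>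
    v \<notin> ffv \<phi> \<Longrightarrow> v \<notin> ffv \<psi> \<Longrightarrow> (\<forall>\<gamma>\<in>\<Gamma>. v \<notin> ffv \<gamma>) \<Longrightarrow> prov L T \<Gamma> \<psi>"

definition L_st :: "fm set" where
  "L_st = {\<phi>. wff [] \<phi>}"

definition L_int :: "fm set" where
  "L_int = {\<phi>. wff [] \<phi> \<and> internal \<phi>}"


section \<open>Closed terms for primitive recursive functions\<close>

text \<open>Bracket abstraction, for well-typed terms without dangling indices.\<close>

definition comb_I :: "ty \<Rightarrow> tm" where
  "comb_I \<sigma> = Cn (CSigma \<sigma> (\<sigma> \<rightarrow> \<sigma>) \<sigma>) \<cdot> Cn (CPi \<sigma> (\<sigma> \<rightarrow> \<sigma>)) \<cdot> Cn (CPi \<sigma> \<sigma>)"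

fun dom_ty :: "ty \<Rightarrow> ty" where "dom_ty (\<sigma> \<rightarrow> \<tau>) = \<sigma>" | "dom_ty _ = N"
fun cod_ty :: "ty \<Rightarrow> ty" where "cod_ty (\<sigma> \<rightarrow> \<tau>) = \<tau>" | "cod_ty _ = N"

fun lam :: "var \<Rightarrow> tm \<Rightarrow> tm" where
  "lam v (s \<cdot> t) =
    (let \<sigma> = the (tty [] s) in
     if v \<in> tfv s \<union> tfv t
     then Cn (CSigma (snd v) (dom_ty \<sigma>) (cod_ty \<sigma>)) \<cdot> lam v s \<cdot> lam v t
     else Cn (CPi (cod_ty \<sigma>) (snd v)) \<cdot> (s \<cdot> t))"
| "lam v t =
    (if t = FV v then comb_I (snd v) else Cn (CPi (the (tty [] t)) (snd v)) \<cdot> t)"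

abbreviation lams :: "var list \<Rightarrow> tm \<Rightarrow> tm" where
  "lams vs t \<equiv> foldr lam vs t"

abbreviation "vi \<equiv> (''i'', N)"
abbreviation "vj \<equiv> (''j'', N)"
abbreviation "vr \<equiv> (''r'', N)"

abbreviation Zero :: tm where "Zero \<equiv> Cn CZero"
abbreviation Succ :: "tm \<Rightarrow> tm" where "Succ t \<equiv> Cn CSucc \<cdot> t"
abbreviation One :: tm where "One \<equiv> Succ Zero"

definition Add :: tm where
  "Add = lams [vi, vj] (Cn CRec \<cdot> FV vj \<cdot> FV vi \<cdot> lams [vr, vj] (Succ (FV vr)))"

definition Mult :: tm where
  "Mult = lams [vi, vj] (Cn CRec \<cdot> FV vj \<cdot> Zero \<cdot> lams [vr, vj] (Add \<cdot> FV vr \<cdot> FV vi))"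

definition Pred :: tm where
  "Pred = lam vi (Cn CRec \<cdot> FV vi \<cdot> Zero \<cdot> lams [vr, vj] (FV vj))"

definition Monus :: tm where
  "Monus = lams [vi, vj] (Cn CRec \<cdot> FV vj \<cdot> FV vi \<cdot> lams [vr, vj] (Pred \<cdot> FV vr))"

definition Pow2 :: tm where
  "Pow2 = lam vi (Cn CRec \<cdot> FV vi \<cdot> One \<cdot> lams [vr, vj] (Add \<cdot> FV vr \<cdot> FV vr))"

text \<open>
  Cantor's pairing \<open>(i, j) \<mapsto> Tri (i + j) + j\<close> with triangular numbers \<open>Tri\<close>; \<open>Diag k\<close> is the
  largest \<open>w\<close> with \<open>Tri w \<le> k\<close>.
\<close>

definition Tri :: tm where
  "Tri = lam vi (Cn CRec \<cdot> FV vi \<cdot> Zero \<cdot> lams [vr, vj] (Add \<cdot> FV vr \<cdot> Succ (FV vj)))"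

definition Pair :: tm where
  "Pair = lams [vi, vj] (Add \<cdot> (Tri \<cdot> (Add \<cdot> FV vi \<cdot> FV vj)) \<cdot> FV vj)"

definition Diag :: tm where
  "Diag = lam vi (Cn CRec \<cdot> FV vi \<cdot> Zero \<cdot>
     lams [vr, vj]
       (Add \<cdot> FV vr \<cdot> (Monus \<cdot> One \<cdot> (Monus \<cdot> (Tri \<cdot> Succ (FV vr)) \<cdot> Succ (FV vj)))))"

definition Snd :: tm where
  "Snd = lam vi (Monus \<cdot> FV vi \<cdot> (Tri \<cdot> (Diag \<cdot> FV vi)))"

definition Fst :: tm where
  "Fst = lam vi (Monus \<cdot> (Diag \<cdot> FV vi) \<cdot> (Snd \<cdot> FV vi))"

definition Len :: "ty \<Rightarrow> tm" where
  "Len \<sigma> = lam (''l'', Seq \<sigma>)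
     (Cn (CLRec \<sigma>) \<cdot> FV (''l'', Seq \<sigma>) \<cdot> Zero \<cdot> lams [vr, (''a'', \<sigma>)] (Succ (FV vr)))"

fun zero_tm :: "ty \<Rightarrow> tm" where
  "zero_tm N = Zero"
| "zero_tm (\<sigma> \<rightarrow> \<tau>) = Cn (CPi \<tau> \<sigma>) \<cdot> zero_tm \<tau>"
| "zero_tm (Seq \<sigma>) = Cn (CNil \<sigma>)"

definition Le :: "tm \<Rightarrow> tm \<Rightarrow> fm" where
  "Le s t = Eq N (Monus \<cdot> s \<cdot> t) Zero"

definition Less :: "tm \<Rightarrow> tm \<Rightarrow> fm" where
  "Less s t = Le (Succ s) t"

text \<open>Here and below, the argument terms must not contain dangling indices.\<close>

definition Mem :: "ty \<Rightarrow> tm \<Rightarrow> tm \<Rightarrow> fm" where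
  "Mem \<sigma> a l = Ex N (Less (BV 0) (Len \<sigma> \<cdot> l) \<^bold>\<and> Eq \<sigma> a (Cn (CNth \<sigma>) \<cdot> l \<cdot> BV 0))"


section \<open>Axioms\<close>

inductive_set EPRA :: "fm set" where
  eq_refl: "x ofty \<sigma> \<Longrightarrow> Eq \<sigma> x x \<in> EPRA"
| eq_trans: "x ofty \<sigma> \<Longrightarrow> y ofty \<sigma> \<Longrightarrow> z ofty \<sigma> \<Longrightarrow>
    (Eq \<sigma> x y \<^bold>\<longrightarrow> Eq \<sigma> x z \<^bold>\<longrightarrow> Eq \<sigma> y z) \<in> EPRA"
| ext: "x ofty \<sigma> \<Longrightarrow> y ofty \<sigma> \<Longrightarrow> z ofty \<sigma> \<rightarrow> \<tau> \<Longrightarrow>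
    (Eq \<sigma> x y \<^bold>\<longrightarrow> Eq \<tau> (z \<cdot> x) (z \<cdot> y)) \<in> EPRA"
| eq_fun: "x ofty \<sigma> \<rightarrow> \<tau> \<Longrightarrow> y ofty \<sigma> \<rightarrow> \<tau> \<Longrightarrow>
    (Eq (\<sigma> \<rightarrow> \<tau>) x y \<^bold>\<longleftrightarrow> All \<sigma> (Eq \<tau> (x \<cdot> BV 0) (y \<cdot> BV 0))) \<in> EPRA"
| eq_seq: "x ofty Seq \<sigma> \<Longrightarrow> y ofty Seq \<sigma> \<Longrightarrow>
    (Eq (Seq \<sigma>) x y \<^bold>\<longleftrightarrow>
      Eq N (Len \<sigma> \<cdot> x) (Len \<sigma> \<cdot> y) \<^bold>\<and>
      All N (Less (BV 0) (Len \<sigma> \<cdot> x) \<^bold>\<longrightarrow>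
             Eq \<sigma> (Cn (CNth \<sigma>) \<cdot> x \<cdot> BV 0) (Cn (CNth \<sigma>) \<cdot> y \<cdot> BV 0))) \<in> EPRA"
| succ_nonzero: "x ofty N \<Longrightarrow> (\<^bold>\<not> Eq N (Succ x) Zero) \<in> EPRA"
| succ_inj: "x ofty N \<Longrightarrow> y ofty N \<Longrightarrow> (Eq N (Succ x) (Succ y) \<^bold>\<longrightarrow> Eq N x y) \<in> EPRA"
| qf_ind: "wff [] \<phi> \<Longrightarrow> qf \<phi> \<Longrightarrow> snd n = N \<Longrightarrow>
    (sub n Zero \<phi> \<^bold>\<and> AllV n (\<phi> \<^bold>\<longrightarrow> sub n (Succ (FV n)) \<phi>) \<^bold>\<longrightarrow> AllV n \<phi>) \<in> EPRA"
| pi: "x ofty \<rho> \<Longrightarrow> y ofty \<tau> \<Longrightarrow> Eq \<rho> (Cn (CPi \<rho> \<tau>) \<cdot> x \<cdot> y) x \<in> EPRA"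
| sigma: "x ofty \<delta> \<rightarrow> \<rho> \<rightarrow> \<tau> \<Longrightarrow> y ofty \<delta> \<rightarrow> \<rho> \<Longrightarrow> z ofty \<delta> \<Longrightarrow>
    Eq \<tau> (Cn (CSigma \<delta> \<rho> \<tau>) \<cdot> x \<cdot> y \<cdot> z) (x \<cdot> z \<cdot> (y \<cdot> z)) \<in> EPRA"
| rec_zero: "y ofty N \<Longrightarrow> z ofty N \<rightarrow> N \<rightarrow> N \<Longrightarrow> Eq N (Cn CRec \<cdot> Zero \<cdot> y \<cdot> z) y \<in> EPRA"
| rec_succ: "x ofty N \<Longrightarrow> y ofty N \<Longrightarrow> z ofty N \<rightarrow> N \<rightarrow> N \<Longrightarrow>
    Eq N (Cn CRec \<cdot> Succ x \<cdot> y \<cdot> z) (z \<cdot> (Cn CRec \<cdot> x \<cdot> y \<cdot> z) \<cdot> x) \<in> EPRA"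
| seq_cases: "x ofty Seq \<sigma> \<Longrightarrow>
    (Eq (Seq \<sigma>) x (Cn (CNil \<sigma>)) \<^bold>\<or>
     Ex \<sigma> (Ex (Seq \<sigma>) (Eq (Seq \<sigma>) x (Cn (CCons \<sigma>) \<cdot> BV 1 \<cdot> BV 0)))) \<in> EPRA"
| lrec_nil: "y ofty N \<Longrightarrow> z ofty N \<rightarrow> \<sigma> \<rightarrow> N \<Longrightarrow>
    Eq N (Cn (CLRec \<sigma>) \<cdot> Cn (CNil \<sigma>) \<cdot> y \<cdot> z) y \<in> EPRA"
| lrec_cons: "a ofty \<sigma> \<Longrightarrow> x ofty Seq \<sigma> \<Longrightarrow> y ofty N \<Longrightarrow> z ofty N \<rightarrow> \<sigma> \<rightarrow> N \<Longrightarrow>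
    Eq N (Cn (CLRec \<sigma>) \<cdot> (Cn (CCons \<sigma>) \<cdot> a \<cdot> x) \<cdot> y \<cdot> z)
         (z \<cdot> (Cn (CLRec \<sigma>) \<cdot> x \<cdot> y \<cdot> z) \<cdot> a) \<in> EPRA"
| nth_nil: "i ofty N \<Longrightarrow> Eq \<sigma> (Cn (CNth \<sigma>) \<cdot> Cn (CNil \<sigma>) \<cdot> i) (zero_tm \<sigma>) \<in> EPRA"
| nth_zero: "a ofty \<sigma> \<Longrightarrow> x ofty Seq \<sigma> \<Longrightarrow>
    Eq \<sigma> (Cn (CNth \<sigma>) \<cdot> (Cn (CCons \<sigma>) \<cdot> a \<cdot> x) \<cdot> Zero) a \<in> EPRA"
| nth_succ: "a ofty \<sigma> \<Longrightarrow> x ofty Seq \<sigma> \<Longrightarrow> i ofty N \<Longrightarrow>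
    Eq \<sigma> (Cn (CNth \<sigma>) \<cdot> (Cn (CCons \<sigma>) \<cdot> a \<cdot> x) \<cdot> Succ i) (Cn (CNth \<sigma>) \<cdot> x \<cdot> i) \<in> EPRA"
| len_seg: "f ofty N \<rightarrow> \<sigma> \<Longrightarrow> n ofty N \<Longrightarrow>
    Eq N (Len \<sigma> \<cdot> (Cn (CSeg \<sigma>) \<cdot> f \<cdot> n)) n \<in> EPRA"
| nth_seg: "f ofty N \<rightarrow> \<sigma> \<Longrightarrow> n ofty N \<Longrightarrow> i ofty N \<Longrightarrow>
    (Less i n \<^bold>\<longrightarrow> Eq \<sigma> (Cn (CNth \<sigma>) \<cdot> (Cn (CSeg \<sigma>) \<cdot> f \<cdot> n) \<cdot> i) (f \<cdot> i)) \<in> EPRA"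

inductive_set T_st :: "fm set" where
  st_eq: "x ofty \<sigma> \<Longrightarrow> y ofty \<sigma> \<Longrightarrow> (St \<sigma> x \<^bold>\<and> Eq \<sigma> x y \<^bold>\<longrightarrow> St \<sigma> y) \<in> T_st"
| st_closed: "t ofty \<sigma> \<Longrightarrow> tfv t = {} \<Longrightarrow> St \<sigma> t \<in> T_st"
| st_app: "f ofty \<sigma> \<rightarrow> \<tau> \<Longrightarrow> x ofty \<sigma> \<Longrightarrow>
    (St (\<sigma> \<rightarrow> \<tau>) f \<^bold>\<and> St \<sigma> x \<^bold>\<longrightarrow> St \<tau> (f \<cdot> x)) \<in> T_st"

inductive_set HAC_int :: "fm set" where
  "wff [] \<phi> \<Longrightarrow> internal \<phi> \<Longrightarrow> x \<noteq> y \<Longrightarrow> snd F = snd x \<rightarrow> Seq (snd y) \<Longrightarrow>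
   F \<notin> ffv \<phi> \<union> {x, y} \<Longrightarrow>
   (AllSt x (ExSt y \<phi>) \<^bold>\<longrightarrow>
    ExSt F (AllSt x (ExV y (Mem (snd y) (FV y) (FV F \<cdot> FV x) \<^bold>\<and> \<phi>)))) \<in> HAC_int"

inductive_set Ideal :: "fm set" where
  "wff [] \<phi> \<Longrightarrow> internal \<phi> \<Longrightarrow> z \<noteq> y \<Longrightarrow> snd x = Seq (snd z) \<Longrightarrow> x \<notin> ffv \<phi> \<union> {y, z} \<Longrightarrow>
   (AllSt x (ExV y (AllV z (Mem (snd z) (FV z) (FV x) \<^bold>\<longrightarrow> \<phi>))) \<^bold>\<longrightarrow>
    ExV y (AllSt z \<phi>)) \<in> Ideal"

inductive_set QF_AC10 :: "fm set" where
  "wff [] \<phi> \<Longrightarrow> qf \<phi> \<Longrightarrow> snd x = N1 \<Longrightarrow> snd y = N \<Longrightarrow> snd F = N1 \<rightarrow> N \<Longrightarrow> F \<notin> ffv \<phi> \<Longrightarrow>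
   (AllV x (ExV y \<phi>) \<^bold>\<longrightarrow> ExV F (AllV x (sub y (FV F \<cdot> FV x) \<phi>))) \<in> QF_AC10"

definition EPRA_proves :: "fm \<Rightarrow> bool" where
  "EPRA_proves \<phi> \<longleftrightarrow> prov L_int EPRA {} \<phi>"

definition P0_proves :: "fm \<Rightarrow> bool" where
  "P0_proves \<phi> \<longleftrightarrow> prov L_st (EPRA \<union> T_st \<union> HAC_int \<union> Ideal \<union> QF_AC10) {} \<phi>"


section \<open>Rational and real numbers\<close>

text \<open>
  Every number codes a rational: \<open>Pair (Pair a b) c\<close> codes \<open>(a - b) / (c + 1)\<close>. In \<open>MkQ a b d\<close>
  the denominator is \<open>max d 1\<close>; thus \<open>1 / m\<close>, which is total here, equals \<open>1\<close> for \<open>m = 0\<close>.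
\<close>

definition QPos :: "tm \<Rightarrow> tm" where "QPos q = Fst \<cdot> (Fst \<cdot> q)"
definition QNeg :: "tm \<Rightarrow> tm" where "QNeg q = Snd \<cdot> (Fst \<cdot> q)"
definition QDen :: "tm \<Rightarrow> tm" where "QDen q = Succ (Snd \<cdot> q)"

definition MkQ :: "tm \<Rightarrow> tm \<Rightarrow> tm \<Rightarrow> tm" where
  "MkQ a b d = Pair \<cdot> (Pair \<cdot> a \<cdot> b) \<cdot> (Pred \<cdot> d)"

definition QLe :: "tm \<Rightarrow> tm \<Rightarrow> fm" where
  "QLe q r =
    Le (Add \<cdot> (Mult \<cdot> QPos q \<cdot> QDen r) \<cdot> (Mult \<cdot> QNeg r \<cdot> QDen q))
       (Add \<cdot> (Mult \<cdot> QPos r \<cdot> QDen q) \<cdot> (Mult \<cdot> QNeg q \<cdot> QDen r))"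

definition QSub :: tm where
  "QSub = lams [vi, vj]
    (MkQ (Add \<cdot> (Mult \<cdot> QPos (FV vi) \<cdot> QDen (FV vj)) \<cdot> (Mult \<cdot> QNeg (FV vj) \<cdot> QDen (FV vi)))
         (Add \<cdot> (Mult \<cdot> QNeg (FV vi) \<cdot> QDen (FV vj)) \<cdot> (Mult \<cdot> QPos (FV vj) \<cdot> QDen (FV vi)))
         (Mult \<cdot> QDen (FV vi) \<cdot> QDen (FV vj)))"

definition QAbs :: tm where
  "QAbs = lam vi
    (MkQ (Add \<cdot> (Monus \<cdot> QPos (FV vi) \<cdot> QNeg (FV vi)) \<cdot> (Monus \<cdot> QNeg (FV vi) \<cdot> QPos (FV vi)))
         Zero
         (QDen (FV vi)))"

definition QInv :: "tm \<Rightarrow> tm" where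
  "QInv m = MkQ One Zero m"

definition Eps :: "tm \<Rightarrow> tm" where
  "Eps n = QInv (Pow2 \<cdot> n)"

definition QDist :: "tm \<Rightarrow> tm \<Rightarrow> tm" where
  "QDist q r = QAbs \<cdot> (QSub \<cdot> q \<cdot> r)"

text \<open>
  The rate of convergence is \<open>|q n - q (n + i)| \<le> 2 ^ -(n + 2)\<close>. It is chosen with regard to
  \<open>REq\<close> and \<open>Approx\<close>, whose bound is \<open>2 ^ -n\<close>: sequences with equal limits satisfy
  \<open>|q n - r n| \<le> 2 ^ -(n + 1)\<close>, and the remaining slack absorbs infinitesimals, so \<open>Approx\<close> holds
  if and only if the limits differ by an infinitesimal. With rate \<open>2 ^ -n\<close>, or even
  \<open>2 ^ -(n + 1)\<close>, \<open>Approx\<close> is not transitive on nonstandard sequences.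
\<close>

definition IsReal :: "tm \<Rightarrow> fm" where
  "IsReal x = All N (All N
    (QLe (QDist (x \<cdot> BV 1) (x \<cdot> (Add \<cdot> BV 1 \<cdot> BV 0))) (Eps (Succ (Succ (BV 1))))))"

definition REq :: "tm \<Rightarrow> tm \<Rightarrow> fm" where
  "REq x y = All N (QLe (QDist (x \<cdot> BV 0) (y \<cdot> BV 0)) (Eps (BV 0)))"

definition Approx :: "tm \<Rightarrow> tm \<Rightarrow> fm" where
  "Approx x y = All N (St N (BV 0) \<^bold>\<longrightarrow> QLe (QDist (x \<cdot> BV 0) (y \<cdot> BV 0)) (Eps (BV 0)))"

definition RLe :: "tm \<Rightarrow> tm \<Rightarrow> fm" where
  "RLe x y = All N (QLe (QSub \<cdot> (x \<cdot> BV 0) \<cdot> (y \<cdot> BV 0)) (Eps (BV 0)))"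

definition RLess :: "tm \<Rightarrow> tm \<Rightarrow> fm" where
  "RLess x y = Ex N (\<^bold>\<not> QLe (QSub \<cdot> (y \<cdot> BV 0) \<cdot> (x \<cdot> BV 0)) (Eps (BV 0)))"

text \<open>\<open>Const \<cdot> q\<close> is the real number given by the rational \<open>q\<close>; the index shift in \<open>RSub\<close>
  restores the rate of convergence.\<close>

definition Const :: tm where
  "Const = lams [vi, vj] (FV vi)"

definition RSub :: tm where
  "RSub = lams [(''x'', N1), (''y'', N1), vi]
    (QSub \<cdot> (FV (''x'', N1) \<cdot> Succ (FV vi)) \<cdot> (FV (''y'', N1) \<cdot> Succ (FV vi)))"

definition RAbs :: tm where
  "RAbs = lams [(''x'', N1), vi] (QAbs \<cdot> (FV (''x'', N1) \<cdot> FV vi))"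

definition RDist :: "tm \<Rightarrow> tm \<Rightarrow> tm" where
  "RDist x y = RAbs \<cdot> (RSub \<cdot> x \<cdot> y)"

definition RInv :: "tm \<Rightarrow> tm" where
  "RInv m = Const \<cdot> QInv m"

definition UnitI :: "tm \<Rightarrow> fm" where
  "UnitI x = (IsReal x \<^bold>\<and>
     RLe (Const \<cdot> MkQ Zero Zero One) x \<^bold>\<and> RLe x (Const \<cdot> MkQ One Zero One))"

text \<open>The variables \<open>u\<close> and \<open>w\<close> must not occur in the argument of \<open>RFun\<close>.\<close>

definition RFun :: "tm \<Rightarrow> fm" where
  "RFun f =
    (let u = (''u'', N1); w = (''w'', N1) in
     AllV u (IsReal (FV u) \<^bold>\<longrightarrow> IsReal (f \<cdot> FV u)) \<^bold>\<and>
     AllV u (AllV w (IsReal (FV u) \<^bold>\<and> IsReal (FV w) \<^bold>\<longrightarrow>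
       REq (FV u) (FV w) \<^bold>\<longrightarrow> REq (f \<cdot> FV u) (f \<cdot> FV w))))"


section \<open>Limits of continuous functions\<close>

definition ULC_ns :: fm where
  "ULC_ns =
    (let vf = (''f'', N1 \<rightarrow> N1); vF = (''F'', N \<rightarrow> N1 \<rightarrow> N1);
         vn = (''n'', N); vN = (''N'', N); vx = (''x'', N1); vy = (''y'', N1);
         f = FV vf; F = FV vF; n = FV vn; M = FV vN; x = FV vx; y = FV vy
     in
     AllV vf (AllV vF (
       RFun f \<^bold>\<and> AllV vn (RFun (F \<cdot> n)) \<^bold>\<longrightarrow>
       AllSt vn (AllSt vx (UnitI x \<^bold>\<longrightarrow> AllV vy (UnitI y \<^bold>\<longrightarrow>
         Approx x y \<^bold>\<longrightarrow> Approx (F \<cdot> n \<cdot> x) (F \<cdot> n \<cdot> y)))) \<^bold>\<and>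
       AllV vx (UnitI x \<^bold>\<longrightarrow> AllV vN (\<^bold>\<not> St N M \<^bold>\<longrightarrow>
         Approx (F \<cdot> M \<cdot> x) (f \<cdot> x))) \<^bold>\<longrightarrow>
       AllSt vx (UnitI x \<^bold>\<longrightarrow> AllV vy (UnitI y \<^bold>\<longrightarrow>
         Approx x y \<^bold>\<longrightarrow> Approx (f \<cdot> x) (f \<cdot> y))))))"

abbreviation ULC_ty :: ty where
  "ULC_ty \<equiv> (N \<rightarrow> N1 \<rightarrow> N \<rightarrow> N) \<rightarrow> (N \<rightarrow> N) \<rightarrow> N \<rightarrow> N1 \<rightarrow> N"

definition ULC_ef :: "tm \<Rightarrow> fm" where
  "ULC_ef t =
    (let vf = (''f'', N1 \<rightarrow> N1); vF = (''F'', N \<rightarrow> N1 \<rightarrow> N1);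
         vg = (''g'', N \<rightarrow> N1 \<rightarrow> N \<rightarrow> N); vh = (''h'', N \<rightarrow> N);
         vn = (''n'', N); vN = (''N'', N); vk = (''k'', N); vx = (''x'', N1); vy = (''y'', N1);
         f = FV vf; F = FV vF; g = FV vg; h = FV vh;
         n = FV vn; M = FV vN; k = FV vk; x = FV vx; y = FV vy
     in
     AllV vf (AllV vF (AllV vg (AllV vh (
       RFun f \<^bold>\<and> AllV vn (RFun (F \<cdot> n)) \<^bold>\<longrightarrow>
       AllV vn (AllV vk (AllV vx (UnitI x \<^bold>\<longrightarrow> AllV vy (UnitI y \<^bold>\<longrightarrow>
         RLe (RDist x y) (RInv (g \<cdot> n \<cdot> x \<cdot> k)) \<^bold>\<longrightarrow>
         RLe (RDist (F \<cdot> n \<cdot> x) (F \<cdot> n \<cdot> y)) (RInv k))))) \<^bold>\<and>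
       AllV vk (AllV vx (UnitI x \<^bold>\<longrightarrow> AllV vN (Le (h \<cdot> k) M \<^bold>\<longrightarrow>
         RLe (RDist (F \<cdot> M \<cdot> x) (f \<cdot> x)) (RInv k)))) \<^bold>\<longrightarrow>
       AllV vk (AllV vx (UnitI x \<^bold>\<longrightarrow> AllV vy (UnitI y \<^bold>\<longrightarrow>
         RLess (RDist x y) (RInv (t \<cdot> g \<cdot> h \<cdot> k \<cdot> x)) \<^bold>\<longrightarrow>
         RLess (RDist (f \<cdot> x) (f \<cdot> y)) (RInv k)))))))))"

end

theory Submission
  imports Defs "HOL-Library.Countable" "HOL-Computational_Algebra.Fraction_Field"
begin

text \<open>
  Both halves are proved by semantic means. A Henkin construction gives completeness of the calculus:
  an unprovable formula fails in a model of the axioms in which every variable ranges over a set of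
  equivalence classes of terms. In such a model, quantifier-free induction makes the objects of type
  \<open>N\<close> a discretely ordered semiring, so that the coded rationals take values in a linearly ordered
  field.

  For \<open>ULC_ns\<close>, fix standard \<open>k\<close> and \<open>m = k + 3\<close>. The functions \<open>f n\<close> with standard \<open>n\<close> satisfy
  \<open>\<bar>f n x - f n y\<bar> \<le> 2 ^ -m\<close> for the \<open>m\<close>-th approximations. By overspill, which follows from idealization,
  so does \<open>f M\<close> for some nonstandard \<open>M\<close>, and \<open>f M\<close> is infinitely close to \<open>f\<close> at \<open>x\<close> and at \<open>y\<close>.
  The same triangle inequality, with \<open>M = h j\<close> for \<open>j = 2 ^ (k + 3)\<close>, shows that
  \<open>t g h k x = g (h j) x j\<close> is a modulus for \<open>ULC_ef\<close>.
\<close>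

section \<open>Terms and formulas without dangling indices\<close>

text \<open>A model may be nonstandard, so HOL has no induction over its numbers; what holds there
  is induction for predicates given by quantifier-free formulas with parameters. All arithmetic,
  down to the commutativity of addition and the correctness of pairing, has to be proved for such
  representable predicates, and existential claims need explicit witnesses beforehand. Only then do
  the numbers become a type with the usual algebraic classes, and inequalities in the model become
  linear arithmetic in an ordered field. Limits need not exist in that field, so reals enter through
  their approximations only.

  Overspill applies to internal formulas, whereas \<open>Approx\<close> mentions \<open>St\<close>;
  therefore one precision is fixed in advance. The three extra binary digits come from counting
  errors: in both halves the estimate uses up 7/8 of the permitted error, and with two extra digits
  it would exceed it. The term is the trace of the nonstandard argument: the nonstandard index
  \<open>M\<close> turns into \<open>h j\<close>, from which on the convergence is good
  enough.\<close>

fun tlc :: "nat \<Rightarrow> tm \<Rightarrow> bool" where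
  "tlc k (FV v) = True"
| "tlc k (BV i) = (i < k)"
| "tlc k (Cn c) = True"
| "tlc k (s \<cdot> t) = (tlc k s \<and> tlc k t)"

fun lc :: "nat \<Rightarrow> fm \<Rightarrow> bool" where
  "lc k (Eq \<sigma> s t) = (tlc k s \<and> tlc k t)"
| "lc k (St \<sigma> t) = tlc k t"
| "lc k Fls = True"
| "lc k (\<phi> \<^bold>\<longrightarrow> \<psi>) = (lc k \<phi> \<and> lc k \<psi>)"
| "lc k (\<phi> \<^bold>\<and> \<psi>) = (lc k \<phi> \<and> lc k \<psi>)"
| "lc k (\<phi> \<^bold>\<or> \<psi>) = (lc k \<phi> \<and> lc k \<psi>)"
| "lc k (All \<sigma> \<phi>) = lc (Suc k) \<phi>"
| "lc k (Ex \<sigma> \<phi>) = lc (Suc k) \<phi>"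

text \<open>For abstract terms the existential form is the convenient one. The recursion equation
  leaves the simpset right after it and comes back where types are to be computed.\<close>

lemma tty_App [simp]:
  "tty \<Delta> (s \<cdot> t) = Some \<tau> \<longleftrightarrow> (\<exists>\<sigma>. tty \<Delta> s = Some (\<sigma> \<rightarrow> \<tau>) \<and> tty \<Delta> t = Some \<sigma>)"
  by (auto split: option.splits ty.splits if_splits)

declare tty.simps(4) [simp del]

lemma tlc_mono: "tlc k t \<Longrightarrow> k \<le> l \<Longrightarrow> tlc l t"
  by (induction t) auto

lemma lc_mono: "lc k \<phi> \<Longrightarrow> k \<le> l \<Longrightarrow> lc l \<phi>"
  by (induction \<phi> arbitrary: k l) (auto intro: tlc_mono)

lemma tlc_tty: "tty \<Delta> t = Some \<sigma> \<Longrightarrow> tlc (length \<Delta>) t"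
  by (induction t arbitrary: \<sigma>) (auto split: if_splits)

lemma lc_wff: "wff \<Delta> \<phi> \<Longrightarrow> lc (length \<Delta>) \<phi>"
  by (induction \<phi> arbitrary: \<Delta>) (auto dest: tlc_tty; metis length_Cons)+

lemma tlc_tinst: "tlc k t \<Longrightarrow> tinst k u t = t"
  by (induction t) auto

lemma lc_inst: "lc k \<phi> \<Longrightarrow> inst k u \<phi> = \<phi>"
  by (induction \<phi> arbitrary: k) (auto simp: tlc_tinst)

lemma tlc_mono0: "tlc 0 t \<Longrightarrow> tlc k t"
  by (rule tlc_mono) auto

lemma tty_append: "tty \<Delta> t = Some \<sigma> \<Longrightarrow> tty (\<Delta> @ \<Delta>') t = Some \<sigma>"
  by (induction t arbitrary: \<sigma>) (auto simp: nth_append split: if_splits)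

lemma tty_weaken: "t ofty \<sigma> \<Longrightarrow> tty \<Delta> t = Some \<sigma>"
  using tty_append [of "[]" t \<sigma> \<Delta>] by simp

text \<open>The index that is replaced belongs to the outermost binder, hence to the last entry of
  the list. Binders met on the way down are added at the front, so this form survives the induction
  on formulas.\<close>

lemma tty_tinst:
  assumes "u ofty \<rho>"
  shows "tty (\<Delta> @ [\<rho>]) t = Some \<sigma> \<Longrightarrow> tty \<Delta> (tinst (length \<Delta>) u t) = Some \<sigma>"
proof (induction t arbitrary: \<sigma>)
  case (BV i)
  then show ?case using tty_weaken[OF assms, of \<Delta>]
    by (auto simp: nth_append split: if_splits)
qed auto

lemma wff_inst:
  "wff (\<Delta> @ [\<rho>]) \<phi> \<Longrightarrow> u ofty \<rho> \<Longrightarrow> wff \<Delta> (inst (length \<Delta>) u \<phi>)"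
proof (induction \<phi> arbitrary: \<Delta>)
  case (All \<sigma> \<phi>)
  then show ?case using All.IH[of "\<sigma> # \<Delta>"] by simp
next
  case (Ex \<sigma> \<phi>)
  then show ?case using Ex.IH[of "\<sigma> # \<Delta>"] by simp
qed (auto intro: tty_tinst)

lemma wff_inst0: "wff [\<rho>] \<phi> \<Longrightarrow> u ofty \<rho> \<Longrightarrow> wff [] (inst 0 u \<phi>)"
  using wff_inst[of "[]"] by simp

lemma internal_inst [simp]: "internal (inst k u \<phi>) = internal \<phi>"
  by (induction \<phi> arbitrary: k) auto

lemma tinst_tclose: "tlc k t \<Longrightarrow> tinst k (FV v) (tclose k v t) = t"
  by (induction t) auto

lemma inst_close: "lc k \<phi> \<Longrightarrow> inst k (FV v) (close k v \<phi>) = \<phi>"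
  by (induction \<phi> arbitrary: k) (auto simp: tinst_tclose)

lemma tfv_tclose: "tfv (tclose k v t) = tfv t - {v}"
  by (induction t) auto

lemma ffv_close: "ffv (close k v \<phi>) = ffv \<phi> - {v}"
  by (induction \<phi> arbitrary: k) (auto simp: tfv_tclose)

lemma tty_tclose:
  "tty \<Delta> t = Some \<sigma> \<Longrightarrow> tty (\<Delta> @ [snd v]) (tclose (length \<Delta>) v t) = Some \<sigma>"
  by (induction t arbitrary: \<sigma>) (auto simp: nth_append split: if_splits)

lemma wff_close: "wff \<Delta> \<phi> \<Longrightarrow> wff (\<Delta> @ [snd v]) (close (length \<Delta>) v \<phi>)"
proof (induction \<phi> arbitrary: \<Delta>)
  case (All \<sigma> \<phi>)
  then show ?case using All.IH[of "\<sigma> # \<Delta>"] by simp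
next
  case (Ex \<sigma> \<phi>)
  then show ?case using Ex.IH[of "\<sigma> # \<Delta>"] by simp
qed (auto intro: tty_tclose)

lemma internal_close [simp]: "internal (close k v \<phi>) = internal \<phi>"
  by (induction \<phi> arbitrary: k) auto

lemma wff_AllV [simp]: "wff [] \<phi> \<Longrightarrow> wff [] (AllV v \<phi>)"
  using wff_close[of "[]"] by (simp add: AllV_def)

lemma wff_ExV [simp]: "wff [] \<phi> \<Longrightarrow> wff [] (ExV v \<phi>)"
  using wff_close[of "[]"] by (simp add: ExV_def)

lemma internal_AllV [simp]: "internal (AllV v \<phi>) = internal \<phi>"
  by (simp add: AllV_def)

lemma internal_ExV [simp]: "internal (ExV v \<phi>) = internal \<phi>"
  by (simp add: ExV_def)

lemma finite_tfv [simp]: "finite (tfv t)"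
  by (induction t) auto

lemma finite_ffv [simp]: "finite (ffv \<phi>)"
  by (induction \<phi>) auto

text \<open>Under \<open>k\<close> binders, the dangling indices are those from \<open>k\<close> on; index \<open>k + i\<close> becomes \<open>ds ! i\<close>.\<close>

fun tmsub :: "(var \<Rightarrow> tm) \<Rightarrow> nat \<Rightarrow> tm list \<Rightarrow> tm \<Rightarrow> tm" where
  "tmsub s k ds (FV v) = s v"
| "tmsub s k ds (BV i) = (if i < k \<or> length ds \<le> i - k then BV i else ds ! (i - k))"
| "tmsub s k ds (Cn c) = Cn c"
| "tmsub s k ds (t \<cdot> u) = tmsub s k ds t \<cdot> tmsub s k ds u"

fun msub :: "(var \<Rightarrow> tm) \<Rightarrow> nat \<Rightarrow> tm list \<Rightarrow> fm \<Rightarrow> fm" where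
  "msub s k ds (Eq \<sigma> t u) = Eq \<sigma> (tmsub s k ds t) (tmsub s k ds u)"
| "msub s k ds (St \<sigma> t) = St \<sigma> (tmsub s k ds t)"
| "msub s k ds Fls = Fls"
| "msub s k ds (\<phi> \<^bold>\<longrightarrow> \<psi>) = (msub s k ds \<phi> \<^bold>\<longrightarrow> msub s k ds \<psi>)"
| "msub s k ds (\<phi> \<^bold>\<and> \<psi>) = (msub s k ds \<phi> \<^bold>\<and> msub s k ds \<psi>)"
| "msub s k ds (\<phi> \<^bold>\<or> \<psi>) = (msub s k ds \<phi> \<^bold>\<or> msub s k ds \<psi>)"
| "msub s k ds (All \<sigma> \<phi>) = All \<sigma> (msub s (Suc k) ds \<phi>)"
| "msub s k ds (Ex \<sigma> \<phi>) = Ex \<sigma> (msub s (Suc k) ds \<phi>)"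

lemma tinst_tmsub:
  assumes "\<And>v. tlc 0 (s v)" "\<And>d. d \<in> set ds \<Longrightarrow> tlc 0 d"
  shows "tinst k u (tmsub s (Suc k) ds t) = tmsub s k (u # ds) t"
proof (induction t)
  case (FV v)
  have "tlc k (s v)" using assms(1) by (rule tlc_mono0)
  then show ?case by (simp add: tlc_tinst)
next
  case (BV i)
  have "tlc k (ds ! j)" if "j < length ds" for j
    using assms(2)[OF nth_mem[OF that]] by (rule tlc_mono0)
  moreover have "(u # ds) ! (i - k) = ds ! (i - Suc k)" if "k < i"
    using that by (simp add: nth_Cons')
  ultimately show ?case
    by (cases i k rule: linorder_cases) (auto simp: tlc_tinst)
qed auto

text \<open>The quantifier step of the truth lemma: to instantiate a quantifier after the
  simultaneous substitution is to push the witness onto the list for the dangling indices.\<close>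

lemma inst_msub:
  assumes "\<And>v. tlc 0 (s v)" "\<And>d. d \<in> set ds \<Longrightarrow> tlc 0 d"
  shows "inst k u (msub s (Suc k) ds \<phi>) = msub s k (u # ds) \<phi>"
  using tinst_tmsub[OF assms] by (induction \<phi> arbitrary: k) auto

lemma tmsub_id: "tmsub FV k [] t = t"
  by (induction t) auto

lemma msub_id: "msub FV k [] \<phi> = \<phi>"
  by (induction \<phi> arbitrary: k) (auto simp: tmsub_id)

lemma tty_tmsub:
  assumes "\<And>v. s v ofty snd v" "list_all2 (\<lambda>d \<sigma>. d ofty \<sigma>) ds \<Delta>'"
  shows "tty (\<Delta> @ \<Delta>') t = Some \<sigma> \<Longrightarrow> tty \<Delta> (tmsub s (length \<Delta>) ds t) = Some \<sigma>"
proof (induction t arbitrary: \<sigma>)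
  case (FV v)
  then show ?case using tty_weaken[OF assms(1)[of v]] by simp
next
  case (BV i)
  have "tty \<Delta> (ds ! j) = Some (\<Delta>' ! j)" if "j < length \<Delta>'" for j
    using list_all2_nthD2[OF assms(2) that] by (rule tty_weaken)
  then show ?case using BV list_all2_lengthD[OF assms(2)]
    by (auto simp: nth_append split: if_splits)
qed auto

lemma wff_msub:
  assumes "\<And>v. s v ofty snd v" "list_all2 (\<lambda>d \<sigma>. d ofty \<sigma>) ds \<Delta>'"
  shows "wff (\<Delta> @ \<Delta>') \<phi> \<Longrightarrow> wff \<Delta> (msub s (length \<Delta>) ds \<phi>)"
proof (induction \<phi> arbitrary: \<Delta>)
  case (All \<sigma> \<phi>)
  then show ?case using All.IH[of "\<sigma> # \<Delta>"] by simp
next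
  case (Ex \<sigma> \<phi>)
  then show ?case using Ex.IH[of "\<sigma> # \<Delta>"] by simp
qed (auto intro: tty_tmsub[OF assms])

lemma wff_msub0:
  assumes "\<And>v. s v ofty snd v" "list_all2 (\<lambda>d \<sigma>. d ofty \<sigma>) ds \<Delta>" "wff \<Delta> \<phi>"
  shows "wff [] (msub s 0 ds \<phi>)"
  using wff_msub[OF assms(1,2), of "[]"] assms(3) by simp

lemma internal_msub [simp]: "internal (msub s k ds \<phi>) = internal \<phi>"
  by (induction \<phi> arbitrary: k) auto

lemma qf_msub [simp]: "qf (msub s k ds \<phi>) = qf \<phi>"
  by (induction \<phi> arbitrary: k) auto


section \<open>Semantics\<close>

primrec eval :: "('v \<Rightarrow> 'v \<Rightarrow> 'v) \<Rightarrow> (cst \<Rightarrow> 'v) \<Rightarrow> (var \<Rightarrow> 'v) \<Rightarrow> 'v list \<Rightarrow> tm \<Rightarrow> 'v" where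
  "eval ap cn e ds (FV v) = e v"
| "eval ap cn e ds (BV i) = ds ! i"
| "eval ap cn e ds (Cn c) = cn c"
| "eval ap cn e ds (s \<cdot> t) = ap (eval ap cn e ds s) (eval ap cn e ds t)"

text \<open>Equality is identity at all types, so a model made of terms has to be a quotient. In
  return, equations that hold in a model can be used for rewriting.\<close>

primrec sat :: "(ty \<Rightarrow> 'v set) \<Rightarrow> ('v \<Rightarrow> 'v \<Rightarrow> 'v) \<Rightarrow> (cst \<Rightarrow> 'v) \<Rightarrow> (ty \<Rightarrow> 'v set) \<Rightarrow>
    (var \<Rightarrow> 'v) \<Rightarrow> 'v list \<Rightarrow> fm \<Rightarrow> bool" where
  "sat D ap cn S e ds (Eq \<sigma> s t) \<longleftrightarrow> eval ap cn e ds s = eval ap cn e ds t"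
| "sat D ap cn S e ds (St \<sigma> t) \<longleftrightarrow> eval ap cn e ds t \<in> S \<sigma>"
| "sat D ap cn S e ds Fls \<longleftrightarrow> False"
| "sat D ap cn S e ds (\<phi> \<^bold>\<longrightarrow> \<psi>) \<longleftrightarrow> (sat D ap cn S e ds \<phi> \<longrightarrow> sat D ap cn S e ds \<psi>)"
| "sat D ap cn S e ds (\<phi> \<^bold>\<and> \<psi>) \<longleftrightarrow> sat D ap cn S e ds \<phi> \<and> sat D ap cn S e ds \<psi>"
| "sat D ap cn S e ds (\<phi> \<^bold>\<or> \<psi>) \<longleftrightarrow> sat D ap cn S e ds \<phi> \<or> sat D ap cn S e ds \<psi>"
| "sat D ap cn S e ds (All \<sigma> \<phi>) \<longleftrightarrow> (\<forall>d \<in> D \<sigma>. sat D ap cn S e (d # ds) \<phi>)"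
| "sat D ap cn S e ds (Ex \<sigma> \<phi>) \<longleftrightarrow> (\<exists>d \<in> D \<sigma>. sat D ap cn S e (d # ds) \<phi>)"

definition typed_env :: "(ty \<Rightarrow> 'v set) \<Rightarrow> (var \<Rightarrow> 'v) \<Rightarrow> bool" where
  "typed_env D e \<longleftrightarrow> (\<forall>v. e v \<in> D (snd v))"

lemma typed_env_upd [simp]: "typed_env D e \<Longrightarrow> d \<in> D (snd v) \<Longrightarrow> typed_env D (e(v := d))"
  by (auto simp: typed_env_def)

lemma eval_lc:
  "tlc (length ds) t \<Longrightarrow> eval ap cn e (ds @ ds') t = eval ap cn e ds t"
  by (induction t) (auto simp: nth_append)

lemma eval_lc0: "tlc 0 t \<Longrightarrow> eval ap cn e ds t = eval ap cn e [] t"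
  using eval_lc[of "[]" t] by simp

lemma eval_cong: "(\<And>v. v \<in> tfv t \<Longrightarrow> e v = e' v) \<Longrightarrow> eval ap cn e ds t = eval ap cn e' ds t"
  by (induction t) auto

lemma eval_tclose:
  "tlc (length ds) t \<Longrightarrow>
    eval ap cn e (ds @ d # ds') (tclose (length ds) v t) = eval ap cn (e(v := d)) ds t"
  by (induction t) (auto simp: nth_append)

lemma sat_close:
  "lc (length ds) \<phi> \<Longrightarrow>
    sat D ap cn S e (ds @ d # ds') (close (length ds) v \<phi>) = sat D ap cn S (e(v := d)) ds \<phi>"
proof (induction \<phi> arbitrary: ds)
  case (All \<sigma> \<phi>)
  have "sat D ap cn S e (x # ds @ d # ds') (close (Suc (length ds)) v \<phi>) =
      sat D ap cn S (e(v := d)) (x # ds) \<phi>" for x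
    using All.IH[of "x # ds"] All.prems by (simp add: fun_upd_def)
  then show ?case by (simp add: fun_upd_def)
next
  case (Ex \<sigma> \<phi>)
  have "sat D ap cn S e (x # ds @ d # ds') (close (Suc (length ds)) v \<phi>) =
      sat D ap cn S (e(v := d)) (x # ds) \<phi>" for x
    using Ex.IH[of "x # ds"] Ex.prems by (simp add: fun_upd_def)
  then show ?case by (simp add: fun_upd_def)
qed (simp_all add: eval_tclose fun_upd_def)

lemma sat_AllV [simp]:
  "lc 0 \<phi> \<Longrightarrow>
    sat D ap cn S e ds (AllV v \<phi>) \<longleftrightarrow> (\<forall>d \<in> D (snd v). sat D ap cn S (e(v := d)) [] \<phi>)"
  using sat_close[of "[]" \<phi> D ap cn S e _ ds v] by (simp add: AllV_def)

lemma sat_ExV [simp]: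
  "lc 0 \<phi> \<Longrightarrow>
    sat D ap cn S e ds (ExV v \<phi>) \<longleftrightarrow> (\<exists>d \<in> D (snd v). sat D ap cn S (e(v := d)) [] \<phi>)"
  using sat_close[of "[]" \<phi> D ap cn S e _ ds v] by (simp add: ExV_def)

lemma sat_AllSt [simp]:
  "lc 0 \<phi> \<Longrightarrow>
    sat D ap cn S e ds (AllSt v \<phi>) \<longleftrightarrow>
      (\<forall>d \<in> D (snd v). d \<in> S (snd v) \<longrightarrow> sat D ap cn S (e(v := d)) [] \<phi>)"
  by (simp add: AllSt_def)

lemma tlc_tclose: "tlc k t \<Longrightarrow> tlc (Suc k) (tclose k v t)"
  by (induction t) auto

lemma lc_close: "lc k \<phi> \<Longrightarrow> lc (Suc k) (close k v \<phi>)"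
  by (induction \<phi> arbitrary: k) (auto simp: tlc_tclose)

lemma lc_AllV [simp]: "lc 0 \<phi> \<Longrightarrow> lc k (AllV v \<phi>)"
  by (rule lc_mono[of 0]) (simp_all add: AllV_def lc_close)

lemma lc_ExV [simp]: "lc 0 \<phi> \<Longrightarrow> lc k (ExV v \<phi>)"
  by (rule lc_mono[of 0]) (simp_all add: ExV_def lc_close)

lemma lc_AllSt [simp]: "lc 0 \<phi> \<Longrightarrow> lc k (AllSt v \<phi>)"
  by (simp add: AllSt_def)

lemma eval_tsub:
  "tlc 0 u \<Longrightarrow> eval ap cn e ds (tsub v u t) = eval ap cn (e(v := eval ap cn e [] u)) ds t"
  by (induction t) (auto simp: eval_lc0[of u ap cn e ds])

lemma sat_sub:
  "tlc 0 u \<Longrightarrow> sat D ap cn S e ds (sub v u \<phi>) = sat D ap cn S (e(v := eval ap cn e [] u)) ds \<phi>"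
  by (induction \<phi> arbitrary: ds) (auto simp: eval_tsub)

lemma eval_tmsub:
  "(\<And>v. tlc 0 (s v)) \<Longrightarrow>
    eval ap cn e ds (tmsub s k [] t) = eval ap cn (\<lambda>v. eval ap cn e [] (s v)) ds t"
  by (induction t) (auto intro: eval_lc0)

lemma sat_msub:
  "(\<And>v. tlc 0 (s v)) \<Longrightarrow>
    sat D ap cn S e ds (msub s k [] \<phi>) = sat D ap cn S (\<lambda>v. eval ap cn e [] (s v)) ds \<phi>"
  by (induction \<phi> arbitrary: ds k) (auto simp: eval_tmsub)

section \<open>Completeness\<close>

instance ty :: countable by countable_datatype
instance cst :: countable by countable_datatype
instance tm :: countable by countable_datatype
instance fm :: countable by countable_datatype

lemma fresh_var:
  assumes "finite A"
  obtains v :: var where "snd v = \<sigma>" "v \<notin> A"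
proof -
  have "infinite (range (\<lambda>s :: string. (s, \<sigma>)))"
    using finite_imageD[of "\<lambda>s :: string. (s, \<sigma>)" UNIV] infinite_UNIV_listI
    by (auto simp: inj_on_def)
  then have "\<not> range (\<lambda>s :: string. (s, \<sigma>)) \<subseteq> A"
    using assms finite_subset by blast
  then obtain s where "(s, \<sigma>) \<notin> A" by blast
  then show ?thesis using that[of "(s, \<sigma>)"] by simp
qed

text \<open>\<open>lang True\<close> is \<open>L_st\<close> and \<open>lang False\<close> is \<open>L_int\<close>.\<close>

definition lang :: "bool \<Rightarrow> fm set" where
  "lang st = {\<phi>. wff [] \<phi> \<and> (st \<or> internal \<phi>)}"

lemma lang_simps [simp]:
  "Fls \<in> lang st"
  "(\<phi> \<^bold>\<longrightarrow> \<psi>) \<in> lang st \<longleftrightarrow> \<phi> \<in> lang st \<and> \<psi> \<in> lang st"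
  "(\<phi> \<^bold>\<and> \<psi>) \<in> lang st \<longleftrightarrow> \<phi> \<in> lang st \<and> \<psi> \<in> lang st"
  "(\<phi> \<^bold>\<or> \<psi>) \<in> lang st \<longleftrightarrow> \<phi> \<in> lang st \<and> \<psi> \<in> lang st"
  by (auto simp: lang_def)

lemma lang_inst:
  "All \<sigma> \<phi> \<in> lang st \<Longrightarrow> t ofty \<sigma> \<Longrightarrow> inst 0 t \<phi> \<in> lang st"
  "Ex \<sigma> \<phi> \<in> lang st \<Longrightarrow> t ofty \<sigma> \<Longrightarrow> inst 0 t \<phi> \<in> lang st"
  by (auto simp: lang_def wff_inst0)

lemma lang_All_Imp [simp]:
  "All \<sigma> (\<phi> \<^bold>\<longrightarrow> \<psi>) \<in> lang st \<longleftrightarrow> All \<sigma> \<phi> \<in> lang st \<and> All \<sigma> \<psi> \<in> lang st"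
  by (auto simp: lang_def)

lemma lang_lc: "\<phi> \<in> lang st \<Longrightarrow> lc 0 \<phi>"
  using lc_wff[of "[]"] by (simp add: lang_def)

lemma wff_weaken: "wff \<Delta> \<phi> \<Longrightarrow> wff (\<Delta> @ \<Delta>') \<phi>"
proof (induction \<phi> arbitrary: \<Delta>)
  case (All \<sigma> \<phi>)
  then show ?case using All.IH[of "\<sigma> # \<Delta>"] by simp
next
  case (Ex \<sigma> \<phi>)
  then show ?case using Ex.IH[of "\<sigma> # \<Delta>"] by simp
qed (auto intro: tty_append)

lemma lang_All: "\<phi> \<in> lang st \<Longrightarrow> All \<sigma> \<phi> \<in> lang st"
  using wff_weaken[of "[]" \<phi> "[\<sigma>]"] by (auto simp: lang_def)

section \<open>Derivability from a set of formulas\<close>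

definition imps :: "fm list \<Rightarrow> fm \<Rightarrow> fm" where
  "imps \<gamma>s \<phi> = foldr (\<^bold>\<longrightarrow>) \<gamma>s \<phi>"

lemma imps_simps [simp]: "imps [] \<phi> = \<phi>" "imps (\<gamma> # \<gamma>s) \<phi> = (\<gamma> \<^bold>\<longrightarrow> imps \<gamma>s \<phi>)"
  by (simp_all add: imps_def)

lemma imps_lang [simp]: "imps \<gamma>s \<phi> \<in> lang st \<longleftrightarrow> set \<gamma>s \<subseteq> lang st \<and> \<phi> \<in> lang st"
  by (induction \<gamma>s) auto

lemma ffv_imps: "ffv (imps \<gamma>s \<phi>) = \<Union> (ffv ` set \<gamma>s) \<union> ffv \<phi>"
  by (induction \<gamma>s) auto

lemma inst_imps: "set \<gamma>s \<subseteq> lang st \<Longrightarrow> inst 0 u (imps \<gamma>s \<phi>) = imps \<gamma>s (inst 0 u \<phi>)"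
  by (induction \<gamma>s) (auto simp: lc_inst[OF lang_lc])

lemma lang_All_imps:
  "set \<gamma>s \<subseteq> lang st \<Longrightarrow> All \<sigma> \<phi> \<in> lang st \<Longrightarrow> All \<sigma> (imps \<gamma>s \<phi>) \<in> lang st"
  by (induction \<gamma>s) (auto simp: lang_All)

lemma prov_imps_I:
  "prov (lang st) T (set \<gamma>s \<union> \<Gamma>) \<phi> \<Longrightarrow> set \<gamma>s \<subseteq> lang st \<Longrightarrow> prov (lang st) T \<Gamma> (imps \<gamma>s \<phi>)"
proof (induction \<gamma>s arbitrary: \<Gamma>)
  case (Cons \<gamma> \<gamma>s)
  then have "prov (lang st) T (insert \<gamma> \<Gamma>) (imps \<gamma>s \<phi>)" by simp
  then show ?case using Cons.prems by (auto intro: prov.ImpI)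
qed simp

lemma prov_imps_E:
  "prov L T \<Gamma> (imps \<gamma>s \<phi>) \<Longrightarrow> (\<And>\<gamma>. \<gamma> \<in> set \<gamma>s \<Longrightarrow> prov L T \<Gamma> \<gamma>) \<Longrightarrow> prov L T \<Gamma> \<phi>"
  by (induction \<gamma>s) (auto intro: prov.ImpE)

lemma prov_MP: "\<phi> \<in> \<Gamma> \<Longrightarrow> (\<phi> \<^bold>\<longrightarrow> \<psi>) \<in> \<Gamma> \<Longrightarrow> (\<phi> \<^bold>\<longrightarrow> \<psi>) \<in> lang st \<Longrightarrow> prov (lang st) T \<Gamma> \<psi>"
  by (rule prov.ImpE[OF prov.Asm prov.Asm]) auto

text \<open>No eigenvariable condition mentions the axioms, so the same derivation works.\<close>

lemma prov_mono:
  assumes "T \<subseteq> T'"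
  shows "prov L T \<Gamma> \<phi> \<Longrightarrow> prov L T' \<Gamma> \<phi>"
  by (induction rule: prov.induct) (use assms in \<open>auto intro: prov.intros\<close>)

text \<open>
  Weakening is not a rule of \<open>prov\<close>, and eigenvariables stand in the way of an easy proof. Hence
  derivability from a set of formulas is defined as derivability of an implication from no
  assumptions, which is monotone by definition.
\<close>

definition derives :: "bool \<Rightarrow> fm set \<Rightarrow> fm set \<Rightarrow> fm \<Rightarrow> bool" where
  "derives st T \<Gamma> \<phi> \<longleftrightarrow> (\<exists>\<gamma>s. set \<gamma>s \<subseteq> \<Gamma> \<and> prov (lang st) T {} (imps \<gamma>s \<phi>))"

lemma derives_mono: "derives st T \<Gamma> \<phi> \<Longrightarrow> \<Gamma> \<subseteq> \<Gamma>' \<Longrightarrow> derives st T \<Gamma>' \<phi>"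
  unfolding derives_def by blast

lemma derives_finite: "derives st T \<Gamma> \<phi> \<Longrightarrow> \<exists>\<Delta> \<subseteq> \<Gamma>. finite \<Delta> \<and> derives st T \<Delta> \<phi>"
  unfolding derives_def by (metis List.finite_set order_refl)

lemma derives_prov: "prov (lang st) T {} \<phi> \<Longrightarrow> derives st T \<Gamma> \<phi>"
  unfolding derives_def by (rule exI[of _ "[]"]) simp

lemma derives_asm: "\<phi> \<in> \<Gamma> \<Longrightarrow> \<phi> \<in> lang st \<Longrightarrow> derives st T \<Gamma> \<phi>"
  unfolding derives_def by (rule exI[of _ "[\<phi>]"]) (auto intro: prov.intros)

lemma derives_mp:
  assumes "derives st T \<Gamma> (\<phi> \<^bold>\<longrightarrow> \<psi>)" "derives st T \<Gamma> \<phi>" "\<Gamma> \<subseteq> lang st"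
    "\<phi> \<in> lang st" "\<psi> \<in> lang st"
  shows "derives st T \<Gamma> \<psi>"
proof -
  obtain \<gamma>s \<delta>s where gd: "set \<gamma>s \<subseteq> \<Gamma>" "prov (lang st) T {} (imps \<gamma>s (\<phi> \<^bold>\<longrightarrow> \<psi>))"
      "set \<delta>s \<subseteq> \<Gamma>" "prov (lang st) T {} (imps \<delta>s \<phi>)"
    using assms unfolding derives_def by blast
  \<comment> \<open>In place of weakening, the two derivable implications are assumed as hypotheses,
    discharged at the end, and then eliminated by their derivations from no assumptions.\<close>
  let ?A = "[imps \<gamma>s (\<phi> \<^bold>\<longrightarrow> \<psi>), imps \<delta>s \<phi>]" and ?B = "\<gamma>s @ \<delta>s"
  have L: "set ?A \<subseteq> lang st" "set ?B \<subseteq> lang st" using gd assms by auto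
  have asm: "prov (lang st) T (set ?B \<union> (set ?A \<union> {})) \<chi>" if "\<chi> \<in> set ?A \<union> set ?B" for \<chi>
    using that L by (intro prov.Asm) auto
  have "prov (lang st) T (set ?B \<union> (set ?A \<union> {})) (\<phi> \<^bold>\<longrightarrow> \<psi>)"
    by (rule prov_imps_E[OF asm[of "imps \<gamma>s (\<phi> \<^bold>\<longrightarrow> \<psi>)"]]) (simp, rule asm, simp)
  moreover have "prov (lang st) T (set ?B \<union> (set ?A \<union> {})) \<phi>"
    by (rule prov_imps_E[OF asm[of "imps \<delta>s \<phi>"]]) (simp, rule asm, simp)
  ultimately have "prov (lang st) T (set ?B \<union> (set ?A \<union> {})) \<psi>" by (rule prov.ImpE)
  then have "prov (lang st) T {} (imps ?A (imps ?B \<psi>))"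
    using L by (intro prov_imps_I) auto
  then have "prov (lang st) T {} (imps ?B \<psi>)"
    by (rule prov_imps_E) (use gd in auto)
  then show ?thesis unfolding derives_def using gd by (intro exI[of _ ?B]) auto
qed

lemma derives_rule:
  assumes "derives st T \<Gamma> \<phi>" "prov (lang st) T {\<phi>} \<psi>" "\<Gamma> \<subseteq> lang st" "\<phi> \<in> lang st" "\<psi> \<in> lang st"
  shows "derives st T \<Gamma> \<psi>"
  by (rule derives_mp[OF derives_prov assms(1)]) (use assms in \<open>auto intro: prov.ImpI\<close>)

lemma derives_rule2:
  assumes "derives st T \<Gamma> \<phi>" "derives st T \<Gamma> \<chi>" "prov (lang st) T {\<phi>, \<chi>} \<psi>"
    "\<Gamma> \<subseteq> lang st" "\<phi> \<in> lang st" "\<chi> \<in> lang st" "\<psi> \<in> lang st"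
  shows "derives st T \<Gamma> \<psi>"
proof -
  have "prov (lang st) T {} (\<chi> \<^bold>\<longrightarrow> \<phi> \<^bold>\<longrightarrow> \<psi>)"
    using assms by (intro prov.ImpI) auto
  then have "derives st T \<Gamma> (\<phi> \<^bold>\<longrightarrow> \<psi>)"
    using derives_mp[OF derives_prov assms(2)] assms by simp
  then show ?thesis using derives_mp assms by blast
qed

lemma derives_ded:
  assumes "derives st T (insert \<phi> \<Gamma>) \<psi>" "\<Gamma> \<subseteq> lang st" "\<phi> \<in> lang st" "\<psi> \<in> lang st"
  shows "derives st T \<Gamma> (\<phi> \<^bold>\<longrightarrow> \<psi>)"
proof -
  obtain \<gamma>s where g: "set \<gamma>s \<subseteq> insert \<phi> \<Gamma>" "prov (lang st) T {} (imps \<gamma>s \<psi>)"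
    using assms unfolding derives_def by blast
  \<comment> \<open>All occurrences of \<open>\<phi>\<close> among the premises are dropped and one
    is put at the end, where it becomes the antecedent of \<open>\<psi>\<close>.\<close>
  let ?d = "filter (\<lambda>\<gamma>. \<gamma> \<noteq> \<phi>) \<gamma>s"
  let ?G = "set (?d @ [\<phi>]) \<union> {imps \<gamma>s \<psi>}"
  have L: "set \<gamma>s \<subseteq> lang st" using g assms by auto
  have asm: "prov (lang st) T ?G \<chi>" if "\<chi> \<in> insert (imps \<gamma>s \<psi>) (set \<gamma>s)" for \<chi>
    using that L assms by (intro prov.Asm) auto
  have "prov (lang st) T ?G \<psi>"
    by (rule prov_imps_E[OF asm[of "imps \<gamma>s \<psi>"]]) (simp, rule asm, simp)
  then have "prov (lang st) T {imps \<gamma>s \<psi>} (imps (?d @ [\<phi>]) \<psi>)"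
    using L assms by (intro prov_imps_I) auto
  then have "prov (lang st) T {} (imps \<gamma>s \<psi> \<^bold>\<longrightarrow> imps (?d @ [\<phi>]) \<psi>)"
    using L assms by (intro prov.ImpI) auto
  then have "prov (lang st) T {} (imps (?d @ [\<phi>]) \<psi>)" using g(2) by (rule prov.ImpE)
  then have "prov (lang st) T {} (imps ?d (\<phi> \<^bold>\<longrightarrow> \<psi>))" by (simp add: imps_def)
  then show ?thesis unfolding derives_def using g(1) by (intro exI[of _ ?d]) auto
qed

lemma derives_gen:
  assumes "derives st T \<Gamma> (inst 0 (FV v) \<phi>)" "v \<notin> ffv \<phi>" "\<forall>\<gamma>\<in>\<Gamma>. v \<notin> ffv \<gamma>"
    "\<Gamma> \<subseteq> lang st" "All (snd v) \<phi> \<in> lang st"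
  shows "derives st T \<Gamma> (All (snd v) \<phi>)"
proof -
  obtain \<gamma>s where g: "set \<gamma>s \<subseteq> \<Gamma>" "prov (lang st) T {} (imps \<gamma>s (inst 0 (FV v) \<phi>))"
    using assms unfolding derives_def by blast
  have L: "set \<gamma>s \<subseteq> lang st" using g assms by auto
  \<comment> \<open>With the premises inside the formula the context is empty, and
    \<open>AllI\<close> applies. Then the quantifier is moved past the premises, in which
    \<open>v\<close> does not occur.\<close>
  let ?A = "All (snd v) (imps \<gamma>s \<phi>)"
  have AL: "?A \<in> lang st" using L assms by (simp add: lang_All_imps)
  have "prov (lang st) T {} ?A"
    using g assms by (intro prov.AllI) (auto simp: inst_imps[OF L] ffv_imps)
  moreover have "prov (lang st) T {} (?A \<^bold>\<longrightarrow> imps \<gamma>s (All (snd v) \<phi>))"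
  proof (intro prov.ImpI[OF prov_imps_I] AL L prov.AllI)
    have "prov (lang st) T (set \<gamma>s \<union> {?A}) (inst 0 (FV v) (imps \<gamma>s \<phi>))"
      by (rule prov.AllE[OF prov.Asm]) (use AL in auto)
    then show "prov (lang st) T (set \<gamma>s \<union> {?A}) (inst 0 (FV v) \<phi>)"
      unfolding inst_imps[OF L]
      by (rule prov_imps_E) (use L in \<open>auto intro: prov.Asm\<close>)
  qed (use assms g in \<open>auto simp: ffv_imps\<close>)
  ultimately have "prov (lang st) T {} (imps \<gamma>s (All (snd v) \<phi>))" by (rule prov.ImpE[rotated])
  then show ?thesis unfolding derives_def using g by blast
qed

section \<open>Maximal consistent sets with witnesses\<close>

definition consistent :: "bool \<Rightarrow> fm set \<Rightarrow> fm set \<Rightarrow> bool" where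
  "consistent st T \<Gamma> \<longleftrightarrow> \<not> derives st T \<Gamma> Fls"

text \<open>If the instance were inconsistent with \<open>\<Gamma>\<close>, its negation would be
  derivable; generalizing over the fresh variable then contradicts the existential formula.\<close>

lemma consistent_witness:
  assumes "consistent st T \<Gamma>" "Ex (snd v) \<phi> \<in> \<Gamma>" "\<Gamma> \<subseteq> lang st" "\<forall>\<gamma>\<in>\<Gamma>. v \<notin> ffv \<gamma>"
  shows "consistent st T (insert (inst 0 (FV v) \<phi>) \<Gamma>)"
proof (rule ccontr)
  let ?E = "Ex (snd v) \<phi>" and ?N = "All (snd v) (\<^bold>\<not> \<phi>)"
  assume "\<not> ?thesis"
  then have "derives st T (insert (inst 0 (FV v) \<phi>) \<Gamma>) Fls" by (simp add: consistent_def)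
  moreover have EL: "?E \<in> lang st" "inst 0 (FV v) \<phi> \<in> lang st"
    using assms by (auto intro: lang_inst)
  ultimately have "derives st T \<Gamma> (inst 0 (FV v) (\<^bold>\<not> \<phi>))"
    using derives_ded assms by simp
  moreover have NL: "?N \<in> lang st" using EL(1) by (simp add: lang_def)
  moreover have v: "v \<notin> ffv \<phi>" using assms by force
  ultimately have *: "derives st T \<Gamma> ?N" using assms by (intro derives_gen) auto
  have "prov (lang st) T {?N, ?E} Fls"
  proof (rule prov.ExE[of _ _ _ v])
    show "prov (lang st) T {?N, ?E} ?E" using EL by (auto intro: prov.Asm)
    let ?G = "insert (inst 0 (FV v) \<phi>) {?N, ?E}"
    have "prov (lang st) T ?G (inst 0 (FV v) (\<^bold>\<not> \<phi>))"
      by (rule prov.AllE[OF prov.Asm]) (use NL in auto)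
    moreover have "prov (lang st) T ?G (inst 0 (FV v) \<phi>)"
      using EL by (intro prov.Asm) auto
    ultimately show "prov (lang st) T ?G Fls" using prov.ImpE by simp
  qed (use v in auto)
  then have "derives st T \<Gamma> Fls"
    using derives_rule2[OF * derives_asm[OF assms(2) EL(1)]] NL EL assms by simp
  then show False using assms(1) by (simp add: consistent_def)
qed

text \<open>The witnesses are variables rather than new constants, so the language stays fixed: a
  stage is a finite set of formulas, and some variable of the required type is fresh for it.\<close>

definition extends :: "bool \<Rightarrow> fm set \<Rightarrow> fm set \<Rightarrow> fm \<Rightarrow> fm set \<Rightarrow> bool" where
  "extends st T \<Gamma> \<phi> \<Gamma>' \<longleftrightarrow>
    finite \<Gamma>' \<and> \<Gamma>' \<subseteq> lang st \<and> consistent st T \<Gamma>' \<and> \<Gamma> \<subseteq> \<Gamma>' \<and>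
    (\<phi> \<in> lang st \<longrightarrow> consistent st T (insert \<phi> \<Gamma>) \<longrightarrow> \<phi> \<in> \<Gamma>' \<and>
      (\<forall>\<sigma> \<psi>. \<phi> = Ex \<sigma> \<psi> \<longrightarrow> (\<exists>v. snd v = \<sigma> \<and> inst 0 (FV v) \<psi> \<in> \<Gamma>')))"

lemma extends_exists:
  assumes "finite \<Gamma>" "\<Gamma> \<subseteq> lang st" "consistent st T \<Gamma>"
  shows "\<exists>\<Gamma>'. extends st T \<Gamma> \<phi> \<Gamma>'"
proof (cases "\<phi> \<in> lang st \<and> consistent st T (insert \<phi> \<Gamma>)")
  case True
  show ?thesis
  proof (cases "\<exists>\<sigma> \<psi>. \<phi> = Ex \<sigma> \<psi>")
    case ex: True
    then obtain \<sigma> \<psi> where \<phi>: "\<phi> = Ex \<sigma> \<psi>" by blast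
    obtain v where v: "snd v = \<sigma>" "v \<notin> \<Union> (ffv ` insert \<phi> \<Gamma>)"
      using fresh_var[of "\<Union> (ffv ` insert \<phi> \<Gamma>)" \<sigma>] assms by auto
    let ?W = "insert (inst 0 (FV v) \<psi>) (insert \<phi> \<Gamma>)"
    have "consistent st T ?W"
      using True assms v \<phi> by (intro consistent_witness) auto
    moreover have "inst 0 (FV v) \<psi> \<in> lang st"
      using True \<phi> v by (auto intro: lang_inst)
    ultimately have "extends st T \<Gamma> \<phi> ?W"
      using True assms \<phi> v unfolding extends_def by blast
    then show ?thesis ..
  next
    case False
    then have "extends st T \<Gamma> \<phi> (insert \<phi> \<Gamma>)"
      using True assms by (auto simp: extends_def)
    then show ?thesis ..
  qed
next
  case False
  then have "extends st T \<Gamma> \<phi> \<Gamma>" using assms by (auto simp: extends_def)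
  then show ?thesis ..
qed

primrec henkin_seq :: "bool \<Rightarrow> fm set \<Rightarrow> fm set \<Rightarrow> nat \<Rightarrow> fm set" where
  "henkin_seq st T \<Gamma> 0 = \<Gamma>"
| "henkin_seq st T \<Gamma> (Suc n) =
    (SOME \<Gamma>'. extends st T (henkin_seq st T \<Gamma> n) (from_nat n) \<Gamma>')"

definition henkin_set :: "bool \<Rightarrow> fm set \<Rightarrow> fm set \<Rightarrow> fm set" where
  "henkin_set st T \<Gamma> = (\<Union>n. henkin_seq st T \<Gamma> n)"

locale henkin =
  fixes st :: bool and T \<Gamma> :: "fm set"
  assumes fin: "finite \<Gamma>" and lang: "\<Gamma> \<subseteq> lang st" and cons: "consistent st T \<Gamma>"
begin

abbreviation "H \<equiv> henkin_set st T \<Gamma>"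

lemma seq_ok:
  "finite (henkin_seq st T \<Gamma> n) \<and> henkin_seq st T \<Gamma> n \<subseteq> lang st \<and> consistent st T (henkin_seq st T \<Gamma> n)"
proof (induction n)
  case (Suc n)
  then have "extends st T (henkin_seq st T \<Gamma> n) (from_nat n) (henkin_seq st T \<Gamma> (Suc n))"
    using someI_ex[OF extends_exists] by simp
  then show ?case by (simp add: extends_def)
qed (simp add: fin lang cons)

lemma seq_extends:
  "extends st T (henkin_seq st T \<Gamma> n) (from_nat n) (henkin_seq st T \<Gamma> (Suc n))"
  using seq_ok[of n] someI_ex[OF extends_exists] by simp

lemma seq_mono: "m \<le> n \<Longrightarrow> henkin_seq st T \<Gamma> m \<subseteq> henkin_seq st T \<Gamma> n"
  by (rule lift_Suc_mono_le[of "henkin_seq st T \<Gamma>"]) (use seq_extends in \<open>auto simp: extends_def\<close>)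

lemma H_lang: "H \<subseteq> lang st"
  using seq_ok by (auto simp: henkin_set_def)

lemma \<Gamma>_H: "\<Gamma> \<subseteq> H"
  using UN_upper[of 0 UNIV "henkin_seq st T \<Gamma>"] by (simp add: henkin_set_def)

lemma H_cons: "consistent st T H"
proof (rule ccontr)
  assume "\<not> ?thesis"
  then have "derives st T H Fls" by (simp add: consistent_def)
  from derives_finite[OF this] obtain \<Delta> where
    \<Delta>: "\<Delta> \<subseteq> H" "finite \<Delta>" "derives st T \<Delta> Fls"
    by auto
  have "\<exists>n. \<Delta> \<subseteq> henkin_seq st T \<Gamma> n"
    using \<Delta>(2,1)
  proof (induction \<Delta>)
    case (insert \<delta> \<Delta>)
    then obtain m n where "\<Delta> \<subseteq> henkin_seq st T \<Gamma> m" "\<delta> \<in> henkin_seq st T \<Gamma> n"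
      by (auto simp: henkin_set_def)
    then have "insert \<delta> \<Delta> \<subseteq> henkin_seq st T \<Gamma> (max m n)"
      using seq_mono[of m "max m n"] seq_mono[of n "max m n"] by auto
    then show ?case ..
  qed simp
  then obtain n where "derives st T (henkin_seq st T \<Gamma> n) Fls"
    using derives_mono[OF \<Delta>(3)] by auto
  then show False using seq_ok[of n] by (simp add: consistent_def)
qed

lemma H_max:
  assumes "\<phi> \<in> lang st" "consistent st T (insert \<phi> H)"
  shows "\<phi> \<in> H" and "\<phi> = Ex \<sigma> \<psi> \<Longrightarrow> \<exists>v. snd v = \<sigma> \<and> inst 0 (FV v) \<psi> \<in> H"
proof -
  \<comment> \<open>The formula is examined at the stage given by its code. The set reached there is
    a subset of \<open>H\<close>, so consistency with \<open>H\<close> implies consistency with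
    it.\<close>
  let ?n = "to_nat \<phi>"
  have "insert \<phi> (henkin_seq st T \<Gamma> ?n) \<subseteq> insert \<phi> H" by (auto simp: henkin_set_def)
  then have "consistent st T (insert \<phi> (henkin_seq st T \<Gamma> ?n))"
    using assms(2) derives_mono[of st T _ Fls] by (auto simp: consistent_def)
  then have *: "\<phi> \<in> henkin_seq st T \<Gamma> (Suc ?n)"
    "\<phi> = Ex \<sigma> \<psi> \<Longrightarrow> \<exists>v. snd v = \<sigma> \<and> inst 0 (FV v) \<psi> \<in> henkin_seq st T \<Gamma> (Suc ?n)" for \<sigma> \<psi>
    using seq_extends[of ?n] assms(1) unfolding extends_def by auto
  then show "\<phi> \<in> H" unfolding henkin_set_def by blast
  show "\<exists>v. snd v = \<sigma> \<and> inst 0 (FV v) \<psi> \<in> H" if "\<phi> = Ex \<sigma> \<psi>"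
    using *(2)[OF that] unfolding henkin_set_def by blast
qed

lemma H_closed:
  assumes "derives st T H \<phi>" "\<phi> \<in> lang st"
  shows "\<phi> \<in> H"
proof (rule H_max(1)[OF assms(2)], rule ccontr)
  assume "\<not> consistent st T (insert \<phi> H)"
  then have "derives st T H (\<^bold>\<not> \<phi>)"
    using derives_ded assms(2) H_lang by (simp add: consistent_def)
  then have "derives st T H Fls"
    using derives_mp assms H_lang by simp
  then show False using H_cons by (simp add: consistent_def)
qed

lemma H_rule: "\<phi> \<in> H \<Longrightarrow> prov (lang st) T {\<phi>} \<psi> \<Longrightarrow> \<psi> \<in> lang st \<Longrightarrow> \<psi> \<in> H"
  using derives_rule[OF derives_asm] H_closed H_lang by blast

lemma H_rule2:
  "\<phi> \<in> H \<Longrightarrow> \<chi> \<in> H \<Longrightarrow> prov (lang st) T {\<phi>, \<chi>} \<psi> \<Longrightarrow> \<psi> \<in> lang st \<Longrightarrow> \<psi> \<in> H"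
  using derives_rule2[OF derives_asm derives_asm] H_closed H_lang by blast

lemma H_prov: "prov (lang st) T {} \<phi> \<Longrightarrow> \<phi> \<in> lang st \<Longrightarrow> \<phi> \<in> H"
  using derives_prov H_closed by blast

lemma H_Fls: "Fls \<notin> H"
  using H_cons derives_asm unfolding consistent_def by fastforce

lemma H_Neg: "\<phi> \<in> lang st \<Longrightarrow> (\<^bold>\<not> \<phi>) \<in> H \<longleftrightarrow> \<phi> \<notin> H"
proof
  assume \<phi>: "\<phi> \<in> lang st"
  show "\<phi> \<notin> H" if "(\<^bold>\<not> \<phi>) \<in> H"
  proof
    assume "\<phi> \<in> H"
    with that have "Fls \<in> H"
      by (rule H_rule2) (use \<phi> in \<open>auto intro: prov_MP\<close>)
    then show False using H_Fls by simp
  qed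
  assume "\<phi> \<notin> H"
  then have "\<not> consistent st T (insert \<phi> H)" using H_max \<phi> by blast
  then show "(\<^bold>\<not> \<phi>) \<in> H"
    using derives_ded[of st T \<phi> H Fls] \<phi> H_lang H_closed by (auto simp: consistent_def)
qed

lemma H_Imp:
  assumes "(\<phi> \<^bold>\<longrightarrow> \<psi>) \<in> lang st"
  shows "(\<phi> \<^bold>\<longrightarrow> \<psi>) \<in> H \<longleftrightarrow> (\<phi> \<in> H \<longrightarrow> \<psi> \<in> H)"
proof
  assume "(\<phi> \<^bold>\<longrightarrow> \<psi>) \<in> H"
  then show "\<phi> \<in> H \<longrightarrow> \<psi> \<in> H"
    using H_rule2[of "\<phi> \<^bold>\<longrightarrow> \<psi>" \<phi> \<psi>] prov_MP[of \<phi> "{\<phi> \<^bold>\<longrightarrow> \<psi>, \<phi>}" \<psi>] assms by simp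
next
  assume *: "\<phi> \<in> H \<longrightarrow> \<psi> \<in> H"
  show "(\<phi> \<^bold>\<longrightarrow> \<psi>) \<in> H"
  proof (cases "\<phi> \<in> H")
    case True
    then have "\<psi> \<in> H" using * by simp
    then show ?thesis
      by (rule H_rule[OF _ prov.ImpI[OF prov.Asm]]) (use assms in auto)
  next
    case False
    then have n: "(\<^bold>\<not> \<phi>) \<in> H" using H_Neg assms by simp
    have "prov (lang st) T {\<^bold>\<not> \<psi>, \<phi>, \<^bold>\<not> \<phi>} Fls"
      using assms by (intro prov_MP[of \<phi>]) simp_all
    then have "prov (lang st) T {\<^bold>\<not> \<phi>} (\<phi> \<^bold>\<longrightarrow> \<psi>)"
      using assms by (intro prov.ImpI[OF prov.Classical]) auto
    then show ?thesis using H_rule[OF n] assms by simp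
  qed
qed

lemma H_Con:
  assumes "(\<phi> \<^bold>\<and> \<psi>) \<in> lang st"
  shows "(\<phi> \<^bold>\<and> \<psi>) \<in> H \<longleftrightarrow> \<phi> \<in> H \<and> \<psi> \<in> H"
proof
  assume *: "(\<phi> \<^bold>\<and> \<psi>) \<in> H"
  then have "prov (lang st) T {\<phi> \<^bold>\<and> \<psi>} (\<phi> \<^bold>\<and> \<psi>)" using assms by (auto intro: prov.Asm)
  then show "\<phi> \<in> H \<and> \<psi> \<in> H"
    using H_rule[OF * prov.ConE1] H_rule[OF * prov.ConE2] assms by auto
next
  assume "\<phi> \<in> H \<and> \<psi> \<in> H"
  then show "(\<phi> \<^bold>\<and> \<psi>) \<in> H"
    using H_rule2[of \<phi> \<psi> "\<phi> \<^bold>\<and> \<psi>"] assms by (simp add: prov.ConI prov.Asm)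
qed

lemma H_Dis:
  assumes "(\<phi> \<^bold>\<or> \<psi>) \<in> lang st"
  shows "(\<phi> \<^bold>\<or> \<psi>) \<in> H \<longleftrightarrow> \<phi> \<in> H \<or> \<psi> \<in> H"
proof
  assume *: "(\<phi> \<^bold>\<or> \<psi>) \<in> H"
  show "\<phi> \<in> H \<or> \<psi> \<in> H"
  proof (rule ccontr)
    assume "\<not> ?thesis"
    then have "(\<^bold>\<not> \<phi>) \<in> H" "(\<^bold>\<not> \<psi>) \<in> H" using H_Neg assms by auto
    then have n: "(\<^bold>\<not> \<phi> \<^bold>\<and> \<^bold>\<not> \<psi>) \<in> H" using H_Con assms by auto
    let ?G = "{\<phi> \<^bold>\<or> \<psi>, \<^bold>\<not> \<phi> \<^bold>\<and> \<^bold>\<not> \<psi>}"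
    have C: "prov (lang st) T (insert \<chi> ?G) (\<^bold>\<not> \<phi> \<^bold>\<and> \<^bold>\<not> \<psi>)" for \<chi>
      using assms by (intro prov.Asm) auto
    have A: "prov (lang st) T (insert \<phi> ?G) Fls"
      by (rule prov.ImpE[OF prov.ConE1[OF C] prov.Asm]) (use assms in auto)
    have B: "prov (lang st) T (insert \<psi> ?G) Fls"
      by (rule prov.ImpE[OF prov.ConE2[OF C] prov.Asm]) (use assms in auto)
    have "prov (lang st) T ?G Fls"
      by (rule prov.DisE[OF prov.Asm A B]) (use assms in auto)
    then have "Fls \<in> H" using H_rule2[OF * n] by simp
    then show False using H_Fls by simp
  qed
next
  assume "\<phi> \<in> H \<or> \<psi> \<in> H"
  then show "(\<phi> \<^bold>\<or> \<psi>) \<in> H"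
    using H_rule[of \<phi> "\<phi> \<^bold>\<or> \<psi>"] H_rule[of \<psi> "\<phi> \<^bold>\<or> \<psi>"] assms
    by (auto simp: prov.DisI1 prov.DisI2 prov.Asm)
qed

lemma H_Ex:
  assumes "Ex \<sigma> \<phi> \<in> lang st"
  shows "Ex \<sigma> \<phi> \<in> H \<longleftrightarrow> (\<exists>t. t ofty \<sigma> \<and> inst 0 t \<phi> \<in> H)"
proof
  assume *: "Ex \<sigma> \<phi> \<in> H"
  then have "consistent st T (insert (Ex \<sigma> \<phi>) H)" using H_cons by (simp add: insert_absorb)
  then obtain v where "snd v = \<sigma>" "inst 0 (FV v) \<phi> \<in> H"
    using H_max(2) assms by blast
  then show "\<exists>t. t ofty \<sigma> \<and> inst 0 t \<phi> \<in> H" by (intro exI[of _ "FV v"]) simp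
next
  assume "\<exists>t. t ofty \<sigma> \<and> inst 0 t \<phi> \<in> H"
  then obtain t where t: "t ofty \<sigma>" "inst 0 t \<phi> \<in> H" by blast
  show "Ex \<sigma> \<phi> \<in> H"
    by (rule H_rule[OF t(2) prov.ExI[OF prov.Asm t(1)]]) (use assms t H_lang in auto)
qed

lemma H_All:
  assumes "All \<sigma> \<phi> \<in> lang st"
  shows "All \<sigma> \<phi> \<in> H \<longleftrightarrow> (\<forall>t. t ofty \<sigma> \<longrightarrow> inst 0 t \<phi> \<in> H)"
proof
  assume *: "All \<sigma> \<phi> \<in> H"
  show "\<forall>t. t ofty \<sigma> \<longrightarrow> inst 0 t \<phi> \<in> H"
  proof (intro allI impI)
    fix t assume t: "t ofty \<sigma>"
    show "inst 0 t \<phi> \<in> H"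
      by (rule H_rule[OF * prov.AllE[OF prov.Asm t]]) (use assms t lang_inst in auto)
  qed
next
  assume *: "\<forall>t. t ofty \<sigma> \<longrightarrow> inst 0 t \<phi> \<in> H"
  show "All \<sigma> \<phi> \<in> H"
  proof (rule ccontr)
    assume "All \<sigma> \<phi> \<notin> H"
    then have n: "(\<^bold>\<not> (All \<sigma> \<phi>)) \<in> H" using H_Neg assms by simp
    \<comment> \<open>Only existential formulas have witnesses in \<open>H\<close>, so the failure
      of a universal one is first turned into \<open>?E\<close> by a classical derivation.\<close>
    let ?E = "Ex \<sigma> (\<^bold>\<not> \<phi>)"
    have EL: "?E \<in> lang st" using assms by (simp add: lang_def)
    obtain v where v: "snd v = \<sigma>" "v \<notin> ffv \<phi>" using fresh_var[of "ffv \<phi>" \<sigma>] by auto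
    have \<phi>L: "inst 0 (FV v) \<phi> \<in> lang st" using assms v by (auto intro: lang_inst)
    let ?G = "{\<^bold>\<not> ?E, \<^bold>\<not> (All \<sigma> \<phi>)}"
    have "prov (lang st) T (insert (\<^bold>\<not> (inst 0 (FV v) \<phi>)) ?G) (inst 0 (FV v) (\<^bold>\<not> \<phi>))"
      using \<phi>L by (intro prov.Asm) auto
    then have "prov (lang st) T (insert (\<^bold>\<not> (inst 0 (FV v) \<phi>)) ?G) ?E"
      by (rule prov.ExI) (use EL v in auto)
    then have "prov (lang st) T (insert (\<^bold>\<not> (inst 0 (FV v) \<phi>)) ?G) Fls"
      by (rule prov.ImpE[OF prov.Asm[of "\<^bold>\<not> ?E"], rotated 2]) (use EL in auto)
    then have "prov (lang st) T ?G (inst 0 (FV v) \<phi>)"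
      using \<phi>L by (rule prov.Classical)
    then have "prov (lang st) T ?G (All \<sigma> \<phi>)"
      using v prov.AllI[of "lang st" T ?G v \<phi>] by auto
    then have "prov (lang st) T ?G Fls"
      by (rule prov.ImpE[OF prov.Asm[of "\<^bold>\<not> (All \<sigma> \<phi>)"], rotated 2]) (use assms in auto)
    then have "prov (lang st) T {\<^bold>\<not> (All \<sigma> \<phi>)} ?E" using EL by (rule prov.Classical)
    then have "?E \<in> H" using H_rule[OF n] EL by blast
    then obtain t where t: "t ofty \<sigma>" "(\<^bold>\<not> (inst 0 t \<phi>)) \<in> H" using H_Ex EL by auto
    then show False using * H_Neg[OF lang_inst(1)[OF assms t(1)]] by simp
  qed
qed

end

section \<open>The quotient of the terms by equality in the Henkin set\<close>

locale term_model = henkin +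
  assumes EPRA_T: "EPRA \<subseteq> T" and T_st_T: "st \<Longrightarrow> T_st \<subseteq> T"
begin

lemma H_ax: "\<phi> \<in> T \<Longrightarrow> \<phi> \<in> lang st \<Longrightarrow> \<phi> \<in> H"
  using H_prov prov.Ax by blast

lemma Eq_lang: "s ofty \<sigma> \<Longrightarrow> t ofty \<sigma> \<Longrightarrow> Eq \<sigma> s t \<in> lang st"
  by (simp add: lang_def)

lemma H_refl: "t ofty \<sigma> \<Longrightarrow> Eq \<sigma> t t \<in> H"
  using EPRA_T EPRA.eq_refl by (intro H_ax) (auto simp: Eq_lang)

lemma H_trans':
  assumes "x ofty \<sigma>" "y ofty \<sigma>" "z ofty \<sigma>" "Eq \<sigma> x y \<in> H" "Eq \<sigma> x z \<in> H"
  shows "Eq \<sigma> y z \<in> H"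
proof -
  have "(Eq \<sigma> x y \<^bold>\<longrightarrow> Eq \<sigma> x z \<^bold>\<longrightarrow> Eq \<sigma> y z) \<in> H"
    using assms EPRA_T EPRA.eq_trans by (intro H_ax) (auto simp: Eq_lang)
  then show ?thesis using assms by (simp add: H_Imp Eq_lang)
qed

lemma H_sym: "x ofty \<sigma> \<Longrightarrow> y ofty \<sigma> \<Longrightarrow> Eq \<sigma> x y \<in> H \<Longrightarrow> Eq \<sigma> y x \<in> H"
  using H_trans' H_refl by blast

lemma H_trans:
  "x ofty \<sigma> \<Longrightarrow> y ofty \<sigma> \<Longrightarrow> z ofty \<sigma> \<Longrightarrow> Eq \<sigma> x y \<in> H \<Longrightarrow> Eq \<sigma> y z \<in> H \<Longrightarrow> Eq \<sigma> x z \<in> H"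
  using H_trans' H_sym by blast

text \<open>The function is replaced by means of \<open>eq_fun\<close>, the argument by means of
  \<open>ext\<close>. Thus equality in \<open>H\<close> is a congruence and application descends to
  classes.\<close>

lemma H_app:
  assumes "f ofty \<sigma> \<rightarrow> \<tau>" "g ofty \<sigma> \<rightarrow> \<tau>" "x ofty \<sigma>" "y ofty \<sigma>"
    "Eq (\<sigma> \<rightarrow> \<tau>) f g \<in> H" "Eq \<sigma> x y \<in> H"
  shows "Eq \<tau> (f \<cdot> x) (g \<cdot> y) \<in> H"
proof -
  have ty: "f \<cdot> x ofty \<tau>" "f \<cdot> y ofty \<tau>" "g \<cdot> y ofty \<tau>" using assms by simp_all
  let ?A = "All \<sigma> (Eq \<tau> (f \<cdot> BV 0) (g \<cdot> BV 0))"
  have A: "?A \<in> lang st"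
    using assms(1,2)[THEN tty_weaken, of "[\<sigma>]"] by (simp add: lang_def)
  have "(Eq (\<sigma> \<rightarrow> \<tau>) f g \<^bold>\<longleftrightarrow> ?A) \<in> H"
    using assms A EPRA_T EPRA.eq_fun by (intro H_ax) (auto simp: Eq_lang)
  then have "?A \<in> H" using assms A by (simp add: H_Con H_Imp Eq_lang)
  then have "inst 0 y (Eq \<tau> (f \<cdot> BV 0) (g \<cdot> BV 0)) \<in> H" using H_All A assms by blast
  moreover have "tlc 0 f" "tlc 0 g" using assms(1,2) tlc_tty by force+
  ultimately have "Eq \<tau> (f \<cdot> y) (g \<cdot> y) \<in> H" by (simp add: tlc_tinst)
  moreover have "(Eq \<sigma> x y \<^bold>\<longrightarrow> Eq \<tau> (f \<cdot> x) (f \<cdot> y)) \<in> H"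
    using assms ty EPRA_T EPRA.ext by (intro H_ax) (auto simp: Eq_lang)
  then have "Eq \<tau> (f \<cdot> x) (f \<cdot> y) \<in> H" using assms ty by (simp add: H_Imp Eq_lang)
  ultimately show ?thesis using H_trans ty by blast
qed

definition cl :: "tm \<Rightarrow> tm set" where
  "cl t = {s. \<exists>\<sigma>. t ofty \<sigma> \<and> s ofty \<sigma> \<and> Eq \<sigma> t s \<in> H}"

definition Dom :: "ty \<Rightarrow> tm set set" where
  "Dom \<sigma> = cl ` {t. t ofty \<sigma>}"

definition app :: "tm set \<Rightarrow> tm set \<Rightarrow> tm set" where
  "app X Y = cl ((SOME s. s \<in> X) \<cdot> (SOME t. t \<in> Y))"

definition stn :: "ty \<Rightarrow> tm set set" where
  "stn \<sigma> = cl ` {t. t ofty \<sigma> \<and> St \<sigma> t \<in> H}"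

lemma ball_Dom: "(\<forall>d \<in> Dom \<sigma>. P d) \<longleftrightarrow> (\<forall>t. t ofty \<sigma> \<longrightarrow> P (cl t))"
  and bex_Dom: "(\<exists>d \<in> Dom \<sigma>. P d) \<longleftrightarrow> (\<exists>t. t ofty \<sigma> \<and> P (cl t))"
  by (auto simp: Dom_def)

lemma cl_typed: "t ofty \<sigma> \<Longrightarrow> cl t = {s. s ofty \<sigma> \<and> Eq \<sigma> t s \<in> H}"
  by (simp add: cl_def)

lemma cl_eq:
  assumes "s ofty \<sigma>" "t ofty \<sigma>"
  shows "cl s = cl t \<longleftrightarrow> Eq \<sigma> s t \<in> H"
proof
  assume "cl s = cl t"
  moreover have "t \<in> cl t" using assms H_refl by (auto simp: cl_def)
  ultimately have "t \<in> cl s" by simp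
  then show "Eq \<sigma> s t \<in> H" using assms by (simp add: cl_def)
next
  assume "Eq \<sigma> s t \<in> H"
  then have "Eq \<sigma> s u \<in> H \<longleftrightarrow> Eq \<sigma> t u \<in> H" if "u ofty \<sigma>" for u
    using assms that H_trans[of s \<sigma> t u] H_trans'[of s \<sigma> t u] by blast
  then show "cl s = cl t" using assms by (auto simp: cl_typed)
qed

lemma cl_some: "t ofty \<sigma> \<Longrightarrow> (SOME s. s \<in> cl t) ofty \<sigma> \<and> Eq \<sigma> t (SOME s. s \<in> cl t) \<in> H"
proof -
  assume t: "t ofty \<sigma>"
  then have "t \<in> cl t" using H_refl by (auto simp: cl_def)
  then have "(SOME s. s \<in> cl t) \<in> cl t" by (rule someI)
  then show ?thesis using t by (simp add: cl_def)
qed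

lemma app_cl:
  assumes "s ofty \<sigma> \<rightarrow> \<tau>" "t ofty \<sigma>"
  shows "app (cl s) (cl t) = cl (s \<cdot> t)"
proof -
  note s = cl_some[OF assms(1)] and t = cl_some[OF assms(2)]
  have "Eq \<tau> (s \<cdot> t) ((SOME u. u \<in> cl s) \<cdot> (SOME u. u \<in> cl t)) \<in> H"
    using H_app s t assms by blast
  then have "cl (s \<cdot> t) = cl ((SOME u. u \<in> cl s) \<cdot> (SOME u. u \<in> cl t))"
    using s t assms by (subst cl_eq[of _ \<tau>]) auto
  then show ?thesis by (simp add: app_def)
qed

lemma eval_cl:
  assumes "\<And>v. s v ofty snd v" "list_all2 (\<lambda>d \<sigma>. d ofty \<sigma>) ds \<Delta>"
  shows "tty \<Delta> t = Some \<sigma> \<Longrightarrow>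
    eval app (\<lambda>c. cl (Cn c)) (\<lambda>v. cl (s v)) (map cl ds) t = cl (tmsub s 0 ds t)"
proof (induction t arbitrary: \<sigma>)
  case (BV i)
  then show ?case using list_all2_lengthD[OF assms(2)] by (auto split: if_splits)
next
  case (App t u)
  then obtain \<rho> where tu: "tty \<Delta> t = Some (\<rho> \<rightarrow> \<sigma>)" "tty \<Delta> u = Some \<rho>" by auto
  then have "tmsub s 0 ds t ofty \<rho> \<rightarrow> \<sigma>" "tmsub s 0 ds u ofty \<rho>"
    using tty_tmsub[OF assms, of "[]"] by simp_all
  then show ?case using App.IH tu by (simp add: app_cl)
qed simp_all

text \<open>Truth lemma. It assigns terms to free variables and to dangling indices alike, because
  the induction passes under binders and every object of the model is the class of a term.\<close>

lemma sat_iff_H: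
  assumes s: "\<And>v. s v ofty snd v"
  shows "list_all2 (\<lambda>d \<sigma>. d ofty \<sigma>) ds \<Delta> \<Longrightarrow> wff \<Delta> \<phi> \<Longrightarrow> st \<or> internal \<phi> \<Longrightarrow>
    sat Dom app (\<lambda>c. cl (Cn c)) stn (\<lambda>v. cl (s v)) (map cl ds) \<phi> \<longleftrightarrow> msub s 0 ds \<phi> \<in> H"
proof (induction \<phi> arbitrary: ds \<Delta>)
  case (Eq \<sigma> t u)
  then have "tmsub s 0 ds t ofty \<sigma>" "tmsub s 0 ds u ofty \<sigma>"
    using tty_tmsub[OF s Eq.prems(1), of "[]"] by simp_all
  then show ?case using Eq.prems eval_cl[OF s Eq.prems(1)] by (simp add: cl_eq)
next
  case (St \<sigma> t)
  let ?t = "tmsub s 0 ds t"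
  have t: "?t ofty \<sigma>" using St.prems tty_tmsub[OF s St.prems(1), of "[]"] by simp
  \<comment> \<open>Membership in \<open>stn\<close> provides only some standard term of the same
    class; the axiom \<open>st_eq\<close> carries standardness over to \<open>?t\<close>.\<close>
  have "St \<sigma> ?t \<in> H" if u: "u ofty \<sigma>" "St \<sigma> u \<in> H" "cl ?t = cl u" for u
  proof -
    have L: "(St \<sigma> u \<^bold>\<and> Eq \<sigma> u ?t \<^bold>\<longrightarrow> St \<sigma> ?t) \<in> lang st"
      using St.prems u t by (simp add: lang_def)
    then have "(St \<sigma> u \<^bold>\<and> Eq \<sigma> u ?t \<^bold>\<longrightarrow> St \<sigma> ?t) \<in> H"
      using T_st_T T_st.st_eq[OF u(1) t] St.prems by (intro H_ax) auto
    moreover have "Eq \<sigma> u ?t \<in> H" using cl_eq u t by metis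
    ultimately show ?thesis
      using u L by (simp add: H_Imp H_Con)
  qed
  then have "cl ?t \<in> stn \<sigma> \<longleftrightarrow> St \<sigma> ?t \<in> H" using t by (auto simp: stn_def)
  then show ?case using St.prems eval_cl[OF s St.prems(1)] by simp
next
  case (All \<sigma> \<phi>)
  have L: "All \<sigma> (msub s (Suc 0) ds \<phi>) \<in> lang st"
    using wff_msub0[OF s All.prems(1,2)] All.prems(3) by (auto simp: lang_def)
  have "tlc 0 (s v)" for v using s[of v] tlc_tty by force
  moreover have "tlc 0 d" if "d \<in> set ds" for d
    using All.prems(1) that tlc_tty[of "[]" d] by (auto simp: list_all2_conv_all_nth in_set_conv_nth)
  ultimately have i: "inst 0 u (msub s (Suc 0) ds \<phi>) = msub s 0 (u # ds) \<phi>" for u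
    by (rule inst_msub)
  have "sat Dom app (\<lambda>c. cl (Cn c)) stn (\<lambda>v. cl (s v)) (map cl (u # ds)) \<phi> \<longleftrightarrow>
      msub s 0 (u # ds) \<phi> \<in> H" if "u ofty \<sigma>" for u
    using All.IH[of "u # ds" "\<sigma> # \<Delta>"] All.prems that by simp
  then show ?case using L by (simp add: ball_Dom H_All i)
next
  case (Ex \<sigma> \<phi>)
  have L: "Ex \<sigma> (msub s (Suc 0) ds \<phi>) \<in> lang st"
    using wff_msub0[OF s Ex.prems(1,2)] Ex.prems(3) by (auto simp: lang_def)
  have "tlc 0 (s v)" for v using s[of v] tlc_tty by force
  moreover have "tlc 0 d" if "d \<in> set ds" for d
    using Ex.prems(1) that tlc_tty[of "[]" d] by (auto simp: list_all2_conv_all_nth in_set_conv_nth)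
  ultimately have i: "inst 0 u (msub s (Suc 0) ds \<phi>) = msub s 0 (u # ds) \<phi>" for u
    by (rule inst_msub)
  have "sat Dom app (\<lambda>c. cl (Cn c)) stn (\<lambda>v. cl (s v)) (map cl (u # ds)) \<phi> \<longleftrightarrow>
      msub s 0 (u # ds) \<phi> \<in> H" if "u ofty \<sigma>" for u
    using Ex.IH[of "u # ds" "\<sigma> # \<Delta>"] Ex.prems that by simp
  then show ?case using L by (auto simp: bex_Dom H_Ex i)
next
  case (Imp \<phi> \<psi>)
  then have "(msub s 0 ds \<phi> \<^bold>\<longrightarrow> msub s 0 ds \<psi>) \<in> lang st"
    using wff_msub0[OF s Imp.prems(1,2)] by (auto simp: lang_def)
  then show ?case using Imp by (auto simp: H_Imp)
next
  case (Con \<phi> \<psi>)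
  then have "(msub s 0 ds \<phi> \<^bold>\<and> msub s 0 ds \<psi>) \<in> lang st"
    using wff_msub0[OF s Con.prems(1,2)] by (auto simp: lang_def)
  then show ?case using Con by (auto simp: H_Con)
next
  case (Dis \<phi> \<psi>)
  then have "(msub s 0 ds \<phi> \<^bold>\<or> msub s 0 ds \<psi>) \<in> lang st"
    using wff_msub0[OF s Dis.prems(1,2)] by (auto simp: lang_def)
  then show ?case using Dis by (auto simp: H_Dis)
qed (simp add: H_Fls)

lemma sat_iff_H0:
  assumes "\<phi> \<in> lang st"
  shows "sat Dom app (\<lambda>c. cl (Cn c)) stn (\<lambda>v. cl (FV v)) [] \<phi> \<longleftrightarrow> \<phi> \<in> H"
  using sat_iff_H[of FV "[]" "[]" \<phi>] assms by (simp add: msub_id lang_def)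

end

section \<open>Universal closures and the completeness theorem\<close>

lemma sat_cong:
  "(\<And>v. v \<in> ffv \<phi> \<Longrightarrow> e v = e' v) \<Longrightarrow> sat D ap cn S e ds \<phi> = sat D ap cn S e' ds \<phi>"
proof (induction \<phi> arbitrary: ds)
  case (Eq \<sigma> s t)
  then show ?case using eval_cong[of s e e'] eval_cong[of t e e'] by auto
next
  case (St \<sigma> t)
  then show ?case using eval_cong[of t e e'] by auto
qed auto

text \<open>The truth lemma yields an axiom in the canonical environment only. Its universal closure
  lies in the Henkin set too, and thereby all typed environments are covered.\<close>

lemma sat_closure:
  "sat D ap cn S e [] (foldr AllV vs \<phi>) \<Longrightarrow> lc 0 \<phi> \<Longrightarrow> typed_env D e' \<Longrightarrow>
    (\<And>v. v \<in> ffv \<phi> - set vs \<Longrightarrow> e v = e' v) \<Longrightarrow> sat D ap cn S e' [] \<phi>"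
proof (induction vs arbitrary: e)
  case Nil
  then show ?case using sat_cong[of \<phi> e e'] by simp
next
  case (Cons v vs)
  have "lc 0 (foldr AllV vs \<phi>)" using Cons.prems(2) by (induction vs) auto
  then have "sat D ap cn S (e(v := e' v)) [] (foldr AllV vs \<phi>)"
    using Cons.prems(1,3) by (simp add: typed_env_def del: split_paired_All)
  then show ?case using Cons.prems by (elim Cons.IH) auto
qed

lemma prov_closure:
  "prov (lang st) T {} \<phi> \<Longrightarrow> \<phi> \<in> lang st \<Longrightarrow>
    prov (lang st) T {} (foldr AllV vs \<phi>) \<and> foldr AllV vs \<phi> \<in> lang st"
proof (induction vs)
  case (Cons v vs)
  then have *: "prov (lang st) T {} (foldr AllV vs \<phi>)" "foldr AllV vs \<phi> \<in> lang st" by auto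
  then have "prov (lang st) T {} (AllV v (foldr AllV vs \<phi>))"
    unfolding AllV_def
    by (intro prov.AllI) (auto simp: inst_close lang_lc ffv_close)
  then show ?case using *(2) by (auto simp: lang_def)
qed simp

definition typed_structure :: "(ty \<Rightarrow> 'v set) \<Rightarrow> ('v \<Rightarrow> 'v \<Rightarrow> 'v) \<Rightarrow> (cst \<Rightarrow> 'v) \<Rightarrow> bool" where
  "typed_structure D ap cn \<longleftrightarrow>
    (\<forall>\<sigma> \<tau>. \<forall>f \<in> D (\<sigma> \<rightarrow> \<tau>). \<forall>x \<in> D \<sigma>. ap f x \<in> D \<tau>) \<and> (\<forall>c. cn c \<in> D (cty c)) \<and> (\<forall>\<sigma>. D \<sigma> \<noteq> {})"

text \<open>The carrier type \<open>tm set\<close> is the same for all theories and formulas, which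
  permits a global choice of a model later on.\<close>

theorem completeness:
  assumes "EPRA \<subseteq> T" "st \<Longrightarrow> T_st \<subseteq> T" "\<phi> \<in> lang st" "\<not> prov (lang st) T {} \<phi>"
  shows "\<exists>(D :: ty \<Rightarrow> tm set set) ap cn S e. typed_structure D ap cn \<and>
    (\<forall>\<psi> \<in> T \<inter> lang st. \<forall>e. typed_env D e \<longrightarrow> sat D ap cn S e [] \<psi>) \<and>
    typed_env D e \<and> \<not> sat D ap cn S e [] \<phi>"
proof -
  have "consistent st T {\<^bold>\<not> \<phi>}"
  proof (rule ccontr)
    let ?N = "\<^bold>\<not> (\<^bold>\<not> \<phi>)"
    assume "\<not> ?thesis"
    then have "derives st T {} ?N"
      using derives_ded assms(3) by (simp add: consistent_def)
    then have "prov (lang st) T {} ?N" by (simp add: derives_def)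
    moreover have "prov (lang st) T {\<^bold>\<not> \<phi>, ?N} Fls"
      using assms(3) by (intro prov_MP[of "\<^bold>\<not> \<phi>"]) auto
    then have "prov (lang st) T {} (?N \<^bold>\<longrightarrow> \<phi>)"
      using assms(3) by (intro prov.ImpI[OF prov.Classical]) auto
    ultimately show False using assms(4) prov.ImpE by blast
  qed
  then interpret term_model st T "{\<^bold>\<not> \<phi>}"
    by unfold_locales (use assms in auto)
  let ?sat = "sat Dom app (\<lambda>c. cl (Cn c)) stn"
  have "typed_structure Dom app (\<lambda>c. cl (Cn c))"
    unfolding typed_structure_def
  proof (intro conjI allI ballI)
    fix \<sigma> \<tau> f x assume "f \<in> Dom (\<sigma> \<rightarrow> \<tau>)" "x \<in> Dom \<sigma>"
    then obtain s t where "s ofty \<sigma> \<rightarrow> \<tau>" "t ofty \<sigma>" "f = cl s" "x = cl t"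
      by (auto simp: Dom_def)
    then show "app f x \<in> Dom \<tau>"
      unfolding Dom_def by (intro image_eqI[of _ _ "s \<cdot> t"]) (auto simp: app_cl)
  next
    fix c show "cl (Cn c) \<in> Dom (cty c)" by (auto simp: Dom_def)
  next
    fix \<sigma> have "FV (s, \<sigma>) ofty \<sigma>" for s by simp
    then show "Dom \<sigma> \<noteq> {}" unfolding Dom_def by blast
  qed
  moreover have "?sat e [] \<psi>" if "\<psi> \<in> T \<inter> lang st" "typed_env Dom e" for \<psi> e
  proof -
    obtain vs where vs: "set vs = ffv \<psi>" using finite_list[OF finite_ffv[of \<psi>]] by auto
    have "prov (lang st) T {} \<psi>" using that by (intro prov.Ax) auto
    then have "foldr AllV vs \<psi> \<in> H" "foldr AllV vs \<psi> \<in> lang st"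
      using prov_closure[of st T \<psi> vs] that H_prov by auto
    then have "?sat (\<lambda>v. cl (FV v)) [] (foldr AllV vs \<psi>)" using sat_iff_H0 by blast
    then show ?thesis by (rule sat_closure) (use that lang_lc vs in auto)
  qed
  moreover have "typed_env Dom (\<lambda>v. cl (FV v))" by (auto simp: typed_env_def Dom_def)
  moreover have "\<phi> \<notin> H" using \<Gamma>_H H_Neg assms(3) by auto
  then have "\<not> ?sat (\<lambda>v. cl (FV v)) [] \<phi>" using sat_iff_H0 assms(3) by blast
  ultimately show ?thesis by blast
qed

section \<open>Models of primitive recursive arithmetic\<close>

declare split_paired_All [simp del] split_paired_Ex [simp del]

section \<open>Bracket abstraction and closed terms\<close>

lemma lam_props:
  "tty [] t \<noteq> None \<Longrightarrow>
    lam v t ofty snd v \<rightarrow> the (tty [] t) \<and> tfv (lam v t) = tfv t - {v}"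
proof (induction t)
  case (App s t)
  then obtain \<sigma> \<tau> where s: "s ofty \<sigma> \<rightarrow> \<tau>" and t: "t ofty \<sigma>" by auto
  then have st: "s \<cdot> t ofty \<tau>" by simp
  have "lam v s ofty snd v \<rightarrow> \<sigma> \<rightarrow> \<tau>" "lam v t ofty snd v \<rightarrow> \<sigma>"
    "tfv (lam v s) = tfv s - {v}" "tfv (lam v t) = tfv t - {v}"
    using App.IH s t by simp_all
  then show ?case using s st by (simp add: Let_def tty.simps(4) Un_Diff)
qed (auto simp: comb_I_def)

declare lam.simps [simp del]

lemma tty_lam: "tty [] t \<noteq> None \<Longrightarrow> tty \<Delta> (lam v t) = Some (snd v \<rightarrow> the (tty [] t))"
  by (rule tty_weaken) (simp add: lam_props)

lemma tfv_lam: "tty [] t \<noteq> None \<Longrightarrow> tfv (lam v t) = tfv t - {v}"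
  by (simp add: lam_props)

lemma tlc_lam: "tty [] t \<noteq> None \<Longrightarrow> tlc k (lam v t)"
  using tlc_tty[of "[]" "lam v t"] tlc_mono0[of "lam v t"] by (simp add: lam_props)

lemmas tty_compute = tty_lam tty.simps(4)

text \<open>For this and the following closed terms, the type is stated for every
  \<open>\<Delta>\<close>: they occur under binders, and their definitions need not be unfolded
  there again.\<close>

lemma Add_closed [simp]: "tty \<Delta> Add = Some (N \<rightarrow> N \<rightarrow> N)" "tfv Add = {}"
  by (simp_all add: Add_def tty_compute tfv_lam insert_Diff_if)

lemma Mult_closed [simp]: "tty \<Delta> Mult = Some (N \<rightarrow> N \<rightarrow> N)" "tfv Mult = {}"
  by (simp_all add: Mult_def tty_compute tfv_lam insert_Diff_if)

lemma Pred_closed [simp]: "tty \<Delta> Pred = Some (N \<rightarrow> N)" "tfv Pred = {}"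
  by (simp_all add: Pred_def tty_compute tfv_lam insert_Diff_if)

lemma Monus_closed [simp]: "tty \<Delta> Monus = Some (N \<rightarrow> N \<rightarrow> N)" "tfv Monus = {}"
  by (simp_all add: Monus_def tty_compute tfv_lam insert_Diff_if)

lemma Pow2_closed [simp]: "tty \<Delta> Pow2 = Some (N \<rightarrow> N)" "tfv Pow2 = {}"
  by (simp_all add: Pow2_def tty_compute tfv_lam insert_Diff_if)

lemma Tri_closed [simp]: "tty \<Delta> Tri = Some (N \<rightarrow> N)" "tfv Tri = {}"
  by (simp_all add: Tri_def tty_compute tfv_lam insert_Diff_if)

lemma Pair_closed [simp]: "tty \<Delta> Pair = Some (N \<rightarrow> N \<rightarrow> N)" "tfv Pair = {}"
  by (simp_all add: Pair_def tty_compute tfv_lam insert_Diff_if)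

lemma Diag_closed [simp]: "tty \<Delta> Diag = Some (N \<rightarrow> N)" "tfv Diag = {}"
  by (simp_all add: Diag_def tty_compute tfv_lam insert_Diff_if)

lemma Snd_closed [simp]: "tty \<Delta> Snd = Some (N \<rightarrow> N)" "tfv Snd = {}"
  by (simp_all add: Snd_def tty_compute tfv_lam insert_Diff_if)

lemma Fst_closed [simp]: "tty \<Delta> Fst = Some (N \<rightarrow> N)" "tfv Fst = {}"
  by (simp_all add: Fst_def tty_compute tfv_lam insert_Diff_if)

lemma Len_closed [simp]: "tty \<Delta> (Len \<sigma>) = Some (Seq \<sigma> \<rightarrow> N)" "tfv (Len \<sigma>) = {}"
  by (simp_all add: Len_def tty_compute tfv_lam insert_Diff_if)

lemma QSub_closed [simp]: "tty \<Delta> QSub = Some (N \<rightarrow> N \<rightarrow> N)" "tfv QSub = {}"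
  by (simp_all add: QSub_def QPos_def QNeg_def QDen_def MkQ_def tty_compute tfv_lam insert_Diff_if)

lemma QAbs_closed [simp]: "tty \<Delta> QAbs = Some (N \<rightarrow> N)" "tfv QAbs = {}"
  by (simp_all add: QAbs_def QPos_def QNeg_def QDen_def MkQ_def tty_compute tfv_lam insert_Diff_if)

lemma Const_closed [simp]: "tty \<Delta> Const = Some (N \<rightarrow> N1)" "tfv Const = {}"
  by (simp_all add: Const_def tty_compute tfv_lam insert_Diff_if)

lemma RSub_closed [simp]: "tty \<Delta> RSub = Some (N1 \<rightarrow> N1 \<rightarrow> N1)" "tfv RSub = {}"
  by (simp_all add: RSub_def tty_compute tfv_lam insert_Diff_if)

lemma RAbs_closed [simp]: "tty \<Delta> RAbs = Some (N1 \<rightarrow> N1)" "tfv RAbs = {}"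
  by (simp_all add: RAbs_def tty_compute tfv_lam insert_Diff_if)

lemma tlc_typed: "tty [] t \<noteq> None \<Longrightarrow> tlc k t"
  using tlc_tty[of "[]" t] tlc_mono0[of t] by auto

lemma tlc_arith [simp]:
  "tlc k Add" "tlc k Mult" "tlc k Pred" "tlc k Monus" "tlc k Pow2" "tlc k Tri"
  "tlc k Pair" "tlc k Diag" "tlc k Snd" "tlc k Fst" "tlc k (Len \<sigma>)"
  "tlc k QSub" "tlc k QAbs" "tlc k Const" "tlc k RSub" "tlc k RAbs"
  by (simp_all add: tlc_typed)

lemma tty_tsub: "u ofty snd v \<Longrightarrow> tty \<Delta> (tsub v u t) = tty \<Delta> t"
  by (induction t) (auto simp: tty.simps(4) tty_weaken[of u "snd v"])

lemma wff_sub: "u ofty snd v \<Longrightarrow> wff \<Delta> (sub v u \<phi>) = wff \<Delta> \<phi>"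
  by (induction \<phi> arbitrary: \<Delta>) (auto simp: tty_tsub)

lemma internal_sub [simp]: "internal (sub v u \<phi>) = internal \<phi>"
  by (induction \<phi>) auto

lemma qf_internal: "qf \<phi> \<Longrightarrow> internal \<phi>"
  by (induction \<phi>) auto

text \<open>Only instances in the internal language are required, so models for either of the two
  languages qualify.\<close>

locale epra_model =
  fixes D :: "ty \<Rightarrow> 'v set" and ap :: "'v \<Rightarrow> 'v \<Rightarrow> 'v" (infixl "\<bullet>" 100)
    and cn :: "cst \<Rightarrow> 'v" and S :: "ty \<Rightarrow> 'v set"
  assumes struct: "typed_structure D ap cn"
    and EPRA_sat: "\<lbrakk>\<psi> \<in> EPRA; \<psi> \<in> lang False; typed_env D e\<rbrakk> \<Longrightarrow> sat D ap cn S e [] \<psi>"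
begin

lemma app_D: "f \<in> D (\<sigma> \<rightarrow> \<tau>) \<Longrightarrow> x \<in> D \<sigma> \<Longrightarrow> f \<bullet> x \<in> D \<tau>"
  using struct unfolding typed_structure_def by blast

lemma cn_D: "cn c \<in> D (cty c)"
  using struct by (simp add: typed_structure_def)

abbreviation ev :: "(var \<Rightarrow> 'v) \<Rightarrow> 'v list \<Rightarrow> tm \<Rightarrow> 'v" where "ev \<equiv> eval ap cn"

definition env0 :: "var \<Rightarrow> 'v" where "env0 v = (SOME d. d \<in> D (snd v))"

lemma typed_env0 [simp]: "typed_env D env0"
  using struct some_in_eq unfolding typed_structure_def typed_env_def env0_def by blast

lemma eval_D:
  assumes "typed_env D e" "list_all2 (\<lambda>d \<sigma>. d \<in> D \<sigma>) ds \<Delta>"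
  shows "tty \<Delta> t = Some \<sigma> \<Longrightarrow> ev e ds t \<in> D \<sigma>"
proof (induction t arbitrary: \<sigma>)
  case (FV v)
  then show ?case using assms(1) by (auto simp: typed_env_def)
next
  case (BV i)
  then show ?case using assms(2) by (auto simp: list_all2_conv_all_nth split: if_splits)
next
  case (Cn c)
  then show ?case using cn_D[of c] by simp
next
  case (App s t)
  then show ?case by (auto intro: app_D)
qed

lemma eval_D0: "typed_env D e \<Longrightarrow> t ofty \<sigma> \<Longrightarrow> ev e [] t \<in> D \<sigma>"
  by (rule eval_D) auto

definition val :: "tm \<Rightarrow> 'v" where "val t = ev env0 [] t"

lemma eval_closed: "tfv t = {} \<Longrightarrow> tlc 0 t \<Longrightarrow> ev e ds t = val t"
  using eval_lc0[of t ap cn e ds] eval_cong[of t e env0 ap cn "[]"] by (simp add: val_def)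

lemma eval_arith:
  "ev e ds Add = val Add" "ev e ds Mult = val Mult" "ev e ds Pred = val Pred"
  "ev e ds Monus = val Monus" "ev e ds Pow2 = val Pow2" "ev e ds Tri = val Tri"
  "ev e ds Pair = val Pair" "ev e ds Diag = val Diag" "ev e ds Snd = val Snd"
  "ev e ds Fst = val Fst" "ev e ds (Len \<sigma>) = val (Len \<sigma>)" "ev e ds QSub = val QSub"
  "ev e ds QAbs = val QAbs" "ev e ds Const = val Const" "ev e ds RSub = val RSub"
  "ev e ds RAbs = val RAbs"
  by (simp_all add: eval_closed)

lemma val_D [simp]:
  "val Add \<in> D (N \<rightarrow> N \<rightarrow> N)" "val Mult \<in> D (N \<rightarrow> N \<rightarrow> N)" "val Pred \<in> D (N \<rightarrow> N)"
  "val Monus \<in> D (N \<rightarrow> N \<rightarrow> N)" "val Pow2 \<in> D (N \<rightarrow> N)" "val Tri \<in> D (N \<rightarrow> N)"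
  "val Pair \<in> D (N \<rightarrow> N \<rightarrow> N)" "val Diag \<in> D (N \<rightarrow> N)" "val Snd \<in> D (N \<rightarrow> N)"
  "val Fst \<in> D (N \<rightarrow> N)" "val (Len \<sigma>) \<in> D (Seq \<sigma> \<rightarrow> N)" "val QSub \<in> D (N \<rightarrow> N \<rightarrow> N)"
  "val QAbs \<in> D (N \<rightarrow> N)" "val Const \<in> D (N \<rightarrow> N1)" "val RSub \<in> D (N1 \<rightarrow> N1 \<rightarrow> N1)"
  "val RAbs \<in> D (N1 \<rightarrow> N1)"
  by (simp_all add: val_def eval_D0)

lemma cn_D' [simp]:
  "cn CZero \<in> D N" "cn CSucc \<in> D (N \<rightarrow> N)" "cn CRec \<in> D (N \<rightarrow> N \<rightarrow> (N \<rightarrow> N \<rightarrow> N) \<rightarrow> N)"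
  "cn (CPi \<sigma> \<tau>) \<in> D (\<sigma> \<rightarrow> \<tau> \<rightarrow> \<sigma>)"
  "cn (CSigma \<delta> \<sigma> \<tau>) \<in> D ((\<delta> \<rightarrow> \<sigma> \<rightarrow> \<tau>) \<rightarrow> (\<delta> \<rightarrow> \<sigma>) \<rightarrow> \<delta> \<rightarrow> \<tau>)"
  "cn (CNth \<sigma>) \<in> D (Seq \<sigma> \<rightarrow> N \<rightarrow> \<sigma>)"
  using cn_D[of CZero] cn_D[of CSucc] cn_D[of CRec] cn_D[of "CPi \<sigma> \<tau>"] cn_D[of "CSigma \<delta> \<sigma> \<tau>"]
    cn_D[of "CNth \<sigma>"]
  by simp_all

lemma app_D1 [simp]: "f \<in> D (N \<rightarrow> N) \<Longrightarrow> x \<in> D N \<Longrightarrow> f \<bullet> x \<in> D N"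
  and app_D2 [simp]: "g \<in> D (N \<rightarrow> N \<rightarrow> N) \<Longrightarrow> x \<in> D N \<Longrightarrow> y \<in> D N \<Longrightarrow> g \<bullet> x \<bullet> y \<in> D N"
  by (blast intro: app_D)+

abbreviation zr :: 'v where "zr \<equiv> cn CZero"
abbreviation sc :: "'v \<Rightarrow> 'v" where "sc x \<equiv> cn CSucc \<bullet> x"

text \<open>The axiom scheme is instantiated at variables, and the environment then lets these range
  over all objects of their types. The equations below are obtained in the same way.\<close>

lemma pi_eq:
  assumes "x \<in> D \<sigma>" "y \<in> D \<tau>"
  shows "cn (CPi \<sigma> \<tau>) \<bullet> x \<bullet> y = x"
  using EPRA_sat[OF EPRA.pi[of "FV (''x'', \<sigma>)" \<sigma> "FV (''y'', \<tau>)" \<tau>],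
      of "env0((''x'', \<sigma>) := x, (''y'', \<tau>) := y)"] assms
  by (simp add: lang_def)

lemma sigma_eq:
  assumes "x \<in> D (\<delta> \<rightarrow> \<sigma> \<rightarrow> \<tau>)" "y \<in> D (\<delta> \<rightarrow> \<sigma>)" "z \<in> D \<delta>"
  shows "cn (CSigma \<delta> \<sigma> \<tau>) \<bullet> x \<bullet> y \<bullet> z = x \<bullet> z \<bullet> (y \<bullet> z)"
  using EPRA_sat[OF EPRA.sigma[of "FV (''x'', \<delta> \<rightarrow> \<sigma> \<rightarrow> \<tau>)" \<delta> \<sigma> \<tau> "FV (''y'', \<delta> \<rightarrow> \<sigma>)" "FV (''z'', \<delta>)"],
      of "env0((''x'', \<delta> \<rightarrow> \<sigma> \<rightarrow> \<tau>) := x, (''y'', \<delta> \<rightarrow> \<sigma>) := y, (''z'', \<delta>) := z)"] assms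
  by (simp add: lang_def)

lemma rec_zero_eq:
  assumes "y \<in> D N" "z \<in> D (N \<rightarrow> N \<rightarrow> N)"
  shows "cn CRec \<bullet> zr \<bullet> y \<bullet> z = y"
  using EPRA_sat[OF EPRA.rec_zero[of "FV (''y'', N)" "FV (''z'', N \<rightarrow> N \<rightarrow> N)"],
      of "env0((''y'', N) := y, (''z'', N \<rightarrow> N \<rightarrow> N) := z)"] assms
  by (simp add: lang_def)

lemma rec_succ_eq:
  assumes "x \<in> D N" "y \<in> D N" "z \<in> D (N \<rightarrow> N \<rightarrow> N)"
  shows "cn CRec \<bullet> sc x \<bullet> y \<bullet> z = z \<bullet> (cn CRec \<bullet> x \<bullet> y \<bullet> z) \<bullet> x"
  using EPRA_sat[OF EPRA.rec_succ[of "FV (''x'', N)" "FV (''y'', N)" "FV (''z'', N \<rightarrow> N \<rightarrow> N)"],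
      of "env0((''x'', N) := x, (''y'', N) := y, (''z'', N \<rightarrow> N \<rightarrow> N) := z)"] assms
  by (simp add: lang_def)

lemma rec_D [simp]:
  "x \<in> D N \<Longrightarrow> y \<in> D N \<Longrightarrow> z \<in> D (N \<rightarrow> N \<rightarrow> N) \<Longrightarrow> cn CRec \<bullet> x \<bullet> y \<bullet> z \<in> D N"
  by (rule app_D[of _ "N \<rightarrow> N \<rightarrow> N"], rule app_D[of _ N], rule app_D[of _ N]) simp_all

lemma sc_nonzero [simp]: "x \<in> D N \<Longrightarrow> sc x \<noteq> zr" "x \<in> D N \<Longrightarrow> zr \<noteq> sc x"
  using EPRA_sat[OF EPRA.succ_nonzero[of "FV (''x'', N)"], of "env0((''x'', N) := x)"]
  by (auto simp add: lang_def)

lemma sc_inj [simp]: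
  assumes "x \<in> D N" "y \<in> D N"
  shows "sc x = sc y \<longleftrightarrow> x = y"
  using EPRA_sat[OF EPRA.succ_inj[of "FV (''x'', N)" "FV (''y'', N)"],
      of "env0((''x'', N) := x, (''y'', N) := y)"] assms
  by (auto simp add: lang_def)

text \<open>Beta reduction. The equations of the combinators are available for objects of the right
  types, hence the assumptions on \<open>e\<close> and \<open>d\<close>.\<close>

lemma eval_lam:
  assumes "typed_env D e" "d \<in> D (snd v)" "tty [] t \<noteq> None"
  shows "ev e ds (lam v t) \<bullet> d = ev (e(v := d)) [] t"
proof -
  define e' where "e' = e(v := d)"
  have "ev e [] (lam v t) \<bullet> d = ev e' [] t" using assms(3)
  proof (induction t)
    case (FV w)
    then show ?case
      using assms(1,2) sigma_eq[of "cn (CPi (snd v) (snd v \<rightarrow> snd v))" "snd v" "snd v \<rightarrow> snd v" "snd v"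
          "cn (CPi (snd v) (snd v))" d]
      by (auto simp: lam.simps comb_I_def e'_def pi_eq app_D[of _ "snd v"] typed_env_def)
  next
    case (Cn c)
    then show ?case using assms cn_D[of c] by (simp add: lam.simps pi_eq)
  next
    case (App s t)
    then obtain \<sigma> \<tau> where s: "s ofty \<sigma> \<rightarrow> \<tau>" and t: "t ofty \<sigma>" by auto
    then have st: "s \<cdot> t ofty \<tau>" by simp
    show ?case
    proof (cases "v \<in> tfv s \<union> tfv t")
      case True
      have "ev e [] (lam v s) \<in> D (snd v \<rightarrow> \<sigma> \<rightarrow> \<tau>)" "ev e [] (lam v t) \<in> D (snd v \<rightarrow> \<sigma>)"
        using s t assms(1) by (auto intro!: eval_D0 simp: tty_lam)
      then show ?thesis using True App.IH s t assms(2) by (auto simp: lam.simps Let_def sigma_eq)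
    next
      case False
      have "ev e [] (s \<cdot> t) \<in> D \<tau>" using eval_D0[OF assms(1) st] .
      moreover have "ev e' [] (s \<cdot> t) = ev e [] (s \<cdot> t)"
        by (rule eval_cong) (use False in \<open>auto simp: e'_def\<close>)
      ultimately show ?thesis using False s assms(2) pi_eq by (simp add: lam.simps Let_def)
    qed
  qed (simp add: lam.simps)
  then show ?thesis using eval_lc0 tlc_lam[OF assms(3)] unfolding e'_def by metis
qed

lemma eval_lam_D:
  assumes "typed_env D e" "tty [] t = Some \<tau>" "\<sigma> = snd v"
  shows "ev e ds (lam v t) \<in> D (\<sigma> \<rightarrow> \<tau>)"
proof -
  have "ev e [] (lam v t) \<in> D (\<sigma> \<rightarrow> \<tau>)" using assms by (intro eval_D0) (auto simp: tty_lam)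
  then show ?thesis using assms by (subst eval_lc0) (auto simp: tlc_lam)
qed

abbreviation add :: "'v \<Rightarrow> 'v \<Rightarrow> 'v" (infixl "\<oplus>" 65) where "a \<oplus> b \<equiv> val Add \<bullet> a \<bullet> b"
abbreviation mult :: "'v \<Rightarrow> 'v \<Rightarrow> 'v" (infixl "\<otimes>" 70) where "a \<otimes> b \<equiv> val Mult \<bullet> a \<bullet> b"
abbreviation monus :: "'v \<Rightarrow> 'v \<Rightarrow> 'v" (infixl "\<ominus>" 65) where "a \<ominus> b \<equiv> val Monus \<bullet> a \<bullet> b"

lemma val_lam: "d \<in> D (snd v) \<Longrightarrow> tty [] t \<noteq> None \<Longrightarrow> val (lam v t) \<bullet> d = ev (env0(v := d)) [] t"
  by (simp add: val_def eval_lam)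

lemma eval_lam_upd:
  "v \<notin> tfv (lam w t) \<Longrightarrow> ev (e(v := d)) ds (lam w t) = ev e ds (lam w t)"
  by (rule eval_cong) auto

lemmas beta = val_lam eval_lam eval_lam_D eval_lam_upd tfv_lam tty_compute eval_arith rec_zero_eq rec_succ_eq

section \<open>Recursion equations of the arithmetic terms\<close>

lemma add_rec [simp]:
  assumes "a \<in> D N"
  shows "a \<oplus> zr = a" "b \<in> D N \<Longrightarrow> a \<oplus> sc b = sc (a \<oplus> b)"
  unfolding Add_def using assms by (simp_all add: beta)

lemma mult_rec [simp]:
  assumes "a \<in> D N"
  shows "a \<otimes> zr = zr" "b \<in> D N \<Longrightarrow> a \<otimes> sc b = a \<otimes> b \<oplus> a"
  unfolding Mult_def using assms by (simp_all add: beta)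

lemma pred_rec [simp]: "val Pred \<bullet> zr = zr" "a \<in> D N \<Longrightarrow> val Pred \<bullet> sc a = a"
  unfolding Pred_def by (simp_all add: beta)

lemma monus_rec [simp]:
  assumes "a \<in> D N"
  shows "a \<ominus> zr = a" "b \<in> D N \<Longrightarrow> a \<ominus> sc b = val Pred \<bullet> (a \<ominus> b)"
  unfolding Monus_def using assms by (simp_all add: beta)

lemma pow2_rec [simp]:
  "val Pow2 \<bullet> zr = sc zr" "a \<in> D N \<Longrightarrow> val Pow2 \<bullet> sc a = val Pow2 \<bullet> a \<oplus> val Pow2 \<bullet> a"
  unfolding Pow2_def by (simp_all add: beta)

lemma tri_rec [simp]:
  "val Tri \<bullet> zr = zr" "a \<in> D N \<Longrightarrow> val Tri \<bullet> sc a = val Tri \<bullet> a \<oplus> sc a"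
  unfolding Tri_def by (simp_all add: beta)

lemma pair_eq: "a \<in> D N \<Longrightarrow> b \<in> D N \<Longrightarrow> val Pair \<bullet> a \<bullet> b = val Tri \<bullet> (a \<oplus> b) \<oplus> b"
  unfolding Pair_def by (simp add: beta)

text \<open>With \<open>r\<close> for the value at \<open>a\<close>, the increment is the truth
  value of \<open>Tri (r + 1) \<le> a + 1\<close>: truncated \<open>1 - c\<close> is
  \<open>1\<close> for \<open>c = 0\<close> and \<open>0\<close> otherwise.\<close>

lemma diag_rec [simp]:
  "val Diag \<bullet> zr = zr"
  "a \<in> D N \<Longrightarrow> val Diag \<bullet> sc a =
    val Diag \<bullet> a \<oplus> (sc zr \<ominus> (val Tri \<bullet> sc (val Diag \<bullet> a) \<ominus> sc a))"
  unfolding Diag_def by (simp_all add: beta del: tri_rec)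

lemma snd_eq: "a \<in> D N \<Longrightarrow> val Snd \<bullet> a = a \<ominus> val Tri \<bullet> (val Diag \<bullet> a)"
  unfolding Snd_def by (simp add: beta)

lemma fst_eq: "a \<in> D N \<Longrightarrow> val Fst \<bullet> a = val Diag \<bullet> a \<ominus> val Snd \<bullet> a"
  unfolding Fst_def by (simp add: beta)


subsection \<open>Induction for quantifier-free predicates\<close>

text \<open>The functions that may be used in induction predicates: those given by an object of the
  model, which may itself be built from parameters. The combinators give closure under
  application.\<close>

definition rep :: "ty \<Rightarrow> ('v \<Rightarrow> 'v) \<Rightarrow> bool" where
  "rep \<sigma> f \<longleftrightarrow> (\<exists>c \<in> D (N \<rightarrow> \<sigma>). \<forall>d \<in> D N. f d = c \<bullet> d)"

lemma rep_id: "rep N (\<lambda>d. d)"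
  unfolding rep_def
proof (intro bexI ballI)
  show "d = ev env0 [] (lam vi (FV vi)) \<bullet> d" if "d \<in> D N" for d
    using that by (simp add: eval_lam)
  show "ev env0 [] (lam vi (FV vi)) \<in> D (N \<rightarrow> N)" by (rule eval_lam_D) auto
qed

lemma rep_const: "a \<in> D \<sigma> \<Longrightarrow> rep \<sigma> (\<lambda>d. a)"
  unfolding rep_def
  by (intro bexI[of _ "cn (CPi \<sigma> N) \<bullet> a"]) (auto simp: pi_eq intro: app_D[OF cn_D'(4)])

lemma rep_app: "rep (\<sigma> \<rightarrow> \<tau>) f \<Longrightarrow> rep \<sigma> g \<Longrightarrow> rep \<tau> (\<lambda>d. f d \<bullet> g d)"
  unfolding rep_def
proof (elim bexE)
  fix c c' assume c: "c \<in> D (N \<rightarrow> \<sigma> \<rightarrow> \<tau>)" "c' \<in> D (N \<rightarrow> \<sigma>)"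
    and fg: "\<forall>d \<in> D N. f d = c \<bullet> d" "\<forall>d \<in> D N. g d = c' \<bullet> d"
  show "\<exists>c \<in> D (N \<rightarrow> \<tau>). \<forall>d \<in> D N. f d \<bullet> g d = c \<bullet> d"
    by (rule bexI[of _ "cn (CSigma N \<sigma> \<tau>) \<bullet> c \<bullet> c'"])
      (use c fg app_D[OF app_D[OF cn_D'(5) c(1)] c(2)] in \<open>auto simp: sigma_eq\<close>)
qed

lemma rep_op1: "c \<in> D (N \<rightarrow> N) \<Longrightarrow> rep N f \<Longrightarrow> rep N (\<lambda>d. c \<bullet> f d)"
  by (intro rep_app rep_const)

lemmas rep_succ_pred = rep_op1[OF cn_D'(2)] rep_op1[OF val_D(3)]

lemma rep_op2: "c \<in> D (N \<rightarrow> N \<rightarrow> N) \<Longrightarrow> rep N f \<Longrightarrow> rep N g \<Longrightarrow> rep N (\<lambda>d. c \<bullet> f d \<bullet> g d)"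
  by (intro rep_app rep_const)

text \<open>The predicates with induction. The variable \<open>vi\<close> is the induction variable;
  all others are parameters, of any type.\<close>

definition rp :: "('v \<Rightarrow> bool) \<Rightarrow> bool" where
  "rp P \<longleftrightarrow> (\<exists>\<phi> e. typed_env D e \<and> wff [] \<phi> \<and> qf \<phi> \<and> (\<forall>d \<in> D N. P d \<longleftrightarrow> sat D ap cn S (e(vi := d)) [] \<phi>))"

lemma rp_eq: "rep N f \<Longrightarrow> rep N g \<Longrightarrow> rp (\<lambda>d. f d = g d)"
  unfolding rep_def
proof (elim bexE)
  fix c c' assume c: "c \<in> D N1" "c' \<in> D N1"
    and fg: "\<forall>d \<in> D N. f d = c \<bullet> d" "\<forall>d \<in> D N. g d = c' \<bullet> d"
  then show "rp (\<lambda>d. f d = g d)"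
    unfolding rp_def
    by (intro exI[of _ "Eq N (FV (''f'', N1) \<cdot> FV vi) (FV (''g'', N1) \<cdot> FV vi)"]
        exI[of _ "env0((''f'', N1) := c, (''g'', N1) := c')"]) auto
qed

text \<open>Each of the two formulas comes with its own environment. Their variables are renamed
  apart by a first letter, except for the shared \<open>vi\<close>, and the joint environment reads
  this letter to decide where to look.\<close>

lemma rp_merge:
  assumes "rp P" "rp Q"
  obtains e \<phi> \<psi> where "typed_env D e" "wff [] \<phi>" "qf \<phi>" "wff [] \<psi>" "qf \<psi>"
    "\<And>d. d \<in> D N \<Longrightarrow> P d \<longleftrightarrow> sat D ap cn S (e(vi := d)) [] \<phi>"
    "\<And>d. d \<in> D N \<Longrightarrow> Q d \<longleftrightarrow> sat D ap cn S (e(vi := d)) [] \<psi>"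
proof -
  obtain \<phi>1 e1 where 1: "typed_env D e1" "wff [] \<phi>1" "qf \<phi>1"
      "\<And>d. d \<in> D N \<Longrightarrow> P d \<longleftrightarrow> sat D ap cn S (e1(vi := d)) [] \<phi>1"
    using assms(1) unfolding rp_def by blast
  obtain \<phi>2 e2 where 2: "typed_env D e2" "wff [] \<phi>2" "qf \<phi>2"
      "\<And>d. d \<in> D N \<Longrightarrow> Q d \<longleftrightarrow> sat D ap cn S (e2(vi := d)) [] \<phi>2"
    using assms(2) unfolding rp_def by blast
  define s where "s c v = (if v = vi then FV vi else FV (c # fst v, snd v))" for c and v :: var
  have s: "tlc 0 (s c v)" "s c v ofty snd v" for c v by (auto simp: s_def)
  define e where
    "e v = (if fst v \<noteq> [] \<and> hd (fst v) = CHR ''a'' then e1 (tl (fst v), snd v) else e2 (tl (fst v), snd v))"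
    for v :: var
  have "e1 (n, \<sigma>) \<in> D \<sigma>" "e2 (n, \<sigma>) \<in> D \<sigma>" for n \<sigma>
    using 1(1) 2(1) unfolding typed_env_def by (metis snd_conv)+
  then have e: "typed_env D e" by (auto simp: typed_env_def e_def)
  have ev: "(\<lambda>v. ev (e(vi := d)) [] (s CHR ''a'' v)) = e1(vi := d)"
    "(\<lambda>v. ev (e(vi := d)) [] (s CHR ''b'' v)) = e2(vi := d)" for d
    by (auto simp: fun_eq_iff s_def e_def)
  have "sat D ap cn S (e(vi := d)) [] (msub (s CHR ''a'') 0 [] \<phi>1) = sat D ap cn S (e1(vi := d)) [] \<phi>1"
    "sat D ap cn S (e(vi := d)) [] (msub (s CHR ''b'') 0 [] \<phi>2) = sat D ap cn S (e2(vi := d)) [] \<phi>2" for d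
    by (simp_all add: sat_msub[OF s(1)] ev)
  moreover have "wff [] (msub (s CHR ''a'') 0 [] \<phi>1)" "wff [] (msub (s CHR ''b'') 0 [] \<phi>2)"
    using wff_msub0[OF s(2), of "[]" "[]"] 1(2) 2(2) by simp_all
  ultimately show ?thesis
    using that[OF e, of "msub (s CHR ''a'') 0 [] \<phi>1" "msub (s CHR ''b'') 0 [] \<phi>2"] 1 2 by simp
qed

lemma rp_imp:
  assumes "rp P" "rp Q"
  shows "rp (\<lambda>d. P d \<longrightarrow> Q d)"
proof (rule rp_merge[OF assms])
  fix e \<phi> \<psi>
  assume "typed_env D e" "wff [] \<phi>" "qf \<phi>" "wff [] \<psi>" "qf \<psi>"
    "\<And>d. d \<in> D N \<Longrightarrow> P d \<longleftrightarrow> sat D ap cn S (e(vi := d)) [] \<phi>"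
    "\<And>d. d \<in> D N \<Longrightarrow> Q d \<longleftrightarrow> sat D ap cn S (e(vi := d)) [] \<psi>"
  then show ?thesis unfolding rp_def by (intro exI[of _ "\<phi> \<^bold>\<longrightarrow> \<psi>"] exI[of _ e]) simp
qed

lemma rp_False: "rp (\<lambda>d. False)"
  unfolding rp_def by (intro exI[of _ Fls] exI[of _ env0]) simp

lemma rp_not: "rp P \<Longrightarrow> rp (\<lambda>d. \<not> P d)"
  using rp_imp[OF _ rp_False] by simp

lemma rp_or: "rp P \<Longrightarrow> rp Q \<Longrightarrow> rp (\<lambda>d. P d \<or> Q d)"
  using rp_imp[OF rp_not, of P Q] by (simp add: disj_imp)

lemma rp_and: "rp P \<Longrightarrow> rp Q \<Longrightarrow> rp (\<lambda>d. P d \<and> Q d)"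
  using rp_not[OF rp_or[OF rp_not rp_not], of P Q] by simp

lemmas rp_intros = rp_eq rp_imp rp_or rp_and rp_not rep_id rep_op2 rep_succ_pred rep_const

lemma N_induct [consumes 1, case_names rep zero suc]:
  assumes "d \<in> D N" "rp P" "P zr" "\<And>d. d \<in> D N \<Longrightarrow> P d \<Longrightarrow> P (sc d)"
  shows "P d"
proof -
  obtain \<phi> e where *: "typed_env D e" "wff [] \<phi>" "qf \<phi>"
      "\<And>d. d \<in> D N \<Longrightarrow> P d \<longleftrightarrow> sat D ap cn S (e(vi := d)) [] \<phi>"
    using assms(2) unfolding rp_def by blast
  have lc: "lc 0 \<phi>" using lc_wff[OF *(2)] by simp
  have [simp]: "wff [] (sub vi t \<phi>)" "lc 0 (sub vi t \<phi>)" if "t ofty N" for t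
  proof -
    show w: "wff [] (sub vi t \<phi>)" using wff_sub *(2) that by simp
    show "lc 0 (sub vi t \<phi>)" using lc_wff[OF w] by simp
  qed
  have [simp]: "internal (sub vi t \<phi>)" for t using *(3) qf_internal by simp
  let ?\<psi> = "sub vi Zero \<phi> \<^bold>\<and> AllV vi (\<phi> \<^bold>\<longrightarrow> sub vi (Succ (FV vi)) \<phi>) \<^bold>\<longrightarrow> AllV vi \<phi>"
  have "?\<psi> \<in> EPRA" by (rule EPRA.qf_ind) (use * in auto)
  moreover have "?\<psi> \<in> lang False" using *(2,3) by (simp add: lang_def qf_internal)
  ultimately have "sat D ap cn S e [] ?\<psi>" using *(1) by (rule EPRA_sat)
  moreover have "sat D ap cn S e [] ?\<psi> \<longleftrightarrow> (P zr \<and> (\<forall>d \<in> D N. P d \<longrightarrow> P (sc d)) \<longrightarrow> (\<forall>d \<in> D N. P d))"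
    using lc by (simp add: sat_sub *(4))
  ultimately show ?thesis using assms(1,3,4) by blast
qed

end

section \<open>Semiring laws by quantifier-free induction\<close>

context epra_model
begin

lemma add_left [simp]:
  assumes "b \<in> D N"
  shows "zr \<oplus> b = b" "a \<in> D N \<Longrightarrow> sc a \<oplus> b = sc (a \<oplus> b)"
proof -
  show "zr \<oplus> b = b" using assms
    by (induction b rule: N_induct) (auto intro!: rp_intros)
  assume a: "a \<in> D N"
  show "sc a \<oplus> b = sc (a \<oplus> b)" using assms
    by (induction b rule: N_induct) (auto intro!: rp_intros simp: a)
qed

lemma add_comm:
  assumes "a \<in> D N" "b \<in> D N"
  shows "a \<oplus> b = b \<oplus> a"
  using assms(2) by (induction b rule: N_induct) (auto intro!: rp_intros simp: assms(1))

lemma add_assoc: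
  assumes "a \<in> D N" "b \<in> D N" "c \<in> D N"
  shows "a \<oplus> b \<oplus> c = a \<oplus> (b \<oplus> c)"
  using assms(3) by (induction c rule: N_induct) (auto intro!: rp_intros simp: assms(1,2))

lemma add_left_comm:
  "a \<in> D N \<Longrightarrow> b \<in> D N \<Longrightarrow> c \<in> D N \<Longrightarrow> a \<oplus> (b \<oplus> c) = b \<oplus> (a \<oplus> c)"
  using add_assoc[of a b c] add_assoc[of b a c] add_comm[of a b] by simp

lemma mult_left [simp]:
  assumes "b \<in> D N"
  shows "zr \<otimes> b = zr" "a \<in> D N \<Longrightarrow> sc a \<otimes> b = a \<otimes> b \<oplus> b"
proof -
  show "zr \<otimes> b = zr" using assms
    by (induction b rule: N_induct) (auto intro!: rp_intros)
  assume a: "a \<in> D N"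
  show "sc a \<otimes> b = a \<otimes> b \<oplus> b" using assms
    by (induction b rule: N_induct)
      (auto intro!: rp_intros simp: a add_assoc add_comm add_left_comm)
qed

lemma mult_comm:
  assumes "a \<in> D N" "b \<in> D N"
  shows "a \<otimes> b = b \<otimes> a"
  using assms(2) by (induction b rule: N_induct) (auto intro!: rp_intros simp: assms(1))

lemma mult_add:
  assumes "a \<in> D N" "b \<in> D N" "c \<in> D N"
  shows "a \<otimes> (b \<oplus> c) = a \<otimes> b \<oplus> a \<otimes> c"
  using assms(3) by (induction c rule: N_induct) (auto intro!: rp_intros simp: assms(1,2) add_assoc)

lemma mult_assoc:
  assumes "a \<in> D N" "b \<in> D N" "c \<in> D N"
  shows "a \<otimes> b \<otimes> c = a \<otimes> (b \<otimes> c)"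
  using assms(3) by (induction c rule: N_induct) (auto intro!: rp_intros simp: assms(1,2) mult_add)

text \<open>The existence of a predecessor is no induction predicate; an equation with
  \<open>Pred\<close> as the witness is.\<close>

lemma N_cases [consumes 1, case_names zero suc]:
  assumes "a \<in> D N"
  obtains (zero) "a = zr" | (suc) b where "b \<in> D N" "a = sc b"
proof -
  have "a = zr \<or> sc (val Pred \<bullet> a) = a" using assms
    by (induction a rule: N_induct) (auto intro!: rp_intros)
  then show ?thesis using that assms by (metis app_D1 val_D(3))
qed

lemma monus_sc [simp]:
  assumes "a \<in> D N" "b \<in> D N"
  shows "sc a \<ominus> sc b = a \<ominus> b"
  using assms(2) by (induction b rule: N_induct) (auto intro!: rp_intros simp: assms(1))

lemma zr_monus [simp]: "b \<in> D N \<Longrightarrow> zr \<ominus> b = zr"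
  by (induction b rule: N_induct) (auto intro!: rp_intros)

lemma add_monus [simp]:
  assumes "a \<in> D N" "b \<in> D N"
  shows "a \<oplus> b \<ominus> b = a"
  using assms(2) by (induction b rule: N_induct)
    (auto intro!: rp_intros simp: assms(1) simp del: monus_rec(2))

lemma add_monus' [simp]: "a \<in> D N \<Longrightarrow> b \<in> D N \<Longrightarrow> b \<oplus> a \<ominus> b = a"
  using add_monus add_comm by metis

lemma monus_monus:
  assumes "a \<in> D N" "b \<in> D N" "c \<in> D N"
  shows "a \<ominus> b \<ominus> c = a \<ominus> (b \<oplus> c)"
  using assms(3) by (induction c rule: N_induct) (auto intro!: rp_intros simp: assms(1,2))

text \<open>Comparability, with the truncated differences as explicit witnesses so that the claim
  stays quantifier-free.\<close>

lemma N_linear: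
  assumes "a \<in> D N" "b \<in> D N"
  shows "a \<oplus> (b \<ominus> a) = b \<or> b \<ominus> a = zr \<and> a = b \<oplus> (a \<ominus> b)"
  using assms(1)
proof (induction a rule: N_induct)
  case (suc a)
  have ba: "b \<ominus> a \<in> D N" using suc assms by simp
  show ?case
  proof (cases "b \<ominus> a = zr")
    case True
    then have "a = b \<oplus> (a \<ominus> b)" using suc by auto
    moreover define c where "c = a \<ominus> b"
    moreover have "c \<in> D N" using c_def suc assms by simp
    ultimately have "sc a = b \<oplus> sc c" using assms by simp
    moreover have "b \<oplus> sc c \<ominus> b = sc c" using assms \<open>c \<in> D N\<close> by (intro add_monus') auto
    moreover have "b \<ominus> sc a = zr" using True suc(1) assms by simp
    ultimately show ?thesis by (simp only: refl simp_thms)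
  next
    case False
    then obtain c where c: "c \<in> D N" "b \<ominus> a = sc c" using N_cases[OF ba] by metis
    then show ?thesis using suc assms by auto
  qed
qed (use assms in \<open>auto intro!: rp_intros\<close>)

end


section \<open>Discretely ordered semirings\<close>

text \<open>The order is given by truncated subtraction: \<open>a \<le> b\<close> iff \<open>d a b = z\<close>.\<close>

definition discrete_semidom ::
    "'v set \<times> 'v \<times> 'v \<times> ('v \<Rightarrow> 'v \<Rightarrow> 'v) \<times> ('v \<Rightarrow> 'v \<Rightarrow> 'v) \<times> ('v \<Rightarrow> 'v \<Rightarrow> 'v) \<Rightarrow> bool" where
  "discrete_semidom = (\<lambda>(C, z, u, p, m, d).
    z \<in> C \<and> u \<in> C \<and> z \<noteq> u \<and>
    (\<forall>a \<in> C. \<forall>b \<in> C. p a b \<in> C \<and> m a b \<in> C \<and> d a b \<in> C) \<and>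
    (\<forall>a \<in> C. \<forall>b \<in> C. p a b = p b a \<and> m a b = m b a) \<and>
    (\<forall>a \<in> C. p z a = a \<and> m u a = a \<and> m z a = z) \<and>
    (\<forall>a \<in> C. \<forall>b \<in> C. \<forall>c \<in> C. p (p a b) c = p a (p b c) \<and> m (m a b) c = m a (m b c) \<and>
      m (p a b) c = p (m a c) (m b c) \<and> d (d a b) c = d a (p b c)) \<and>
    (\<forall>a \<in> C. \<forall>b \<in> C. d (p a b) a = b \<and> (p a b = z \<longrightarrow> a = z) \<and> (m a b = z \<longrightarrow> a = z \<or> b = z)) \<and>
    (\<forall>a \<in> C. d z a = z) \<and>
    (\<forall>a \<in> C. \<forall>b \<in> C. p a (d b a) = b \<or> d b a = z \<and> a = p b (d a b)) \<and>
    (\<forall>a \<in> C. a = z \<or> (\<exists>b \<in> C. a = p b u)))"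

lemma (in epra_model) discrete_semidom_N:
  "discrete_semidom (D N, zr, sc zr, \<lambda>a b. a \<oplus> b, \<lambda>a b. a \<otimes> b, \<lambda>a b. a \<ominus> b)"
proof -
  have 1: "p = zr" if "p \<in> D N" "q \<in> D N" "p \<oplus> q = zr" for p q
    using that by (cases p rule: N_cases) auto
  have 2: "p = zr \<or> q = zr" if "p \<in> D N" "q \<in> D N" "p \<otimes> q = zr" for p q
    using that(1)
  proof (cases p rule: N_cases)
    case (suc b)
    then show ?thesis using that 1[of q "b \<otimes> q"] add_comm[of q "b \<otimes> q"] by simp
  qed simp
  have 3: "p = zr \<or> (\<exists>b \<in> D N. p = sc b)" if "p \<in> D N" for p
    using that by (cases p rule: N_cases) auto
  have 4: "(p \<oplus> q) \<otimes> r = p \<otimes> r \<oplus> q \<otimes> r" if "p \<in> D N" "q \<in> D N" "r \<in> D N" for p q r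
    using that mult_add[of r p q] by (simp add: mult_comm[of _ r])
  show ?thesis
    unfolding discrete_semidom_def split
    by (intro conjI ballI; (rule add_comm mult_comm add_assoc mult_assoc monus_monus N_linear 4)?)
      (auto dest: 1 2 3)
qed

section \<open>Rings of differences\<close>

text \<open>A pair \<open>(a, b)\<close> stands for the difference of \<open>a\<close> and
  \<open>b\<close>. The detour through differences is taken because fraction fields are formed over
  integral domains, and values of rationals are wanted in an ordered field.\<close>

definition gr_rel :: "'a::linordered_semidom \<times> 'a \<Rightarrow> 'a \<times> 'a \<Rightarrow> bool" where
  "gr_rel x y \<longleftrightarrow> fst x + snd y = fst y + snd x"

quotient_type (overloaded) 'a gr = "'a::linordered_semidom \<times> 'a" / gr_rel
  morphisms Rep_gr Abs_gr
proof (rule equivpI)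
  show "reflp (gr_rel :: 'a \<times> 'a \<Rightarrow> _)" by (auto simp: reflp_def gr_rel_def)
  show "symp (gr_rel :: 'a \<times> 'a \<Rightarrow> _)" by (auto simp: symp_def gr_rel_def)
  show "transp (gr_rel :: 'a \<times> 'a \<Rightarrow> _)"
  proof (rule transpI)
    fix x y z :: "'a \<times> 'a" assume "gr_rel x y" "gr_rel y z"
    then have "fst x + snd y + (fst y + snd z) = fst y + snd x + (fst z + snd y)"
      by (simp add: gr_rel_def)
    then have "(fst x + snd z) + (fst y + snd y) = (fst z + snd x) + (fst y + snd y)"
      by (simp add: ac_simps)
    then show "gr_rel x z" by (simp add: gr_rel_def)
  qed
qed

instantiation gr :: (linordered_semidom) linordered_idom
begin

lift_definition zero_gr :: "'a gr" is "(0, 0)" .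
lift_definition one_gr :: "'a gr" is "(1, 0)" .
lift_definition plus_gr :: "'a gr \<Rightarrow> 'a gr \<Rightarrow> 'a gr"
  is "\<lambda>(a, b) (c, d). (a + c, b + d)"
  by (auto simp: gr_rel_def algebra_simps) (metis add.left_commute add.commute)
lift_definition uminus_gr :: "'a gr \<Rightarrow> 'a gr" is "\<lambda>(a, b). (b, a)"
  by (auto simp: gr_rel_def algebra_simps)
lift_definition minus_gr :: "'a gr \<Rightarrow> 'a gr \<Rightarrow> 'a gr"
  is "\<lambda>(a, b) (c, d). (a + d, b + c)"
  by (auto simp: gr_rel_def algebra_simps) (metis add.left_commute add.commute)
lift_definition times_gr :: "'a gr \<Rightarrow> 'a gr \<Rightarrow> 'a gr"
  is "\<lambda>(a, b) (c, d). (a * c + b * d, a * d + b * c)"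
proof (clarsimp simp: gr_rel_def)
  fix s t u v w x y z :: 'a
  assume "s + v = u + t" and "w + z = y + x"
  \<comment> \<open>Without subtraction, suitable multiples of the two hypotheses are added up. What
    exceeds the claim, the products of \<open>u\<close> and \<open>v\<close> with \<open>w\<close>
    and \<open>x\<close>, occurs on both sides and cancels.\<close>
  then have "(s + v) * w + (u + t) * x + u * (w + z) + v * (y + x) =
      (u + t) * w + (s + v) * x + u * (y + x) + v * (w + z)" by simp
  then have "s * w + t * x + (u * z + v * y) + (u * w + u * x + v * w + v * x) =
      u * y + v * z + (s * x + t * w) + (u * w + u * x + v * w + v * x)"
    by (simp only: algebra_simps)
  then show "s * w + t * x + (u * z + v * y) = u * y + v * z + (s * x + t * w)"
    by (rule add_right_imp_eq)
qed
lift_definition less_eq_gr :: "'a gr \<Rightarrow> 'a gr \<Rightarrow> bool" is "\<lambda>(a, b) (c, d). a + d \<le> c + b"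
proof (clarsimp simp: gr_rel_def)
  fix s t u v w x y z :: 'a
  assume e: "s + v = u + t" "w + z = y + x"
  have "s + x \<le> w + t \<longleftrightarrow> s + x + (v + z) \<le> w + t + (v + z)" by simp
  also have "\<dots> \<longleftrightarrow> (s + v) + (x + z) \<le> (w + z) + (t + v)" by (simp add: ac_simps)
  also have "\<dots> \<longleftrightarrow> (u + z) + (t + x) \<le> (y + v) + (t + x)" by (simp add: e ac_simps)
  finally show "s + x \<le> w + t \<longleftrightarrow> u + z \<le> y + v" by simp
qed
definition less_gr :: "'a gr \<Rightarrow> 'a gr \<Rightarrow> bool" where "less_gr a b \<longleftrightarrow> a \<le> b \<and> \<not> b \<le> a"
definition abs_gr :: "'a gr \<Rightarrow> 'a gr" where "abs_gr a = (if a < 0 then - a else a)"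
definition sgn_gr :: "'a gr \<Rightarrow> 'a gr" where
  "sgn_gr a = (if a = 0 then 0 else if 0 < a then 1 else - 1)"

lemma less_gr_Abs: "Abs_gr (a, b) < Abs_gr (c, d) \<longleftrightarrow> a + d < c + b"
  by (auto simp: less_gr_def less_eq_gr.abs_eq)

lemma gr_exhaust:
  obtains a b where "i = Abs_gr (a, b)"
  using Quotient_abs_rep[OF Quotient_gr, of i] by (metis surj_pair)

instance
proof
  fix i j k :: "'a gr"
  show "i + j + k = i + (j + k)" by transfer (auto simp: gr_rel_def ac_simps)
  show "i + j = j + i" by transfer (auto simp: gr_rel_def ac_simps)
  show "0 + i = i" by transfer (auto simp: gr_rel_def)
  show "- i + i = 0" by transfer (auto simp: gr_rel_def ac_simps)
  show "i - j = i + - j" by transfer (auto simp: gr_rel_def ac_simps)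
  show "i * j * k = i * (j * k)" by transfer (auto simp: gr_rel_def algebra_simps)
  show "i * j = j * i" by transfer (auto simp: gr_rel_def ac_simps)
  show "1 * i = i" by transfer (auto simp: gr_rel_def)
  show "(i + j) * k = i * k + j * k" by transfer (auto simp: gr_rel_def algebra_simps)
  show "i + j - i = j" "i - j - k = i - (j + k)" by (transfer, auto simp: gr_rel_def ac_simps)+
  show "0 * i = 0" "i * 0 = 0" by (transfer, auto simp: gr_rel_def)+
  show "0 \<noteq> (1 :: 'a gr)" by transfer (simp add: gr_rel_def)
  show "(i < j) = (i \<le> j \<and> \<not> j \<le> i)" by (simp add: less_gr_def)
  show "i \<le> i" by transfer auto
  show "i \<le> j \<or> j \<le> i" by transfer auto
  show "i \<le> j \<Longrightarrow> j \<le> i \<Longrightarrow> i = j"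
    by transfer (auto simp: gr_rel_def)
  show "i \<le> k" if "i \<le> j" "j \<le> k"
    using that
  proof (transfer, clarify)
    fix s t u v w x :: 'a
    assume "s + v \<le> u + t" "u + x \<le> w + v"
    then have "s + v + (u + x) \<le> u + t + (w + v)" by (rule add_mono)
    then have "s + x + (u + v) \<le> w + t + (u + v)" by (simp add: ac_simps)
    then show "s + x \<le> w + t" by simp
  qed
  show "k + i \<le> k + j" if "i \<le> j"
    using that
  proof (transfer, clarify)
    fix s t u v w x :: 'a
    assume "s + v \<le> u + t"
    then have "s + v + (w + x) \<le> u + t + (w + x)" by simp
    then show "w + s + (x + v) \<le> w + u + (x + t)" by (simp add: ac_simps)
  qed
  show "k * i < k * j" if "i < j" "0 < k"
  proof -
    obtain a b where i: "i = Abs_gr (a, b)" using gr_exhaust .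
    obtain c d where j: "j = Abs_gr (c, d)" using gr_exhaust .
    obtain x y where k: "k = Abs_gr (x, y)" using gr_exhaust .
    have ij: "a + d < c + b" using that(1) by (simp add: i j less_gr_Abs)
    have "y < x" using that(2) by (simp add: k zero_gr_def less_gr_Abs)
    \<comment> \<open>The positive factor becomes \<open>e > 0\<close> after a common
      \<open>y\<close> is split off. Multiplication by \<open>e\<close> is strictly monotone, and
      the contributions of \<open>y\<close> are equal on both sides.\<close>
    then obtain e where x: "x = y + e" by (metis le_add_diff_inverse less_imp_le)
    have "y + 0 < y + e" using \<open>y < x\<close> x by simp
    then have e: "0 < e" by (simp only: add_less_cancel_left)
    have "e * (a + d) < e * (c + b)" using ij e by (simp add: mult_strict_left_mono)
    then have "e * (a + d) + y * (a + b + c + d) < e * (c + b) + y * (a + b + c + d)" by simp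
    then show ?thesis
      by (simp add: i j k times_gr.abs_eq less_gr_Abs x algebra_simps)
  qed
  show "\<bar>i\<bar> = (if i < 0 then - i else i)" by (simp add: abs_gr_def)
  show "sgn i = (if i = 0 then 0 else if 0 < i then 1 else - 1)" by (simp add: sgn_gr_def)
qed

end

definition frac_of :: "'a::linordered_semidom \<Rightarrow> 'a gr fract" where
  "frac_of a = Fract (Abs_gr (a, 0)) 1"

lemma frac_of_simps [simp]:
  "frac_of 0 = 0" "frac_of 1 = 1" "frac_of (a + b) = frac_of a + frac_of b"
  "frac_of (a * b) = frac_of a * frac_of b"
  by (simp_all add: frac_of_def Zero_fract_def One_fract_def flip: zero_gr_def one_gr_def)
    (simp_all add: plus_gr.abs_eq times_gr.abs_eq)

lemma frac_of_le [simp]: "frac_of a \<le> frac_of b \<longleftrightarrow> a \<le> b"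
  by (simp add: frac_of_def less_eq_gr.abs_eq)

lemma frac_of_less [simp]: "frac_of a < frac_of b \<longleftrightarrow> a < b"
  by (meson frac_of_le not_le)

lemma frac_of_pos [simp]: "0 < frac_of a \<longleftrightarrow> 0 < a"
  using frac_of_less[of 0 a] by (simp del: frac_of_less)

section \<open>The numbers of a refuting model\<close>

text \<open>A power of two makes the error \<open>1 / j\<close> one of the tolerances
  \<open>2 ^ -n\<close> that are built into the relations on reals. Since
  \<open>k \<le> 2 ^ k\<close>, it is at most an eighth of \<open>1 / k\<close>.\<close>

definition modulus :: tm where
  "modulus =
    (let vg = (''g'', N \<rightarrow> N1 \<rightarrow> N \<rightarrow> N); vh = (''h'', N \<rightarrow> N); vk = (''k'', N); vx = (''x'', N1);
         j = Pow2 \<cdot> Succ (Succ (Succ (FV vk)))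
     in lams [vg, vh, vk, vx] (FV vg \<cdot> (FV vh \<cdot> j) \<cdot> FV vx \<cdot> j))"

lemma modulus_closed [simp]: "tty \<Delta> modulus = Some ULC_ty" "tfv modulus = {}"
  by (simp_all add: modulus_def Let_def tty_compute tfv_lam insert_Diff_if)

text \<open>One notion covers both halves of the theorem: the type of numbers is fixed only once, so
  the model behind it has to serve whichever half might fail.\<close>

definition refutes ::
    "(ty \<Rightarrow> 'v set) \<times> ('v \<Rightarrow> 'v \<Rightarrow> 'v) \<times> (cst \<Rightarrow> 'v) \<times> (ty \<Rightarrow> 'v set) \<Rightarrow> bool" where
  "refutes = (\<lambda>(D, ap, cn, S). epra_model D ap cn S \<and>
    ((\<forall>\<psi> \<in> (T_st \<union> Ideal) \<inter> lang True. \<forall>e. typed_env D e \<longrightarrow> sat D ap cn S e [] \<psi>) \<and>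
       (\<exists>e. typed_env D e \<and> \<not> sat D ap cn S e [] ULC_ns) \<or>
     (\<exists>e. typed_env D e \<and> \<not> sat D ap cn S e [] (ULC_ef modulus))))"

definition refuting_model ::
    "(ty \<Rightarrow> tm set set) \<times> (tm set \<Rightarrow> tm set \<Rightarrow> tm set) \<times> (cst \<Rightarrow> tm set) \<times> (ty \<Rightarrow> tm set set)" where
  "refuting_model = (SOME M. refutes M)"

definition N_struct ::
    "(ty \<Rightarrow> 'v set) \<times> ('v \<Rightarrow> 'v \<Rightarrow> 'v) \<times> (cst \<Rightarrow> 'v) \<times> (ty \<Rightarrow> 'v set) \<Rightarrow>
     'v set \<times> 'v \<times> 'v \<times> ('v \<Rightarrow> 'v \<Rightarrow> 'v) \<times> ('v \<Rightarrow> 'v \<Rightarrow> 'v) \<times> ('v \<Rightarrow> 'v \<Rightarrow> 'v)" where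
  "N_struct = (\<lambda>(D, ap, cn, S).
    let val = epra_model.val D ap cn in
    (D N, cn CZero, ap (cn CSucc) (cn CZero), \<lambda>a b. ap (ap (val Add) a) b,
     \<lambda>a b. ap (ap (val Mult) a) b, \<lambda>a b. ap (ap (val Monus) a) b))"

text \<open>The default has to live in the carrier type of the refuting model; \<open>{BV n}\<close>
  is merely an injective code of \<open>n\<close> there.\<close>

definition nat_struct ::
    "tm set set \<times> tm set \<times> tm set \<times> (tm set \<Rightarrow> tm set \<Rightarrow> tm set) \<times>
     (tm set \<Rightarrow> tm set \<Rightarrow> tm set) \<times> (tm set \<Rightarrow> tm set \<Rightarrow> tm set)" where
  "nat_struct =
    (let c = (\<lambda>n. {BV n}); dec = inv c in
     (range c, c 0, c 1, \<lambda>a b. c (dec a + dec b), \<lambda>a b. c (dec a * dec b), \<lambda>a b. c (dec a - dec b)))"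

text \<open>
  There are no local types in HOL. Therefore a single refuting model is chosen once and for all, so
  that its numbers form a type; the natural numbers serve as a default, as long as it is not known
  that there is no such model.
\<close>

definition num_struct where
  "num_struct = (if \<exists>M :: (ty \<Rightarrow> tm set set) \<times> _. refutes M then N_struct refuting_model else nat_struct)"

lemma refutes_refuting_model: "\<exists>M :: (ty \<Rightarrow> tm set set) \<times> _. refutes M \<Longrightarrow> refutes refuting_model"
  unfolding refuting_model_def by (rule someI_ex)

lemma discrete_semidom_nat_struct: "discrete_semidom nat_struct"
proof -
  have [simp]: "inv (\<lambda>n. {BV n}) {BV m} = m" for m
    by (rule inv_f_f) (auto simp: inj_def)
  show ?thesis
    unfolding nat_struct_def Let_def discrete_semidom_def split
    by (auto simp: algebra_simps) (metis Suc_eq_plus1 not0_implies_Suc)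
qed

lemma discrete_semidom_num_struct: "discrete_semidom num_struct"
proof (cases "\<exists>M :: (ty \<Rightarrow> tm set set) \<times> _. refutes M")
  case True
  obtain D ap cn S where M: "refuting_model = (D, ap, cn, S)" by (metis surj_pair)
  have "epra_model D ap cn S"
    using refutes_refuting_model[OF True] by (simp add: refutes_def M)
  from epra_model.discrete_semidom_N[OF this] show ?thesis
    using True by (simp add: num_struct_def N_struct_def M Let_def)
qed (simp add: num_struct_def discrete_semidom_nat_struct)

lemma discrete_semidom_zero: "discrete_semidom M \<Longrightarrow> fst (snd M) \<in> fst M"
  by (cases M) (simp add: discrete_semidom_def)

section \<open>The numbers of the model as an ordered semidomain\<close>

typedef model_num = "fst num_struct"
  using discrete_semidom_zero[OF discrete_semidom_num_struct] by blast

instantiation model_num :: "{zero, one, plus, times, minus, ord}"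
begin

definition zero_model_num :: model_num where "zero_model_num = Abs_model_num (fst (snd num_struct))"
definition one_model_num :: model_num where "one_model_num = Abs_model_num (fst (snd (snd num_struct)))"
definition plus_model_num :: "model_num \<Rightarrow> model_num \<Rightarrow> model_num" where
  "plus_model_num a b = Abs_model_num (fst (snd (snd (snd num_struct))) (Rep_model_num a) (Rep_model_num b))"
definition times_model_num :: "model_num \<Rightarrow> model_num \<Rightarrow> model_num" where
  "times_model_num a b = Abs_model_num (fst (snd (snd (snd (snd num_struct)))) (Rep_model_num a) (Rep_model_num b))"
definition minus_model_num :: "model_num \<Rightarrow> model_num \<Rightarrow> model_num" where
  "minus_model_num a b = Abs_model_num (snd (snd (snd (snd (snd num_struct)))) (Rep_model_num a) (Rep_model_num b))"
definition less_eq_model_num :: "model_num \<Rightarrow> model_num \<Rightarrow> bool" where "less_eq_model_num a b \<longleftrightarrow> a - b = 0"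
definition less_model_num :: "model_num \<Rightarrow> model_num \<Rightarrow> bool" where "less_model_num a b \<longleftrightarrow> \<not> b \<le> a"

instance ..

end

context
begin

private lemma ex_num:
  "(\<forall>a \<in> fst num_struct. P a) \<longleftrightarrow> (\<forall>a. P (Rep_model_num a))"
  "(\<exists>a \<in> fst num_struct. P a) \<longleftrightarrow> (\<exists>a. P (Rep_model_num a))"
  using Rep_model_num Abs_model_num_inverse by metis+

lemma Rep_num_ops:
  assumes "num_struct = (C, z, u, p, m, d)"
  shows "Rep_model_num 0 = z" "Rep_model_num 1 = u" "Rep_model_num (a + b) = p (Rep_model_num a) (Rep_model_num b)"
    "Rep_model_num (a * b) = m (Rep_model_num a) (Rep_model_num b)" "Rep_model_num (a - b) = d (Rep_model_num a) (Rep_model_num b)"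
  using discrete_semidom_num_struct Rep_model_num[of a] Rep_model_num[of b]
  by (simp_all add: zero_model_num_def one_model_num_def plus_model_num_def times_model_num_def minus_model_num_def assms
      discrete_semidom_def Abs_model_num_inverse)

lemma num_laws:
  fixes a b c :: model_num
  shows "0 \<noteq> (1 :: model_num)" "a + b = b + a" "a * b = b * a" "0 + a = a" "1 * a = a" "0 * a = 0"
    "a + b + c = a + (b + c)" "a * b * c = a * (b * c)" "(a + b) * c = a * c + b * c"
    "a - b - c = a - (b + c)" "a + b - a = b" "a + b = 0 \<Longrightarrow> a = 0" "a * b = 0 \<Longrightarrow> a = 0 \<or> b = 0"
    "0 - a = 0" "a + (b - a) = b \<or> b - a = 0 \<and> a = b + (a - b)" "a = 0 \<or> (\<exists>b. a = b + 1)"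
proof -
  obtain C z u p m d where S: "num_struct = (C, z, u, p, m, d)" by (metis surj_pair)
  note R = Rep_num_ops[OF S, symmetric]
  have C: "C = fst num_struct" by (simp add: S)
  have *: "discrete_semidom (fst num_struct, Rep_model_num 0, Rep_model_num 1, p, m, d)"
    using discrete_semidom_num_struct by (simp add: R S)
  note ** = *[unfolded discrete_semidom_def split ex_num R Rep_model_num_inject]
  show "0 \<noteq> (1 :: model_num)" "a + b = b + a" "a * b = b * a" "0 + a = a" "1 * a = a" "0 * a = 0"
    "a + b + c = a + (b + c)" "a * b * c = a * (b * c)" "(a + b) * c = a * c + b * c"
    "a - b - c = a - (b + c)" "a + b - a = b" "a + b = 0 \<Longrightarrow> a = 0" "a * b = 0 \<Longrightarrow> a = 0 \<or> b = 0"
    "0 - a = 0" "a + (b - a) = b \<or> b - a = 0 \<and> a = b + (a - b)" "a = 0 \<or> (\<exists>b. a = b + 1)"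
    using ** by blast+
qed

end

text \<open>The order was defined by truncated subtraction to be quantifier-free. The class axioms
  follow more easily from this additive description.\<close>

lemma num_le_iff: "(a :: model_num) \<le> b \<longleftrightarrow> (\<exists>c. b = a + c)"
proof
  assume "a \<le> b"
  then have "a - b = 0" by (simp add: less_eq_model_num_def)
  then have "b + (0 :: model_num) = a \<or> b = a + (b - a)" using num_laws(15)[of b a] by metis
  then show "\<exists>c. b = a + c" using num_laws(2,4) by metis
next
  assume "\<exists>c. b = a + c"
  then obtain c where "b = a + c" ..
  then have "a - b = a - a - c" by (simp add: num_laws(10))
  moreover have "a - a = 0" using num_laws(2,4,11) by metis
  ultimately show "a \<le> b" by (simp add: less_eq_model_num_def num_laws(14))
qed

instance model_num :: linordered_semidom
proof
  fix a b c :: model_num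
  note comm = num_laws(2) num_laws(3)
  have cancel: "x + y = x + z \<Longrightarrow> y = z" for x y z :: model_num using num_laws(11) by metis
  have zero: "x + (0 :: model_num) = x" for x using num_laws(2,4) by metis
  have linear: "x \<le> y \<or> y \<le> x" for x y :: model_num
    using num_laws(15)[of x y] num_le_iff by metis
  have antisym: "x \<le> y \<Longrightarrow> y \<le> x \<Longrightarrow> x = y" for x y :: model_num
    unfolding num_le_iff using cancel zero num_laws(7,12) by metis
  show "a + b + c = a + (b + c)" "a + b = b + a" "0 + a = a" "a + b - a = b" "a - b - c = a - (b + c)"
    "a * b * c = a * (b * c)" "a * b = b * a" "1 * a = a" "(a + b) * c = a * c + b * c"
    "0 * a = 0" "0 \<noteq> (1 :: model_num)"
    by (fact num_laws)+
  show "a * (b + c) = a * b + a * c" using num_laws(3,9) by metis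
  show "a * 0 = 0" using num_laws(3,6) by metis
  show "a \<noteq> 0 \<Longrightarrow> b \<noteq> 0 \<Longrightarrow> a * b \<noteq> 0" using num_laws(13) by blast
  show "a \<le> b \<or> b \<le> a" by (rule linear)
  show "a \<le> b \<Longrightarrow> b \<le> a \<Longrightarrow> a = b" by (rule antisym)
  show "a \<le> a" using linear[of a a] by (elim disjE)
  show "a \<le> b \<Longrightarrow> b \<le> c \<Longrightarrow> a \<le> c" unfolding num_le_iff using num_laws(7) by metis
  show "(a < b) = (a \<le> b \<and> \<not> b \<le> a)" using linear by (auto simp: less_model_num_def)
  show "a \<le> b \<Longrightarrow> c + a \<le> c + b" unfolding num_le_iff using num_laws(7) by metis
  have zle: "0 \<le> x" for x :: model_num unfolding num_le_iff using num_laws(4) by metis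
  show "0 < (1 :: model_num)"
    using antisym zle num_laws(1) unfolding less_model_num_def by metis
  show "b \<le> a \<Longrightarrow> a - b + b = a"
    unfolding num_le_iff using num_laws(2,11) by metis
  show "a * (b - c) = a * b - a * c"
  proof (cases "c \<le> b")
    case True
    then obtain x where x: "b = c + x" using num_le_iff by blast
    then have "a * b = a * c + a * x" using num_laws(3,9) by metis
    then show ?thesis using x num_laws(11) by metis
  next
    case False
    then obtain x where x: "c = b + x" using num_le_iff linear by blast
    then have "a * c = a * b + a * x" using num_laws(3,9) by metis
    then have "b - c = 0" "a * b - a * c = 0" using x num_le_iff less_eq_model_num_def by blast+
    then show ?thesis using num_laws(3,6) by metis
  qed
  show "c * a < c * b" if ab: "a < b" and c: "0 < c"
  proof (rule ccontr)
    assume "\<not> c * a < c * b"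
    then obtain y where y: "c * a = c * b + y" unfolding less_model_num_def num_le_iff by blast
    obtain x where x: "b = a + x" using ab linear num_le_iff unfolding less_model_num_def by blast
    have "x \<noteq> 0" "c \<noteq> 0" using ab c x zero zle linear unfolding less_model_num_def by metis+
    then have "c * x \<noteq> 0" using num_laws(13) by blast
    moreover have "c * b = c * a + c * x" using x num_laws(3,9) by metis
    then have "c * a + 0 = c * a + (c * x + y)" using y num_laws(7) zero by metis
    then have "c * x + y = 0" using cancel by metis
    ultimately show False using num_laws(12) by blast
  qed
qed

text \<open>A nonzero difference is a successor.\<close>

lemma model_num_discrete: "(a :: model_num) < b \<longleftrightarrow> a + 1 \<le> b"
proof
  assume "a < b"
  then obtain c where c: "b = a + c" using num_le_iff[of a b] by auto
  with \<open>a < b\<close> have "c \<noteq> 0" by auto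
  then obtain d where "c = d + 1" using num_laws(16) by blast
  then show "a + 1 \<le> b" using c num_le_iff[of "a + 1" b] by (auto simp: ac_simps)
next
  assume "a + 1 \<le> b"
  then show "a < b" using less_le_trans[of a "a + 1" b] by simp
qed

lemma model_num_nonneg [simp]: "0 \<le> (a :: model_num)"
  using num_le_iff[of 0 a] by simp

type_synonym model_frac = "model_num gr fract"

text \<open>Here the numbers of the model are the ones from which the type \<open>model_num\<close>
  was made. This turns \<open>\<iota>\<close> and \<open>\<alpha>\<close> into mutually inverse
  translations.\<close>

locale num_model = epra_model D ap cn S
  for D :: "ty \<Rightarrow> tm set set" and ap (infixl "\<bullet>" 100) and cn and S +
  assumes num_struct_D: "num_struct = N_struct (D, ap, cn, S)"
begin

abbreviation \<iota> :: "model_num \<Rightarrow> tm set" where "\<iota> \<equiv> Rep_model_num"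
abbreviation \<alpha> :: "tm set \<Rightarrow> model_num" where "\<alpha> \<equiv> Abs_model_num"

lemma num_struct_eq:
  "num_struct = (D N, zr, sc zr, \<lambda>a b. a \<oplus> b, \<lambda>a b. a \<otimes> b, \<lambda>a b. a \<ominus> b)"
  by (simp add: num_struct_D N_struct_def Let_def)

lemma \<iota>_D [simp]: "\<iota> a \<in> D N"
  using Rep_model_num[of a] by (simp add: num_struct_eq)

lemma \<iota>_\<alpha> [simp]: "x \<in> D N \<Longrightarrow> \<iota> (\<alpha> x) = x"
  by (rule Abs_model_num_inverse) (simp add: num_struct_eq)

lemma \<alpha>_\<iota> [simp]: "\<alpha> (\<iota> a) = a"
  by (rule Rep_model_num_inverse)

lemma \<iota>_eq: "\<iota> a = \<iota> b \<longleftrightarrow> a = b"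
  by (rule Rep_model_num_inject)

lemma ball_N: "(\<forall>d \<in> D N. P d) \<longleftrightarrow> (\<forall>a. P (\<iota> a))"
  and bex_N: "(\<exists>d \<in> D N. P d) \<longleftrightarrow> (\<exists>a. P (\<iota> a))"
  using \<iota>_D \<iota>_\<alpha> by metis+

lemma \<iota>_ops: "zr = \<iota> 0" "\<iota> a \<oplus> \<iota> b = \<iota> (a + b)" "\<iota> a \<otimes> \<iota> b = \<iota> (a * b)" "\<iota> a \<ominus> \<iota> b = \<iota> (a - b)"
  "sc (\<iota> a) = \<iota> (a + 1)"
proof -
  show ops: "zr = \<iota> 0" "\<iota> a \<oplus> \<iota> b = \<iota> (a + b)" "\<iota> a \<otimes> \<iota> b = \<iota> (a * b)" "\<iota> a \<ominus> \<iota> b = \<iota> (a - b)" for a b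
    using Rep_num_ops(1)[OF num_struct_eq] Rep_num_ops(3-)[OF num_struct_eq, of a b] by simp_all
  have "sc (\<iota> a) = \<iota> a \<oplus> sc zr" by simp
  also have "\<dots> = \<iota> (a + 1)" using Rep_num_ops(2)[OF num_struct_eq] Rep_num_ops(3)[OF num_struct_eq, of a 1] by simp
  finally show "sc (\<iota> a) = \<iota> (a + 1)" .
qed

lemma \<alpha>_ops:
  "\<alpha> zr = 0"
  "a \<in> D N \<Longrightarrow> \<alpha> (sc a) = \<alpha> a + 1"
  "a \<in> D N \<Longrightarrow> b \<in> D N \<Longrightarrow> \<alpha> (a \<oplus> b) = \<alpha> a + \<alpha> b"
  "a \<in> D N \<Longrightarrow> b \<in> D N \<Longrightarrow> \<alpha> (a \<otimes> b) = \<alpha> a * \<alpha> b"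
  "a \<in> D N \<Longrightarrow> b \<in> D N \<Longrightarrow> \<alpha> (a \<ominus> b) = \<alpha> a - \<alpha> b"
  by (metis \<iota>_ops \<iota>_\<alpha> \<alpha>_\<iota>)+

lemma \<alpha>_eq: "a \<in> D N \<Longrightarrow> b \<in> D N \<Longrightarrow> \<alpha> a = \<alpha> b \<longleftrightarrow> a = b"
  by (metis \<iota>_\<alpha>)

lemma monus_zr_iff: "a \<in> D N \<Longrightarrow> b \<in> D N \<Longrightarrow> a \<ominus> b = zr \<longleftrightarrow> \<alpha> a \<le> \<alpha> b"
  by (simp add: less_eq_model_num_def flip: \<alpha>_eq \<alpha>_ops)

subsection \<open>Triangular numbers and pairing\<close>

abbreviation tri :: "model_num \<Rightarrow> model_num" where "tri a \<equiv> \<alpha> (val Tri \<bullet> \<iota> a)"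
abbreviation diag :: "model_num \<Rightarrow> model_num" where "diag a \<equiv> \<alpha> (val Diag \<bullet> \<iota> a)"
abbreviation pow2 :: "model_num \<Rightarrow> model_num" where "pow2 a \<equiv> \<alpha> (val Pow2 \<bullet> \<iota> a)"

text \<open>Representability is transported to \<open>model_num\<close>, where induction proofs can
  use the order and the algebraic simplification rules.\<close>

definition tp :: "(model_num \<Rightarrow> bool) \<Rightarrow> bool" where
  "tp P \<longleftrightarrow> rp (\<lambda>d. P (\<alpha> d))"

definition trep :: "(model_num \<Rightarrow> model_num) \<Rightarrow> bool" where
  "trep f \<longleftrightarrow> rep N (\<lambda>d. \<iota> (f (\<alpha> d)))"

lemma rep_cong: "(\<And>d. d \<in> D N \<Longrightarrow> f d = g d) \<Longrightarrow> rep \<sigma> f = rep \<sigma> g"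
  by (simp add: rep_def)

lemma trep_id: "trep (\<lambda>a. a)"
  using rep_id rep_cong[of "\<lambda>d. \<iota> (\<alpha> d)" "\<lambda>d. d"] by (simp add: trep_def)

lemma trep_const: "trep (\<lambda>a. b)"
  by (simp add: trep_def rep_const)

lemma trep_op2:
  assumes "trep f" "trep g"
  shows "trep (\<lambda>a. f a + g a)" "trep (\<lambda>a. f a * g a)" "trep (\<lambda>a. f a - g a)"
  using assms rep_op2[OF val_D(1), of "\<lambda>d. \<iota> (f (\<alpha> d))" "\<lambda>d. \<iota> (g (\<alpha> d))"]
    rep_op2[OF val_D(2), of "\<lambda>d. \<iota> (f (\<alpha> d))" "\<lambda>d. \<iota> (g (\<alpha> d))"]
    rep_op2[OF val_D(4), of "\<lambda>d. \<iota> (f (\<alpha> d))" "\<lambda>d. \<iota> (g (\<alpha> d))"]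
  by (simp_all add: trep_def \<iota>_ops(2-))

lemma trep_op1: "c \<in> D N1 \<Longrightarrow> trep f \<Longrightarrow> trep (\<lambda>a. \<alpha> (c \<bullet> \<iota> (f a)))"
  using rep_op1[of c "\<lambda>d. \<iota> (f (\<alpha> d))"] by (simp add: trep_def)

lemma tp_eq: "trep f \<Longrightarrow> trep g \<Longrightarrow> tp (\<lambda>a. f a = g a)"
  using rp_eq[of "\<lambda>d. \<iota> (f (\<alpha> d))" "\<lambda>d. \<iota> (g (\<alpha> d))"] by (simp add: trep_def tp_def \<iota>_eq)

lemma tp_le: "trep f \<Longrightarrow> trep g \<Longrightarrow> tp (\<lambda>a. f a \<le> g a)"
  using tp_eq[OF trep_op2(3) trep_const, of f g 0] by (simp add: less_eq_model_num_def)

lemma tp_less: "trep f \<Longrightarrow> trep g \<Longrightarrow> tp (\<lambda>a. f a < g a)"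
  using tp_le[of g f] rp_not by (simp add: tp_def flip: not_le)

lemma tp_imp: "tp P \<Longrightarrow> tp Q \<Longrightarrow> tp (\<lambda>a. P a \<longrightarrow> Q a)"
  and tp_and: "tp P \<Longrightarrow> tp Q \<Longrightarrow> tp (\<lambda>a. P a \<and> Q a)"
  unfolding tp_def by (intro rp_imp rp_and; assumption)+

lemmas tp_intros = tp_imp tp_and tp_eq tp_le tp_less trep_id trep_const trep_op2
  trep_op1[OF val_D(5)] trep_op1[OF val_D(6)] trep_op1[OF val_D(8)]

lemma num_induct [case_names tp zero suc]:
  assumes "tp P" "P 0" "\<And>a. P a \<Longrightarrow> P (a + 1)"
  shows "P a"
proof -
  have "P (\<alpha> (\<iota> a))"
    by (rule N_induct[OF \<iota>_D, of "\<lambda>d. P (\<alpha> d)"]) (use assms in \<open>auto simp: tp_def \<alpha>_ops\<close>)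
  then show ?thesis by simp
qed

lemma tri_rec': "tri 0 = 0" "tri (a + 1) = tri a + (a + 1)"
  using tri_rec(2)[of "\<iota> a"] by (simp_all add: \<alpha>_ops add.assoc flip: \<iota>_ops(1,5))

lemma pow2_rec': "pow2 0 = 1" "pow2 (a + 1) = pow2 a + pow2 a"
  using pow2_rec(2)[of "\<iota> a"] by (simp_all add: \<alpha>_ops flip: \<iota>_ops(1,5))

lemma diag_rec': "diag 0 = 0" "diag (a + 1) = diag a + (1 - (tri (diag a + 1) - (a + 1)))"
  using diag_rec(2)[of "\<iota> a"]
  by (simp_all add: \<alpha>_ops del: tri_rec(2) monus_rec(2) monus_sc flip: \<iota>_ops(1,5))

text \<open>The doubled form avoids division. The monotonicity of \<open>tri\<close> will be read
  off it.\<close>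

lemma tri_eq: "2 * tri a = a * (a + 1)"
  by (induction a rule: num_induct)
    (intro tp_intros, simp_all add: tri_rec' algebra_simps)

lemma tri_mono:
  assumes "a \<le> b"
  shows "tri a \<le> tri b"
proof -
  have "a * (a + 1) \<le> b * (b + 1)" using assms by (intro mult_mono) auto
  then have "2 * tri a \<le> 2 * tri b" by (simp only: tri_eq)
  then show ?thesis by (rule mult_left_le_imp_le) simp
qed

text \<open>One increment per step is enough: a step raises the argument by one, while
  \<open>tri r\<close> and \<open>tri (r + 1)\<close> are \<open>r + 1\<close> apart.\<close>

lemma diag_bounds: "tri (diag a) \<le> a \<and> a < tri (diag a + 1)"
proof (induction a rule: num_induct)
  case tp
  show ?case by (intro tp_intros)
next
  case zero
  show ?case using tri_rec'(2)[of 0] by (simp add: diag_rec' tri_rec')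
next
  case (suc a)
  let ?r = "diag a"
  show ?case
  proof (cases "tri (?r + 1) \<le> a + 1")
    case True
    then have "tri (?r + 1) - (a + 1) = 0" by (simp add: less_eq_model_num_def)
    then have d: "diag (a + 1) = ?r + 1" using diag_rec'(2)[of a] by simp
    have "a + 1 < tri (?r + 1) + (?r + 1 + 1)"
      using suc by (metis add_less_le_mono le_add_same_cancel2 model_num_nonneg)
    then show ?thesis unfolding d using True by (simp add: tri_rec')
  next
    case False
    then have l: "a + 1 < tri (?r + 1)" by simp
    then obtain c where c: "tri (?r + 1) = a + 1 + c" "c \<noteq> 0" 
      using num_le_iff[of "a + 1" "tri (?r + 1)"] by auto
    then obtain b where "c = b + 1" using num_laws(16) by blast
    then have "(1 :: model_num) - c = 0" by (simp flip: less_eq_model_num_def)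
    then have d: "diag (a + 1) = ?r" using diag_rec'(2)[of a] c by simp
    have "tri ?r \<le> a + 1" using suc by (meson le_add_same_cancel1 order_trans model_num_nonneg)
    then show ?thesis unfolding d using l by simp
  qed
qed

text \<open>As \<open>b < a + b + 1\<close>, the code lies at or above \<open>tri (a + b)\<close>
  and below \<open>tri (a + b + 1)\<close>. By monotonicity no other \<open>w\<close> in place of
  \<open>a + b\<close> has this property.\<close>

lemma diag_pair: "diag (tri (a + b) + b) = a + b"
proof -
  let ?k = "tri (a + b) + b" and ?r = "diag (tri (a + b) + b)"
  have r: "tri ?r \<le> ?k" "?k < tri (?r + 1)" using diag_bounds[of ?k] by auto
  have "b + 1 \<le> a + b + 1" by simp
  then have "b < a + b + 1" by (simp only: model_num_discrete)
  then have k: "?k < tri (a + b + 1)" unfolding tri_rec' by (rule add_strict_left_mono)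
  show ?thesis
  proof (cases ?r "a + b" rule: linorder_cases)
    case less
    then have "tri (?r + 1) \<le> tri (a + b)" by (intro tri_mono) (simp add: model_num_discrete)
    then show ?thesis using r(2) by (meson le_add_same_cancel1 model_num_nonneg not_le order_trans)
  next
    case greater
    then have "tri (a + b + 1) \<le> tri ?r" by (intro tri_mono) (simp add: model_num_discrete)
    then show ?thesis using r(1) k by simp
  qed
qed

lemma snd_pair [simp]:
  assumes "a \<in> D N" "b \<in> D N"
  shows "val Snd \<bullet> (val Pair \<bullet> a \<bullet> b) = b"
proof -
  have "\<alpha> (val Diag \<bullet> (val Pair \<bullet> a \<bullet> b)) = \<alpha> (a \<oplus> b)"
    using assms diag_pair[of "\<alpha> a" "\<alpha> b"] by (simp add: pair_eq \<alpha>_ops flip: \<iota>_ops)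
  then have "val Diag \<bullet> (val Pair \<bullet> a \<bullet> b) = a \<oplus> b" using assms by (simp add: \<alpha>_eq)
  then show ?thesis using assms by (simp add: snd_eq) (simp add: pair_eq)
qed

lemma fst_pair [simp]:
  assumes "a \<in> D N" "b \<in> D N"
  shows "val Fst \<bullet> (val Pair \<bullet> a \<bullet> b) = a"
proof -
  have "\<alpha> (val Diag \<bullet> (val Pair \<bullet> a \<bullet> b)) = \<alpha> (a \<oplus> b)"
    using assms diag_pair[of "\<alpha> a" "\<alpha> b"] by (simp add: pair_eq \<alpha>_ops flip: \<iota>_ops)
  then have "val Diag \<bullet> (val Pair \<bullet> a \<bullet> b) = a \<oplus> b" using assms by (simp add: \<alpha>_eq)
  then show ?thesis using assms by (simp add: fst_eq)
qed

end

section \<open>Rational and real numbers in the model\<close>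

context num_model
begin

definition fr :: "tm set \<Rightarrow> model_frac" where "fr a = frac_of (\<alpha> a)"

lemma fr_ops [simp]:
  "fr zr = 0"
  "a \<in> D N \<Longrightarrow> fr (sc a) = fr a + 1"
  "a \<in> D N \<Longrightarrow> b \<in> D N \<Longrightarrow> fr (a \<oplus> b) = fr a + fr b"
  "a \<in> D N \<Longrightarrow> b \<in> D N \<Longrightarrow> fr (a \<otimes> b) = fr a * fr b"
  by (simp_all add: fr_def \<alpha>_ops)

lemma fr_nonneg [simp]: "0 \<le> fr a"
  using frac_of_le[of 0 "\<alpha> a"] by (simp add: fr_def del: frac_of_le)

lemma fr_le: "a \<in> D N \<Longrightarrow> b \<in> D N \<Longrightarrow> a \<ominus> b = zr \<longleftrightarrow> fr a \<le> fr b"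
  by (simp add: fr_def monus_zr_iff)

lemma fr_monus:
  assumes "a \<in> D N" "b \<in> D N"
  shows "fr (a \<ominus> b) = max 0 (fr a - fr b)"
proof (cases "a \<ominus> b = zr")
  case True
  then have "fr (a \<ominus> b) = 0" by simp
  moreover have "fr a \<le> fr b" using True assms by (simp add: fr_le)
  ultimately show ?thesis by simp
next
  case False
  then have l: "fr b \<le> fr a" using assms fr_le[of a b] by simp
  have "a = b \<oplus> (a \<ominus> b)"
    using N_linear[of b a] assms False by metis
  then have "fr a = fr b + fr (a \<ominus> b)" using assms by (metis app_D2 fr_ops(3) val_D(4))
  then show ?thesis using l by simp
qed

text \<open>\<open>MkQ\<close> stores the predecessor of the denominator and decoding adds one; a
  denominator \<open>0\<close> thus comes out as \<open>1\<close>.\<close>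

lemma fr_pred_sc:
  assumes "a \<in> D N"
  shows "fr (val Pred \<bullet> a) + 1 = max 1 (fr a)"
  using assms by (cases a rule: N_cases) simp_all

definition qv :: "tm set \<Rightarrow> model_frac" where
  "qv q = (fr (val Fst \<bullet> (val Fst \<bullet> q)) - fr (val Snd \<bullet> (val Fst \<bullet> q))) / (fr (val Snd \<bullet> q) + 1)"

lemma fr_plus1_pos [simp]: "0 < fr a + 1" "fr a + 1 \<noteq> 0"
  using fr_nonneg[of a] by (simp_all add: add_nonneg_pos add_nonneg_eq_0_iff)

lemma eval_QPos: "ev e ds (QPos q) = val Fst \<bullet> (val Fst \<bullet> ev e ds q)"
  and eval_QNeg: "ev e ds (QNeg q) = val Snd \<bullet> (val Fst \<bullet> ev e ds q)"
  and eval_QDen: "ev e ds (QDen q) = sc (val Snd \<bullet> ev e ds q)"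
  and eval_MkQ: "ev e ds (MkQ s t u) =
    val Pair \<bullet> (val Pair \<bullet> ev e ds s \<bullet> ev e ds t) \<bullet> (val Pred \<bullet> ev e ds u)"
  by (simp_all add: QPos_def QNeg_def QDen_def MkQ_def eval_arith)

lemma qv_pair:
  "a \<in> D N \<Longrightarrow> b \<in> D N \<Longrightarrow> d \<in> D N \<Longrightarrow>
    qv (val Pair \<bullet> (val Pair \<bullet> a \<bullet> b) \<bullet> (val Pred \<bullet> d)) = (fr a - fr b) / max 1 (fr d)"
  by (simp add: qv_def fr_pred_sc)

lemma sat_QLe:
  assumes "ev e ds q \<in> D N" "ev e ds r \<in> D N"
  shows "sat D ap cn S e ds (QLe q r) \<longleftrightarrow> qv (ev e ds q) \<le> qv (ev e ds r)"
proof -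
  define a b d a' b' d' where
    "a = val Fst \<bullet> (val Fst \<bullet> ev e ds q)" "b = val Snd \<bullet> (val Fst \<bullet> ev e ds q)" "d = val Snd \<bullet> ev e ds q"
    "a' = val Fst \<bullet> (val Fst \<bullet> ev e ds r)" "b' = val Snd \<bullet> (val Fst \<bullet> ev e ds r)" "d' = val Snd \<bullet> ev e ds r"
  note defs = this
  have D: "a \<in> D N" "b \<in> D N" "d \<in> D N" "a' \<in> D N" "b' \<in> D N" "d' \<in> D N"
    using assms by (simp_all add: defs)
  have "sat D ap cn S e ds (QLe q r) \<longleftrightarrow>
      fr a * (fr d' + 1) + fr b' * (fr d + 1) \<le> fr a' * (fr d + 1) + fr b * (fr d' + 1)"
    \<comment> \<open>The recursion equations of multiplication would expand the products with the
      denominators \<open>sc d\<close>, which \<open>fr_ops\<close> is to turn into factors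
      \<open>fr d + 1\<close>.\<close>
    using D
    by (simp add: QLe_def Le_def eval_arith eval_QPos eval_QNeg eval_QDen fr_le
        del: mult_rec mult_left flip: defs)
  also have "\<dots> \<longleftrightarrow> (fr a - fr b) * (fr d' + 1) \<le> (fr a' - fr b') * (fr d + 1)"
    by (auto simp: algebra_simps)
  also have "\<dots> \<longleftrightarrow> (fr a - fr b) / (fr d + 1) \<le> (fr a' - fr b') / (fr d' + 1)"
    using fr_plus1_pos by (simp add: divide_le_eq le_divide_eq field_simps)
  finally show ?thesis by (simp add: qv_def flip: defs)
qed

lemma qv_QSub:
  assumes "x \<in> D N" "y \<in> D N"
  shows "qv (val QSub \<bullet> x \<bullet> y) = qv x - qv y"
proof -
  define a b d a' b' d' where
    "a = val Fst \<bullet> (val Fst \<bullet> x)" "b = val Snd \<bullet> (val Fst \<bullet> x)" "d = val Snd \<bullet> x"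
    "a' = val Fst \<bullet> (val Fst \<bullet> y)" "b' = val Snd \<bullet> (val Fst \<bullet> y)" "d' = val Snd \<bullet> y"
  note defs = this
  have D: "a \<in> D N" "b \<in> D N" "d \<in> D N" "a' \<in> D N" "b' \<in> D N" "d' \<in> D N"
    using assms by (simp_all add: defs)
  have "val QSub \<bullet> x \<bullet> y =
      val Pair \<bullet> (val Pair \<bullet> (a \<otimes> sc d' \<oplus> b' \<otimes> sc d) \<bullet> (b \<otimes> sc d' \<oplus> a' \<otimes> sc d)) \<bullet> (val Pred \<bullet> (sc d \<otimes> sc d'))"
    unfolding QSub_def using assms
    by (simp add: beta eval_QPos eval_QNeg eval_QDen eval_MkQ MkQ_def QPos_def QNeg_def QDen_def
        del: mult_rec mult_left flip: defs)
  moreover have "1 \<le> (fr d + 1) * (fr d' + 1)"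
    using mult_mono[of 1 "fr d + 1" 1 "fr d' + 1"] by simp
  ultimately have "qv (val QSub \<bullet> x \<bullet> y) =
      (fr a * (fr d' + 1) + fr b' * (fr d + 1) - (fr b * (fr d' + 1) + fr a' * (fr d + 1))) /
      ((fr d + 1) * (fr d' + 1))"
    using D by (simp add: qv_pair max_def del: mult_rec mult_left)
  also have "\<dots> = (fr a - fr b) / (fr d + 1) - (fr a' - fr b') / (fr d' + 1)"
    by (subst diff_frac_eq[OF fr_plus1_pos(2) fr_plus1_pos(2)]) (simp add: algebra_simps)
  finally show ?thesis by (simp add: qv_def flip: defs)
qed

lemma qv_QAbs:
  assumes "x \<in> D N"
  shows "qv (val QAbs \<bullet> x) = \<bar>qv x\<bar>"
proof -
  define a b d where
    "a = val Fst \<bullet> (val Fst \<bullet> x)" "b = val Snd \<bullet> (val Fst \<bullet> x)" "d = val Snd \<bullet> x"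
  note defs = this
  have D: "a \<in> D N" "b \<in> D N" "d \<in> D N" using assms by (simp_all add: defs)
  have "val QAbs \<bullet> x = val Pair \<bullet> (val Pair \<bullet> (a \<ominus> b \<oplus> (b \<ominus> a)) \<bullet> zr) \<bullet> (val Pred \<bullet> sc d)"
    unfolding QAbs_def using assms
    by (simp add: beta MkQ_def QPos_def QNeg_def QDen_def del: pred_rec flip: defs)
  then have "qv (val QAbs \<bullet> x) = (max 0 (fr a - fr b) + max 0 (fr b - fr a)) / (fr d + 1)"
    using D by (simp add: qv_pair fr_monus max_def[of 1] del: pred_rec)
  also have "\<dots> = \<bar>fr a - fr b\<bar> / (fr d + 1)" by (simp add: max_def abs_if)
  also have "\<dots> = \<bar>qv x\<bar>" using fr_nonneg[of d] by (simp add: qv_def abs_div flip: defs)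
  finally show ?thesis .
qed

lemma QDist_D: "ev e ds q \<in> D N \<Longrightarrow> ev e ds r \<in> D N \<Longrightarrow> ev e ds (QDist q r) \<in> D N"
  and qv_QDist: "ev e ds q \<in> D N \<Longrightarrow> ev e ds r \<in> D N \<Longrightarrow>
    qv (ev e ds (QDist q r)) = \<bar>qv (ev e ds q) - qv (ev e ds r)\<bar>"
  by (simp_all add: QDist_def eval_arith qv_QAbs qv_QSub)

definition inv1 :: "model_num \<Rightarrow> model_frac" where "inv1 m = 1 / max 1 (frac_of m)"

definition eps :: "model_num \<Rightarrow> model_frac" where "eps n = 1 / frac_of (pow2 n)"

lemma QInv_D: "ev e ds m \<in> D N \<Longrightarrow> ev e ds (QInv m) \<in> D N"
  and qv_QInv: "ev e ds m \<in> D N \<Longrightarrow> qv (ev e ds (QInv m)) = inv1 (\<alpha> (ev e ds m))"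
  by (simp_all add: QInv_def eval_MkQ qv_pair inv1_def fr_def[of "ev e ds m"])

text \<open>The summand \<open>1\<close> carries the induction: from \<open>a \<le> 2 ^ a\<close>
  alone the step would lack \<open>1 \<le> 2 ^ a\<close>.\<close>

lemma pow2_ge: "a + 1 \<le> pow2 a"
proof (induction a rule: num_induct)
  case (suc a)
  have "1 \<le> a + 1" by simp
  then have "1 \<le> pow2 a" using suc by (rule order_trans)
  then show ?case using suc by (auto simp: pow2_rec' intro: add_mono)
qed (intro tp_intros, simp add: pow2_rec')

lemma pow2_ge_1: "1 \<le> pow2 a"
  using pow2_ge[of a] by (rule order_trans[rotated]) simp

lemma Eps_D: "ev e ds n \<in> D N \<Longrightarrow> ev e ds (Eps n) \<in> D N"
  and qv_Eps: "ev e ds n \<in> D N \<Longrightarrow> qv (ev e ds (Eps n)) = eps (\<alpha> (ev e ds n))"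
proof -
  assume n: "ev e ds n \<in> D N"
  then show "ev e ds (Eps n) \<in> D N" unfolding Eps_def by (intro QInv_D) (simp add: eval_arith)
  have "1 \<le> frac_of (pow2 (\<alpha> (ev e ds n)))"
    using frac_of_le[of 1 "pow2 (\<alpha> (ev e ds n))"] pow2_ge_1 by (simp del: frac_of_le)
  then show "qv (ev e ds (Eps n)) = eps (\<alpha> (ev e ds n))"
    unfolding Eps_def using n by (subst qv_QInv) (simp_all add: eval_arith inv1_def eps_def max_def)
qed

lemma eps_pos [simp]: "0 < eps n"
  using pow2_ge_1[of n] by (simp add: eps_def less_le_trans[OF zero_less_one])

lemma eps_Suc: "eps n = 2 * eps (n + 1)"
proof -
  have "frac_of (pow2 (n + 1)) = 2 * frac_of (pow2 n)" unfolding pow2_rec' by simp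
  then show ?thesis by (simp add: eps_def)
qed

text \<open>It links the two scales: the errors in \<open>ULC_ef\<close> are given as
  \<open>1 / k\<close>, the tolerances of the relations on reals as \<open>2 ^ -n\<close>. At
  \<open>0\<close> both are \<open>1\<close>.\<close>

lemma eps_le_inv1: "eps n \<le> inv1 n"
proof -
  have "n \<le> pow2 n" using pow2_ge[of n] order_trans[of n "n + 1"] by simp
  then have "max 1 (frac_of n) \<le> frac_of (pow2 n)"
    using frac_of_le[of 1 "pow2 n"] pow2_ge_1[of n] by simp
  moreover have "0 < frac_of (pow2 n)" "0 < max 1 (frac_of n)"
    using pow2_ge_1[of n] less_le_trans[OF zero_less_one] by (auto simp: less_max_iff_disj)
  ultimately show ?thesis unfolding eps_def inv1_def by (intro divide_left_mono mult_pos_pos) auto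
qed

text \<open>A real is represented by the values of its approximations, not by a limit, which the
  field may lack.\<close>

definition rv :: "tm set \<Rightarrow> model_num \<Rightarrow> model_frac" where "rv x n = qv (x \<bullet> \<iota> n)"

definition is_real :: "tm set \<Rightarrow> bool" where
  "is_real x \<longleftrightarrow> (\<forall>n i. \<bar>rv x n - rv x (n + i)\<bar> \<le> eps (n + 1 + 1))"

lemma ev_tlc: "tlc 0 t \<Longrightarrow> ev e (d # ds) t = ev e [] t"
  by (rule eval_lc0)

lemma sat_IsReal:
  assumes "tlc 0 x" "ev e [] x \<in> D N1"
  shows "sat D ap cn S e ds (IsReal x) \<longleftrightarrow> is_real (ev e [] x)"
  using assms
  by (simp add: IsReal_def is_real_def rv_def ball_N sat_QLe QDist_D Eps_D qv_QDist qv_Eps ev_tlc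
      eval_arith \<iota>_ops(2-))

lemma sat_Approx:
  assumes "tlc 0 x" "ev e [] x \<in> D N1" "tlc 0 y" "ev e [] y \<in> D N1"
  shows "sat D ap cn S e ds (Approx x y) \<longleftrightarrow>
    (\<forall>n. \<iota> n \<in> S N \<longrightarrow> \<bar>rv (ev e [] x) n - rv (ev e [] y) n\<bar> \<le> eps n)"
  using assms
  by (simp add: Approx_def rv_def ball_N sat_QLe QDist_D Eps_D qv_QDist qv_Eps ev_tlc)

lemma sat_RLe:
  assumes "tlc 0 x" "ev e [] x \<in> D N1" "tlc 0 y" "ev e [] y \<in> D N1"
  shows "sat D ap cn S e ds (RLe x y) \<longleftrightarrow> (\<forall>n. rv (ev e [] x) n - rv (ev e [] y) n \<le> eps n)"
  using assms
  by (simp add: RLe_def rv_def ball_N sat_QLe Eps_D qv_QSub qv_Eps ev_tlc eval_arith)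

lemma sat_RLess:
  assumes "tlc 0 x" "ev e [] x \<in> D N1" "tlc 0 y" "ev e [] y \<in> D N1"
  shows "sat D ap cn S e ds (RLess x y) \<longleftrightarrow> (\<exists>n. eps n < rv (ev e [] y) n - rv (ev e [] x) n)"
  using assms
  by (simp add: RLess_def rv_def bex_N sat_QLe Eps_D qv_QSub qv_Eps ev_tlc eval_arith not_le)

lemma RDist_D:
  assumes "ev e [] x \<in> D N1" "ev e [] y \<in> D N1"
  shows "ev e [] (RDist x y) \<in> D N1"
  using assms by (auto simp: RDist_def eval_arith intro!: app_D[OF val_D(16)] app_D[OF app_D[OF val_D(15)]])

lemma rv_RDist:
  assumes "ev e [] x \<in> D N1" "ev e [] y \<in> D N1"
  shows "rv (ev e [] (RDist x y)) n = \<bar>rv (ev e [] x) (n + 1) - rv (ev e [] y) (n + 1)\<bar>"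
proof -
  have RSub: "val RSub \<bullet> X \<bullet> Y \<bullet> \<iota> n = val QSub \<bullet> (X \<bullet> \<iota> (n + 1)) \<bullet> (Y \<bullet> \<iota> (n + 1))"
    if "X \<in> D N1" "Y \<in> D N1" for X Y
    unfolding RSub_def using that by (simp add: beta \<iota>_ops(5))
  have RAbs: "val RAbs \<bullet> X \<bullet> \<iota> n = val QAbs \<bullet> (X \<bullet> \<iota> n)" if "X \<in> D N1" for X
    unfolding RAbs_def using that by (simp add: beta)
  have "val RSub \<bullet> ev e [] x \<bullet> ev e [] y \<in> D N1"
    using assms by (intro app_D[OF app_D[OF val_D(15)]])
  then show ?thesis
    using assms by (simp add: rv_def RDist_def eval_arith RAbs RSub qv_QAbs qv_QSub)
qed

lemma RInv_D: "ev e [] m \<in> D N \<Longrightarrow> ev e [] (RInv m) \<in> D N1"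
  using QInv_D[of e "[]" m] by (auto simp: RInv_def eval_arith intro: app_D[OF val_D(14)])

lemma rv_RInv:
  assumes "ev e [] m \<in> D N"
  shows "rv (ev e [] (RInv m)) n = inv1 (\<alpha> (ev e [] m))"
proof -
  have "val Const \<bullet> q \<bullet> \<iota> n = q" if "q \<in> D N" for q
    unfolding Const_def using that by (simp add: beta)
  then show ?thesis
    using assms QInv_D[of e "[]" m] by (simp add: rv_def RInv_def eval_arith qv_QInv)
qed

abbreviation "zero_real \<equiv> val (Const \<cdot> MkQ Zero Zero One)"
abbreviation "one_real \<equiv> val (Const \<cdot> MkQ One Zero One)"

definition in_unit :: "tm set \<Rightarrow> bool" where
  "in_unit x \<longleftrightarrow> is_real x \<and> (\<forall>n. rv zero_real n - rv x n \<le> eps n) \<and> (\<forall>n. rv x n - rv one_real n \<le> eps n)"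

lemma sat_UnitI:
  assumes "tlc 0 x" "ev e [] x \<in> D N1"
  shows "sat D ap cn S e ds (UnitI x) \<longleftrightarrow> in_unit (ev e [] x)"
proof -
  have c: "tfv (Const \<cdot> MkQ Zero Zero One) = {}" "tlc 0 (Const \<cdot> MkQ Zero Zero One)"
    "tfv (Const \<cdot> MkQ One Zero One) = {}" "tlc 0 (Const \<cdot> MkQ One Zero One)"
    by (simp_all add: MkQ_def)
  have "zero_real \<in> D N1" "one_real \<in> D N1"
    unfolding val_def by (rule eval_D0; simp add: MkQ_def)+
  then show ?thesis
    using assms c eval_closed[OF c(1,2)] eval_closed[OF c(3,4)]
    by (simp add: UnitI_def in_unit_def sat_IsReal sat_RLe del: eval.simps)
qed

lemma in_unit_real: "in_unit x \<Longrightarrow> is_real x"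
  by (simp add: in_unit_def)

text \<open>The tolerance at the smaller index would do; the sum of both spares later estimates the
  case distinction.\<close>

lemma is_real_diff:
  assumes "is_real x"
  shows "\<bar>rv x m - rv x n\<bar> \<le> eps (m + 1 + 1) + eps (n + 1 + 1)"
proof -
  have *: "\<bar>rv x p - rv x q\<bar> \<le> eps (p + 1 + 1)" if pq: "p \<le> q" for p q
  proof -
    obtain i where "q = p + i" using pq num_le_iff[of p q] by auto
    then show ?thesis using assms by (simp add: is_real_def)
  qed
  show ?thesis
  proof (cases "m \<le> n")
    case True
    then show ?thesis using *[OF True] eps_pos[of "n + 1 + 1"] by linarith
  next
    case False
    then have "\<bar>rv x n - rv x m\<bar> \<le> eps (n + 1 + 1)" by (intro *) simp
    then show ?thesis using eps_pos[of "m + 1 + 1"] by linarith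
  qed
qed

end

section \<open>Well-formedness of the formulas about reals\<close>

lemma tlc_reals [simp]:
  "tlc k (QInv m) = tlc k m" "tlc k (RInv m) = tlc k m" "tlc k (RDist x y) = (tlc k x \<and> tlc k y)"
  by (auto simp: QInv_def MkQ_def RInv_def RDist_def)

lemma lc_Le [simp]: "lc k (Le s t) = (tlc k s \<and> tlc k t)"
  by (auto simp: Le_def)

lemma lc_QLe [simp]: "tlc k q \<Longrightarrow> tlc k r \<Longrightarrow> lc k (QLe q r)"
  by (simp add: QLe_def QPos_def QNeg_def QDen_def)

lemma lc_reals [simp]:
  assumes "tlc 0 x"
  shows "lc 0 (IsReal x)" "lc 0 (UnitI x)" "tlc 0 y \<Longrightarrow> lc 0 (REq x y)" "tlc 0 y \<Longrightarrow> lc 0 (Approx x y)"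
    "tlc 0 y \<Longrightarrow> lc 0 (RLe x y)" "tlc 0 y \<Longrightarrow> lc 0 (RLess x y)" "lc 0 (RFun x)"
  using tlc_mono0[OF assms] tlc_mono0[of y]
  by (simp_all add: IsReal_def UnitI_def REq_def Approx_def RLe_def RLess_def RFun_def Let_def Eps_def
      QDist_def MkQ_def)

lemma wff_QLe [simp]:
  "tty \<Delta> q = Some N \<Longrightarrow> tty \<Delta> r = Some N \<Longrightarrow> wff \<Delta> (QLe q r)"
  by (simp add: QLe_def Le_def QPos_def QNeg_def QDen_def)

lemma wff_reals [simp]:
  assumes "x ofty N1"
  shows "wff [] (IsReal x)" "wff [] (UnitI x)" "y ofty N1 \<Longrightarrow> wff [] (REq x y)"
    "y ofty N1 \<Longrightarrow> wff [] (Approx x y)"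
    "y ofty N1 \<Longrightarrow> wff [] (RLe x y)" "y ofty N1 \<Longrightarrow> wff [] (RLess x y)"
  using tty_weaken[OF assms, of "[N, N]"] tty_weaken[OF assms, of "[N]"] assms
    tty_weaken[of y N1 "[N]"]
  by (simp_all add: IsReal_def UnitI_def REq_def Approx_def RLe_def RLess_def Eps_def
      QDist_def QInv_def MkQ_def tty.simps(4))

lemma internal_reals [simp]:
  "internal (QLe q r)" "internal (IsReal x)" "internal (UnitI x)" "internal (REq x y)"
  "internal (RLe x y)" "internal (RLess x y)" "internal (RFun f)" "internal (Le s t)"
  by (simp_all add: QLe_def Le_def IsReal_def UnitI_def REq_def RLe_def RLess_def RFun_def Let_def)

lemma wff_RFun [simp]: "f ofty N1 \<rightarrow> N1 \<Longrightarrow> wff [] (RFun f)"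
  by (simp add: RFun_def Let_def)

lemma wff_AllSt [simp]: "wff [] \<phi> \<Longrightarrow> wff [] (AllSt v \<phi>)"
  by (simp add: AllSt_def)

lemma wff_Le [simp]: "wff \<Delta> (Le s t) \<longleftrightarrow> tty \<Delta> s = Some N \<and> tty \<Delta> t = Some N"
  by (auto simp: Le_def)

lemma tty_reals [simp]:
  "tty \<Delta> x = Some N1 \<Longrightarrow> tty \<Delta> y = Some N1 \<Longrightarrow> tty \<Delta> (RDist x y) = Some N1"
  "tty \<Delta> m = Some N \<Longrightarrow> tty \<Delta> (RInv m) = Some N1"
  by (simp_all add: RDist_def RInv_def QInv_def MkQ_def)

lemma ULC_lang: "ULC_ns \<in> lang True" "ULC_ef modulus \<in> lang False"
  by (simp_all add: lang_def ULC_ns_def ULC_ef_def Let_def)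

section \<open>The theorem\<close>

lemma tlc_modulus [simp]: "tlc k modulus"
  by (simp add: tlc_typed)

section \<open>The effective statement\<close>

context num_model
begin

lemma app_N1 [simp]:
  "f \<in> D (N1 \<rightarrow> N1) \<Longrightarrow> x \<in> D N1 \<Longrightarrow> f \<bullet> x \<in> D N1"
  "F \<in> D (N \<rightarrow> N1 \<rightarrow> N1) \<Longrightarrow> n \<in> D N \<Longrightarrow> x \<in> D N1 \<Longrightarrow> F \<bullet> n \<bullet> x \<in> D N1"
  "F \<in> D (N \<rightarrow> N1 \<rightarrow> N1) \<Longrightarrow> n \<in> D N \<Longrightarrow> F \<bullet> n \<in> D (N1 \<rightarrow> N1)"
  "g \<in> D (N \<rightarrow> N1 \<rightarrow> N \<rightarrow> N) \<Longrightarrow> n \<in> D N \<Longrightarrow> x \<in> D N1 \<Longrightarrow> k \<in> D N \<Longrightarrow> g \<bullet> n \<bullet> x \<bullet> k \<in> D N"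
  by (metis app_D)+

lemma eval_modulus: "ev e ds modulus = val modulus"
  by (simp add: eval_closed tlc_typed)

lemma modulus_D [simp]:
  assumes "g \<in> D (N \<rightarrow> N1 \<rightarrow> N \<rightarrow> N)" "h \<in> D N1" "k \<in> D N" "x \<in> D N1"
  shows "val modulus \<bullet> g \<bullet> h \<bullet> k \<bullet> x \<in> D N"
proof -
  have "val modulus \<in> D ULC_ty" by (simp add: val_def eval_D0)
  then show ?thesis using assms by (metis app_D)
qed

lemma modulus_eq:
  assumes "g \<in> D (N \<rightarrow> N1 \<rightarrow> N \<rightarrow> N)" "h \<in> D N1" "x \<in> D N1"
  shows "val modulus \<bullet> g \<bullet> h \<bullet> \<iota> k \<bullet> x =
    g \<bullet> (h \<bullet> \<iota> (pow2 (k + 1 + 1 + 1))) \<bullet> x \<bullet> \<iota> (pow2 (k + 1 + 1 + 1))"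
  unfolding modulus_def Let_def using assms
  by (simp add: beta \<iota>_ops(5))

lemma inv1_pow2: "inv1 (pow2 n) = eps n"
proof -
  have "1 \<le> frac_of (pow2 n)" using frac_of_le[of 1 "pow2 n"] pow2_ge_1[of n] by simp
  then show ?thesis by (simp add: inv1_def eps_def)
qed

lemma ULC_ef_sat:
  assumes e: "typed_env D e"
  shows "sat D ap cn S e [] (ULC_ef modulus)"
proof -
  \<comment> \<open>The evaluated form of \<open>ULC_ef\<close>, shaped so that the goals left by
    the simplifier below match it. The indices \<open>m + 1\<close> come from the shift in
    \<open>RSub\<close>.\<close>
  have core: "\<exists>n. eps n < inv1 (\<alpha> k) - \<bar>rv (f \<bullet> x) (n + 1) - rv (f \<bullet> y) (n + 1)\<bar>"
    if D: "f \<in> D (N1 \<rightarrow> N1)" "F \<in> D (N \<rightarrow> N1 \<rightarrow> N1)" "g \<in> D (N \<rightarrow> N1 \<rightarrow> N \<rightarrow> N)" "h \<in> D N1"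
        "k \<in> D N" "x \<in> D N1" "y \<in> D N1"
      and F: "\<forall>n \<in> D N. \<forall>k \<in> D N. \<forall>x \<in> D N1. in_unit x \<longrightarrow> (\<forall>y \<in> D N1. in_unit y \<longrightarrow>
        (\<forall>m. \<bar>rv x (m + 1) - rv y (m + 1)\<bar> - inv1 (\<alpha> (g \<bullet> n \<bullet> x \<bullet> k)) \<le> eps m) \<longrightarrow>
        (\<forall>m. \<bar>rv (F \<bullet> n \<bullet> x) (m + 1) - rv (F \<bullet> n \<bullet> y) (m + 1)\<bar> - inv1 (\<alpha> k) \<le> eps m))"
      and f: "\<forall>k \<in> D N. \<forall>x \<in> D N1. in_unit x \<longrightarrow> (\<forall>n \<in> D N. \<alpha> (h \<bullet> k) \<le> \<alpha> n \<longrightarrow>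
        (\<forall>m. \<bar>rv (F \<bullet> n \<bullet> x) (m + 1) - rv (f \<bullet> x) (m + 1)\<bar> - inv1 (\<alpha> k) \<le> eps m))"
      and xy: "in_unit x" "in_unit y"
      and less: "eps m < inv1 (\<alpha> (val modulus \<bullet> g \<bullet> h \<bullet> k \<bullet> x)) - \<bar>rv x (m + 1) - rv y (m + 1)\<bar>"
    for f F g h k x y m
  proof -
    define j where "j = \<alpha> k + 1 + 1 + 1"
    define J where "J = \<iota> (pow2 j)"
    define M where "M = h \<bullet> J"
    have JM: "J \<in> D N" "M \<in> D N" "inv1 (\<alpha> J) = eps j"
      using D by (simp_all add: J_def M_def inv1_pow2)
    define a where "a = inv1 (\<alpha> (g \<bullet> M \<bullet> x \<bullet> J))"
    have a: "val modulus \<bullet> g \<bullet> h \<bullet> k \<bullet> x = g \<bullet> M \<bullet> x \<bullet> J"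
      using modulus_eq[of g h x "\<alpha> k"] D by (simp add: M_def J_def j_def)
    \<comment> \<open>The strict inequality is known at the single index \<open>m\<close>, but the
      hypothesis on \<open>F\<close> asks for the weak one at every \<open>n\<close>. Passing from
      \<open>m + 1\<close> to \<open>n + 1\<close> in both reals costs a quarter of
      \<open>eps m\<close> and a quarter of \<open>eps n\<close>; the gap \<open>eps m\<close> pays
      for the former, the tolerance \<open>eps n\<close> for the latter.\<close>
    have "\<bar>rv x (n + 1) - rv y (n + 1)\<bar> - a \<le> eps n" for n
    proof -
      note eps_Suc[of n] eps_Suc[of "n + 1"] eps_Suc[of "n + 1 + 1"]
        eps_Suc[of m] eps_Suc[of "m + 1"] eps_Suc[of "m + 1 + 1"]
        eps_pos[of "n + 1 + 1 + 1"] eps_pos[of "m + 1 + 1 + 1"]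
      then show ?thesis
        using is_real_diff[OF in_unit_real[OF xy(1)], of "n + 1" "m + 1"]
          is_real_diff[OF in_unit_real[OF xy(2)], of "n + 1" "m + 1"] less[unfolded a, folded a_def]
        by linarith
    qed
    then have "\<bar>rv (F \<bullet> M \<bullet> x) (j + 1) - rv (F \<bullet> M \<bullet> y) (j + 1)\<bar> - eps j \<le> eps j"
      using F D JM xy a_def by metis
    moreover have B: "\<bar>rv (F \<bullet> M \<bullet> z) (j + 1) - rv (f \<bullet> z) (j + 1)\<bar> - eps j \<le> eps j"
      if "z \<in> D N1" "in_unit z" for z
      using f that JM M_def by (metis order_refl)
    \<comment> \<open>Each of the three comparisons allows the error \<open>eps j\<close> plus the
      tolerance \<open>eps j\<close> of \<open>RLe\<close> at index \<open>j\<close>, in total six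
      times \<open>eps j\<close>. Strictness with witness \<open>j\<close> takes one more, which
      leaves one of the eight.\<close>
    moreover have "8 * eps j \<le> inv1 (\<alpha> k)"
      using eps_le_inv1[of "\<alpha> k"] eps_Suc[of "\<alpha> k"] eps_Suc[of "\<alpha> k + 1"] eps_Suc[of "\<alpha> k + 1 + 1"]
      unfolding j_def by linarith
    ultimately have "eps j < inv1 (\<alpha> k) - \<bar>rv (f \<bullet> x) (j + 1) - rv (f \<bullet> y) (j + 1)\<bar>"
      using B[OF D(6) xy(1)] B[OF D(7) xy(2)] eps_pos[of j] by linarith
    then show ?thesis ..
  qed
  show ?thesis
    using e unfolding ULC_ef_def Let_def
    by (simp add: sat_UnitI sat_RLe sat_RLess RDist_D RInv_D rv_RDist rv_RInv Le_def eval_arith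
        monus_zr_iff eval_modulus)
      (intro ballI impI allI; elim conjE exE; rule core; assumption)
qed

end

text \<open>
  The sum is taken by recursion on the number of summands. Thus quantifier-free induction shows that
  it bounds the entries, whereas induction on sequences is not available.
\<close>

definition seq_bound :: tm where
  "seq_bound =
    (let vl = (''l'', Seq N) in
     lam vl (Succ (Cn CRec \<cdot> (Len N \<cdot> FV vl) \<cdot> Zero \<cdot>
       lams [vr, vj] (Add \<cdot> FV vr \<cdot> (Cn (CNth N) \<cdot> FV vl \<cdot> FV vj)))))"

lemma seq_bound_closed [simp]: "tty \<Delta> seq_bound = Some (Seq N \<rightarrow> N)" "tfv seq_bound = {}"
  by (simp_all add: seq_bound_def Let_def tty_compute tfv_lam insert_Diff_if)

context num_model
begin

lemma seq_D [simp]: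
  "l \<in> D (Seq N) \<Longrightarrow> val (Len N) \<bullet> l \<in> D N"
  "l \<in> D (Seq N) \<Longrightarrow> i \<in> D N \<Longrightarrow> cn (CNth N) \<bullet> l \<bullet> i \<in> D N"
  using app_D[OF val_D(11)] app_D[OF app_D[OF cn_D'(6)]] by blast+

text \<open>An entry is at most the sum of all entries, and the outer \<open>Succ\<close> of
  \<open>seq_bound\<close> makes the inequality strict.\<close>

lemma nth_less_seq_bound:
  assumes l: "l \<in> D (Seq N)" and i: "i < \<alpha> (val (Len N) \<bullet> l)"
  shows "\<alpha> (cn (CNth N) \<bullet> l \<bullet> \<iota> i) < \<alpha> (val seq_bound \<bullet> l)"
proof -
  define W where "W = ev (env0((''l'', Seq N) := l)) []
    (lams [vr, vj] (Add \<cdot> FV vr \<cdot> (Cn (CNth N) \<cdot> FV (''l'', Seq N) \<cdot> FV vj)))"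
  have W: "W \<in> D (N \<rightarrow> N \<rightarrow> N)"
    unfolding W_def using l by (intro eval_D0) (simp_all add: tty_compute)
  have W_eq: "W \<bullet> r \<bullet> j = r \<oplus> cn (CNth N) \<bullet> l \<bullet> j" if "r \<in> D N" "j \<in> D N" for r j
    unfolding W_def using that l by (simp add: beta)
  have bound: "val seq_bound \<bullet> l = sc (cn CRec \<bullet> (val (Len N) \<bullet> l) \<bullet> zr \<bullet> W)"
    unfolding seq_bound_def Let_def using l by (simp add: val_lam W_def tty_compute eval_arith)
  have rec: "rep N (\<lambda>d. cn CRec \<bullet> d \<bullet> zr \<bullet> W)"
    by (rule rep_app[OF rep_app[OF rep_app[OF rep_const[OF cn_D'(3)] rep_id] rep_const] rep_const])
      (use W in simp_all)
  \<comment> \<open>With \<open>i\<close> as a parameter this is quantifier-free: if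
    \<open>i < d\<close>, the entry at \<open>i\<close> is at most the sum of the first
    \<open>d\<close> entries.\<close>
  have "sc (\<iota> i) \<ominus> d = zr \<longrightarrow> cn (CNth N) \<bullet> l \<bullet> \<iota> i \<ominus> cn CRec \<bullet> d \<bullet> zr \<bullet> W = zr" if "d \<in> D N" for d
    using that
  proof (induction d rule: N_induct)
    case rep
    show ?case using l by (intro rp_imp rp_eq rep_op2 rep_id rep_const rec) simp_all
  next
    case zero
    then show ?case by simp
  next
    case (suc d)
    let ?r = "cn CRec \<bullet> d \<bullet> zr \<bullet> W"
    have r: "?r \<in> D N" using suc W by simp
    have IH: "i < \<alpha> d \<Longrightarrow> \<alpha> (cn (CNth N) \<bullet> l \<bullet> \<iota> i) \<le> \<alpha> ?r"
      using suc r l by (simp add: monus_zr_iff \<alpha>_ops model_num_discrete del: monus_rec)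
    have "\<alpha> (cn (CNth N) \<bullet> l \<bullet> \<iota> i) \<le> \<alpha> ?r + \<alpha> (cn (CNth N) \<bullet> l \<bullet> d)" if "i \<le> \<alpha> d"
    proof (cases "i = \<alpha> d")
      case True
      then show ?thesis using suc(1) by simp
    next
      case False
      then have "\<alpha> (cn (CNth N) \<bullet> l \<bullet> \<iota> i) \<le> \<alpha> ?r" using IH that by simp
      then show ?thesis by (rule order_trans) simp
    qed
    then show ?case
      using suc(1) r l W by (simp add: monus_zr_iff \<alpha>_ops rec_succ_eq W_eq del: monus_rec)
  qed
  from this[of "val (Len N) \<bullet> l"] show ?thesis
    using l i W by (simp add: monus_zr_iff \<alpha>_ops bound model_num_discrete del: monus_rec)
qed

lemma sat_Less:
  assumes "ev e ds s \<in> D N" "ev e ds t \<in> D N"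
  shows "sat D ap cn S e ds (Less s t) \<longleftrightarrow> \<alpha> (ev e ds s) < \<alpha> (ev e ds t)"
  using assms by (simp add: Less_def Le_def eval_arith monus_zr_iff \<alpha>_ops model_num_discrete
      del: monus_rec monus_sc)

lemma sat_Mem:
  assumes "tlc 0 a" "tlc 0 l" "ev e [] l \<in> D (Seq N)"
  shows "sat D ap cn S e ds (Mem N a l) \<longleftrightarrow>
    (\<exists>i < \<alpha> (val (Len N) \<bullet> ev e [] l). ev e [] a = cn (CNth N) \<bullet> ev e [] l \<bullet> \<iota> i)"
  using assms by (simp add: Mem_def bex_N sat_Less ev_tlc eval_arith)

end

section \<open>Overspill and the nonstandard statement\<close>

locale num_st_model = num_model +
  assumes st_sat: "\<lbrakk>\<psi> \<in> T_st \<union> Ideal; \<psi> \<in> lang True; typed_env D e\<rbrakk> \<Longrightarrow> sat D ap cn S e [] \<psi>"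
begin

lemma st_app:
  assumes "f \<in> D (\<sigma> \<rightarrow> \<tau>)" "x \<in> D \<sigma>" "f \<in> S (\<sigma> \<rightarrow> \<tau>)" "x \<in> S \<sigma>"
  shows "f \<bullet> x \<in> S \<tau>"
  using st_sat[OF UnI1[OF T_st.st_app[of "FV (''f'', \<sigma> \<rightarrow> \<tau>)" \<sigma> \<tau> "FV (''x'', \<sigma>)"]],
      of "env0((''f'', \<sigma> \<rightarrow> \<tau>) := f, (''x'', \<sigma>) := x)"] assms
  by (simp add: lang_def)

lemma st_closed:
  assumes "t ofty \<sigma>" "tfv t = {}"
  shows "val t \<in> S \<sigma>"
  using st_sat[OF UnI1[OF T_st.st_closed[OF assms]], of env0] assms
  by (simp add: lang_def val_def)

lemma st_sc: "x \<in> D N \<Longrightarrow> x \<in> S N \<Longrightarrow> sc x \<in> S N"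
  using st_app[OF cn_D'(2)] st_closed[of "Cn CSucc" "N \<rightarrow> N"] by (simp add: val_def)

text \<open>Idealization is applied to \<open>z < y\<close> together with \<open>\<psi>\<close> for
  \<open>y\<close>: a \<open>y\<close> that works for all standard \<open>z\<close> exceeds every
  standard number, so it is not standard itself.\<close>

lemma overspill:
  fixes \<psi> :: fm
  defines "vy \<equiv> (''y'', N)" and "vz \<equiv> (''z'', N)" and "vl \<equiv> (''l'', Seq N)"
  assumes e: "typed_env D e" and \<psi>: "wff [] \<psi>" "internal \<psi>" "vz \<notin> ffv \<psi>" "vl \<notin> ffv \<psi>"
    and st: "\<And>d. d \<in> D N \<Longrightarrow> d \<in> S N \<Longrightarrow> sat D ap cn S (e(vy := d)) [] \<psi>"
  shows "\<exists>d \<in> D N. d \<notin> S N \<and> sat D ap cn S (e(vy := d)) [] \<psi>"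
proof -
  let ?\<phi> = "Less (FV vz) (FV vy) \<^bold>\<and> \<psi>"
  let ?I = "AllSt vl (ExV vy (AllV vz (Mem (snd vz) (FV vz) (FV vl) \<^bold>\<longrightarrow> ?\<phi>))) \<^bold>\<longrightarrow> ExV vy (AllSt vz ?\<phi>)"
  have v: "snd vy = N" "snd vz = N" "snd vl = Seq N" "vy \<noteq> vz" "vy \<noteq> vl" "vz \<noteq> vl"
    by (simp_all add: vz_def vy_def vl_def)
  have w: "wff [] ?\<phi>" "internal ?\<phi>" "wff [] (Mem N (FV vz) (FV vl))"
    using \<psi> by (simp_all add: Less_def vz_def vy_def vl_def Mem_def)
  have lc: "lc 0 \<psi>" "lc 0 (Less (FV vz) (FV vy))" "lc 0 (Mem N (FV vz) (FV vl))"
    using lc_wff[OF \<psi>(1)] lc_wff[OF w(3)] by (simp_all add: Less_def)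
  have "?I \<in> Ideal"
    by (rule Ideal.intros) (use w \<psi> in \<open>auto simp: vz_def vy_def vl_def Less_def Le_def\<close>)
  moreover have "?I \<in> lang True" using w by (simp add: lang_def vz_def)
  ultimately have "sat D ap cn S e [] ?I" using e st_sat by blast
  moreover have eq: "sat D ap cn S (e(vl := l, vy := d, vz := c)) [] \<psi> = sat D ap cn S (e(vy := d)) [] \<psi>"
    "sat D ap cn S (e(vy := d, vz := c)) [] \<psi> = sat D ap cn S (e(vy := d)) [] \<psi>" for l d c
    by (rule sat_cong; use \<psi> in auto)+
  have "sat D ap cn S e [] ?I \<longleftrightarrow>
      ((\<forall>l \<in> D (Seq N). l \<in> S (Seq N) \<longrightarrow> (\<exists>d \<in> D N. \<forall>c \<in> D N.
        (\<exists>i < \<alpha> (val (Len N) \<bullet> l). c = cn (CNth N) \<bullet> l \<bullet> \<iota> i) \<longrightarrow>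
        \<alpha> c < \<alpha> d \<and> sat D ap cn S (e(vy := d)) [] \<psi>)) \<longrightarrow>
      (\<exists>d \<in> D N. \<forall>c \<in> D N. c \<in> S N \<longrightarrow> \<alpha> c < \<alpha> d \<and> sat D ap cn S (e(vy := d)) [] \<psi>))"
    using lc v by (simp add: eq sat_Mem sat_Less)
  moreover have "\<exists>d \<in> D N. \<forall>c \<in> D N. (\<exists>i < \<alpha> (val (Len N) \<bullet> l). c = cn (CNth N) \<bullet> l \<bullet> \<iota> i) \<longrightarrow>
      \<alpha> c < \<alpha> d \<and> sat D ap cn S (e(vy := d)) [] \<psi>" if l: "l \<in> D (Seq N)" "l \<in> S (Seq N)" for l
  proof -
    \<comment> \<open>The number required for a standard sequence is the value of a closed term at a
      standard argument. Hence it is standard, and \<open>\<psi>\<close> is known for it.\<close>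
    have "val seq_bound \<in> D (Seq N \<rightarrow> N)" by (simp add: val_def eval_D0)
    then have d: "val seq_bound \<bullet> l \<in> D N" "val seq_bound \<bullet> l \<in> S N"
      using l st_closed[of seq_bound] by (auto intro: app_D st_app)
    have "\<forall>c \<in> D N. (\<exists>i < \<alpha> (val (Len N) \<bullet> l). c = cn (CNth N) \<bullet> l \<bullet> \<iota> i) \<longrightarrow>
        \<alpha> c < \<alpha> (val seq_bound \<bullet> l) \<and> sat D ap cn S (e(vy := val seq_bound \<bullet> l)) [] \<psi>"
      using nth_less_seq_bound[OF l(1)] st[OF d] by blast
    then show ?thesis using d(1) by (rule bexI)
  qed
  ultimately obtain d where d: "d \<in> D N"
      "\<And>c. c \<in> D N \<Longrightarrow> c \<in> S N \<Longrightarrow> \<alpha> c < \<alpha> d \<and> sat D ap cn S (e(vy := d)) [] \<psi>"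
    by blast
  \<comment> \<open>The formula \<open>\<psi>\<close> stands in the scope of the quantifier over
    standard \<open>z\<close>, so one standard number is needed to release it. If \<open>d\<close>
    were standard, \<open>z = d\<close> would give \<open>d < d\<close>.\<close>
  have "zr \<in> S N" using st_closed[of Zero N] by (simp add: val_def)
  then show ?thesis using d(1) d(2)[of d] d(2)[of zr] by (intro bexI[of _ d]) auto
qed

text \<open>The values of \<open>f\<close> have to converge at the fixed rate because the main
  estimate moves between their approximations at \<open>k\<close> and at
  \<open>k + 3\<close>.\<close>

lemma sat_RFun_real:
  assumes "sat D ap cn S e [] (RFun (FV v))" "e v = f" "typed_env D e" "snd v = N1 \<rightarrow> N1"
    "x \<in> D N1" "in_unit x"
  shows "is_real (f \<bullet> x)"
proof -
  let ?u = "(''u'', N1)"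
  have v: "v \<noteq> ?u" using assms(4) by auto
  have f: "f \<in> D (N1 \<rightarrow> N1)" using assms(2,3,4) unfolding typed_env_def by metis
  have "sat D ap cn S e [] (AllV ?u (IsReal (FV ?u) \<^bold>\<longrightarrow> IsReal (FV v \<cdot> FV ?u)))"
    using assms(1) by (simp only: RFun_def Let_def sat.simps)
  then have "sat D ap cn S (e(?u := x)) [] (IsReal (FV ?u) \<^bold>\<longrightarrow> IsReal (FV v \<cdot> FV ?u))"
    using assms(5) by (subst (asm) sat_AllV) simp_all
  then show ?thesis using assms(2,5,6) v f in_unit_real by (simp add: sat_IsReal)
qed

lemma ULC_ns_sat:
  assumes e: "typed_env D e"
  shows "sat D ap cn S e [] ULC_ns"
proof -
  have core: "\<bar>rv (f \<bullet> x) k - rv (f \<bullet> y) k\<bar> \<le> eps k"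
    if D: "f \<in> D (N1 \<rightarrow> N1)" "F \<in> D (N \<rightarrow> N1 \<rightarrow> N1)" "x \<in> D N1" "y \<in> D N1" "x \<in> S N1" "\<iota> k \<in> S N"
      and real: "is_real (f \<bullet> x)" "is_real (f \<bullet> y)"
      and F: "\<forall>n \<in> D N. n \<in> S N \<longrightarrow> (\<forall>x \<in> D N1. x \<in> S N1 \<longrightarrow> in_unit x \<longrightarrow>
        (\<forall>y \<in> D N1. in_unit y \<longrightarrow>
          (\<forall>m. \<iota> m \<in> S N \<longrightarrow> \<bar>rv x m - rv y m\<bar> \<le> eps m) \<longrightarrow>
          (\<forall>m. \<iota> m \<in> S N \<longrightarrow> \<bar>rv (F \<bullet> n \<bullet> x) m - rv (F \<bullet> n \<bullet> y) m\<bar> \<le> eps m)))"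
      and f: "\<forall>x \<in> D N1. in_unit x \<longrightarrow> (\<forall>n \<in> D N. n \<notin> S N \<longrightarrow>
        (\<forall>m. \<iota> m \<in> S N \<longrightarrow> \<bar>rv (F \<bullet> n \<bullet> x) m - rv (f \<bullet> x) m\<bar> \<le> eps m))"
      and xy: "in_unit x" "in_unit y" "\<forall>m. \<iota> m \<in> S N \<longrightarrow> \<bar>rv x m - rv y m\<bar> \<le> eps m"
    for f F x y k
  proof -
    \<comment> \<open>The precision is again standard, so the hypotheses on \<open>F\<close> and
      \<open>f\<close>, which speak of standard precisions only, can be used at it.\<close>
    define m where "m = k + 1 + 1 + 1"
    have "sc (sc (sc (\<iota> k))) \<in> S N" using D by (intro st_sc) simp_all
    then have m: "\<iota> m \<in> S N" by (simp add: m_def \<iota>_ops(5))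
    let ?F = "(''F'', N \<rightarrow> N1 \<rightarrow> N1)" and ?y = "(''y'', N)" and ?a = "(''a'', N1)" and ?b = "(''b'', N1)"
      and ?m = "(''m'', N)"
    \<comment> \<open>Closeness of the values of \<open>F\<close> at all standard precisions is
      external. Its instance at \<open>m\<close> is internal, with \<open>F\<close>,
      \<open>x\<close>, \<open>y\<close> and \<open>m\<close> as parameters.\<close>
    let ?\<psi> = "QLe (QDist (FV ?F \<cdot> FV ?y \<cdot> FV ?a \<cdot> FV ?m) (FV ?F \<cdot> FV ?y \<cdot> FV ?b \<cdot> FV ?m)) (Eps (FV ?m))"
    let ?e = "env0(?F := F, ?a := x, ?b := y, ?m := \<iota> m)"
    have \<psi>: "sat D ap cn S (?e(?y := d)) [] ?\<psi> \<longleftrightarrow> \<bar>rv (F \<bullet> d \<bullet> x) m - rv (F \<bullet> d \<bullet> y) m\<bar> \<le> eps m"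
      if "d \<in> D N" for d
      using D that by (simp add: sat_QLe QDist_D Eps_D qv_QDist qv_Eps rv_def)
    have "\<exists>d \<in> D N. d \<notin> S N \<and> sat D ap cn S (?e(?y := d)) [] ?\<psi>"
    proof (rule overspill)
      show "typed_env D ?e" using D by simp
      show "wff [] ?\<psi>" by (simp add: QDist_def Eps_def QInv_def MkQ_def)
      show "sat D ap cn S (?e(?y := d)) [] ?\<psi>" if "d \<in> D N" "d \<in> S N" for d
        unfolding \<psi>[OF that(1)] using F D xy m that by blast
    qed (auto simp: QLe_def Le_def QPos_def QNeg_def QDen_def QDist_def Eps_def QInv_def MkQ_def)
    then obtain M where M: "M \<in> D N" "M \<notin> S N" "\<bar>rv (F \<bullet> M \<bullet> x) m - rv (F \<bullet> M \<bullet> y) m\<bar> \<le> eps m"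
      using \<psi> by blast
    have f': "\<bar>rv (F \<bullet> M \<bullet> z) m - rv (f \<bullet> z) m\<bar> \<le> eps m" if "z \<in> D N1" "in_unit z" for z
      using f M m that by blast
    have r: "\<bar>rv z k - rv z m\<bar> \<le> eps (k + 1 + 1)" if "is_real z" for z
      using that unfolding is_real_def m_def by (metis add.assoc)
    \<comment> \<open>Going from \<open>k\<close> to \<open>m\<close> for both values costs twice
      \<open>eps (k + 2)\<close>, a half of \<open>eps k\<close>; the three comparisons at
      \<open>m = k + 3\<close> cost three eighths.\<close>
    show ?thesis
      using f'[OF D(3) xy(1)] f'[OF D(4) xy(2)] M(3) r[OF real(1)] r[OF real(2)]
        eps_Suc[of k] eps_Suc[of "k + 1"] eps_Suc[of "k + 1 + 1"] eps_pos[of m]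
      unfolding m_def by linarith
  qed
  \<comment> \<open>The simplifier leaves the formulas \<open>RFun\<close> unevaluated; the two
    facts on real values that \<open>core\<close> needs are obtained from them by
    \<open>sat_RFun_real\<close>.\<close>
  show ?thesis
    using e unfolding ULC_ns_def Let_def
    by (simp add: sat_UnitI sat_Approx)
      (intro ballI impI allI; elim conjE exE; rule core;
        (assumption | rule sat_RFun_real, assumption, simp, simp, simp, assumption, assumption))
qed

end

text \<open>If any model refutes, then \<open>num_struct\<close> consists of the numbers of the
  chosen one, so the results proved in the locales apply to it. They exclude both ways of
  refuting.\<close>

lemma no_refuting_model: "\<not> refutes (M :: (ty \<Rightarrow> tm set set) \<times> _)"
proof
  assume "refutes M"
  then have ex: "\<exists>M :: (ty \<Rightarrow> tm set set) \<times> _. refutes M" by blast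
  obtain D ap cn S where R: "refuting_model = (D, ap, cn, S)" by (metis surj_pair)
  have r: "refutes (D, ap, cn, S)" using refutes_refuting_model[OF ex] R by simp
  have num: "num_model D ap cn S"
  proof (intro num_model.intro num_model_axioms.intro)
    show "epra_model D ap cn S" using r by (simp add: refutes_def)
    show "num_struct = N_struct (D, ap, cn, S)" using ex R by (auto simp: num_struct_def)
  qed
  then have "\<exists>e. typed_env D e \<and> \<not> sat D ap cn S e [] ULC_ns"
    and st: "\<forall>\<psi> \<in> (T_st \<union> Ideal) \<inter> lang True. \<forall>e. typed_env D e \<longrightarrow> sat D ap cn S e [] \<psi>"
    using r num_model.ULC_ef_sat[OF num] unfolding refutes_def by auto
  moreover have "num_st_model D ap cn S"
    using num st by (intro num_st_model.intro num_st_model_axioms.intro) auto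
  ultimately show False using num_st_model.ULC_ns_sat by blast
qed

theorem theorem3p17:
  shows "P0_proves ULC_ns \<and>
    (\<exists>t. t ofty ULC_ty \<and> tfv t = {} \<and> EPRA_proves (ULC_ef t))"
proof
  have L: "L_st = lang True" "L_int = lang False" by (auto simp: L_st_def L_int_def lang_def)
  have sub: "lang False \<subseteq> lang True" by (auto simp: lang_def)
  let ?T = "EPRA \<union> T_st \<union> Ideal"
  have "prov (lang True) ?T {} ULC_ns"
  proof (rule ccontr)
    assume "\<not> ?thesis"
    then obtain D :: "ty \<Rightarrow> tm set set" and ap cn S e where M: "typed_structure D ap cn"
        "\<forall>\<psi> \<in> ?T \<inter> lang True. \<forall>e. typed_env D e \<longrightarrow> sat D ap cn S e [] \<psi>"
        "typed_env D e" "\<not> sat D ap cn S e [] ULC_ns"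
      using completeness[of ?T True ULC_ns] ULC_lang by blast
    have "epra_model D ap cn S"
      by (rule epra_model.intro) (use M sub in auto)
    then have "refutes (D, ap, cn, S)"
      using M by (auto simp: refutes_def)
    then show False using no_refuting_model by blast
  qed
  then show "P0_proves ULC_ns"
    unfolding P0_proves_def L by (rule prov_mono[rotated]) auto
  have "prov (lang False) EPRA {} (ULC_ef modulus)"
  proof (rule ccontr)
    assume "\<not> ?thesis"
    then obtain D :: "ty \<Rightarrow> tm set set" and ap cn S e where M: "typed_structure D ap cn"
        "\<forall>\<psi> \<in> EPRA \<inter> lang False. \<forall>e. typed_env D e \<longrightarrow> sat D ap cn S e [] \<psi>"
        "typed_env D e" "\<not> sat D ap cn S e [] (ULC_ef modulus)"
      using completeness[of EPRA False "ULC_ef modulus"] ULC_lang by blast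
    have "epra_model D ap cn S"
      by (rule epra_model.intro) (use M in auto)
    then have "refutes (D, ap, cn, S)"
      using M by (auto simp: refutes_def)
    then show False using no_refuting_model by blast
  qed
  then show "\<exists>t. t ofty ULC_ty \<and> tfv t = {} \<and> EPRA_proves (ULC_ef t)"
    unfolding EPRA_proves_def L by (intro exI[of _ modulus]) simp
qed

end
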